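(* Let $(\mathcal{A},\Sigma(\mathcal{A}),\mu)$ be a measure space with $\mu$ positive and $\sigma$-finite, let $\mathcal{H}=\int^\oplus_{\mathcal{A}}\mathcal{H}^\alpha\,d\mu(\alpha)$ be a direct integral Hilbert space, and let $Q$ be a Hermitian quadratic form on a dense subspace $\mathcal{D}\subset\mathcal{H}$. Assume: (H1) $Q$ is closable and orthogonally additive; (H2) $\mu$ is point supported and $\mu(\{\alpha\})>0$ for every $\alpha\in\mathcal{A}$; (H3) for every $\alpha\in\mathcal{A}$ the quadratic form $q_\alpha$ on $P_\alpha\mathcal{D}\subset\mathcal{H}^\alpha$ is strongly representable by a self-adjoint operator $T_\alpha$ on $\mathcal{H}^\alpha$. Let $E^\alpha(\cdot)$ be the resolution of the identity of $T_\alpha$, let $E(\sigma)=\int^\oplus_{\mathcal{A}}E^\alpha(\sigma)\,d\mu(\alpha)$ for Borel $\sigma\subset\mathbb{R}$, and let $T=\int_{\mathbb{R}}\lambda\,dE(\lambda)$ be the associated self-adjoint operator on $\mathcal{H}$, with domain $\mathcal{D}(T)=\{\Phi\in\mathcal{H}\mid\int_{\mathbb{R}}\lambda^2\,d\nu_\Phi(\lambda)<\infty\}$, where $\nu_\Phi(\cdot)=\|E(\cdot)\Phi\|^2$. Assume in addition that $\mathcal{D}\subset\mathcal{D}(|T|^{1/2})$. Then $Q$ is strongly representable by $T$. The extension $(\widehat Q,\widehat{\mathcal{D}})$ of $(Q,\mathcal{D})$ is given by $\widehat{\mathcal{D}}=\mathcal{D}(|T|^{1/2})$ and $$\widehat Q(\Phi)=\langle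 |T|^{1/2}\Phi,(\operatorname{sgn}T)|T|^{1/2}\Phi\rangle=\int_{\mathbb{R}}\lambda\,d\nu_\Phi(\lambda),\qquad \Phi\in\widehat{\mathcal{D}},$$ where $\operatorname{sgn}T:=E((0,\infty))-E((-\infty,0))$.
   Context: All Hilbert spaces are complex and separable; inner products are antilinear in the first entry. Quadratic forms. A Hermitian quadratic form $Q$ on a dense subspace $\mathcal{D}\subset\mathcal{H}$ is the diagonal $Q(\Phi):=Q(\Phi,\Phi)$ of a sesquilinear form $Q:\mathcal{D}\times\mathcal{D}\to\mathbb{C}$ (antilinear in the first entry, linear in the second) with $Q(\Phi,\Psi)=\overline{Q(\Psi,\Phi)}$. It is closable if for every sequence $\{\Phi_n\}\subset\mathcal{D}$ with $\Phi_n\to0$ in $\mathcal{H}$ and $\lim_{n,m\to\infty}Q(\Phi_n-\Phi_m)=0$ one has $\lim_nQ(\Phi_n)=0$. A form $\widehat Q$ on $\widehat{\mathcal{D}}$ extends $(Q,\mathcal{D})$ if $\mathcal{D}\subset\widehat{\mathcal{D}}\subset\mathcal{H}$ and $\widehat Q|_{\mathcal{D}}=Q$. Strong representability. Let $T$ be self-adjoint with resolution of the identity $E(\cdot)$ and $\nu_\Phi(\sigma)=\|E(\sigma)\Phi\|^2$. The spectral norm is $|||\Phi|||_E^2=\int_{\mathbb{R}}(1+|\lambda|)\,d\nu_\Phi(\lambda)$, $\Phi\in\mathcal{D}(|T|^{1/2})$. A Hermitian quadratic form $(Q,\mathcal{D})$ is strongly representable by $T$ if (1) there is an extension $(\widehat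 Q,\widehat{\mathcal{D}})$ of $(Q,\mathcal{D})$ with $\mathcal{D}(T)\subset\widehat{\mathcal{D}}$, and $\mathcal{D}\subset\mathcal{D}(|T|^{1/2})$; (2) $\widehat{\mathcal{D}}$ is the closure of $\mathcal{D}$ (in $\mathcal{D}(|T|^{1/2})$) with respect to $|||\cdot|||_E$; (3) $\widehat Q(\Phi)=\int_{\mathbb{R}}\lambda\,d\nu_\Phi(\lambda)$ for all $\Phi\in\widehat{\mathcal{D}}$. Direct integrals. $\int^\oplus_{\mathcal{A}}\mathcal{H}^\alpha\,d\mu(\alpha)$ is the usual direct integral of a $\mu$-measurable field of separable Hilbert spaces, with $\|\Phi\|^2=\int_{\mathcal{A}}\|\Phi(\alpha)\|_\alpha^2\,d\mu(\alpha)$. For $\Delta\in\Sigma(\mathcal{A})$, $P_\Delta$ is the orthogonal projection onto $\mathcal{H}_\Delta=\int_\Delta^\oplus\mathcal{H}^\alpha\,d\mu(\alpha)$; $P_\alpha:=P_{\{\alpha\}}$, and $P_\alpha\mathcal{D}$ is identified with the subspace $\{\Phi(\alpha)\mid\Phi\in\mathcal{D}\}$ of $\mathcal{H}^\alpha$. Orthogonal additivity. $(Q,\mathcal{D})$ is orthogonally additive if: (i) $P_\Delta\mathcal{D}\subset\mathcal{D}$ for all $\Delta\in\Sigma(\mathcal{A})$; (ii) for each $\Phi\in\mathcal{D}$ there is $M_\Phi>0$ with $|Q(P_\Delta\Phi)|<M_\Phi$ for all $\Delta\in\Sigma(\mathcal{A})$; (iii) for each finite measurable partition $\{\Delta_i\}_{i=1}^N$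 of a $\Delta\in\Sigma(\mathcal{A})$ and each $\Phi\in\mathcal{D}$, $Q(P_\Delta\Phi)=\sum_{i=1}^NQ(P_{\Delta_i}\Phi)$. Point supported. $\mu$ is point supported if $\mathcal{A}$ is countable, $\Sigma(\mathcal{A})$ is the set of all subsets of $\mathcal{A}$, and $\mu(\Delta)=\sum_{x\in\Delta}\mu(\{x\})$ for all $\Delta\subset\mathcal{A}$. Forms $q_\alpha$. Under (H1), (H2), $q_\alpha$ is the Hermitian quadratic form on $P_\alpha\mathcal{D}$ given by $q_\alpha(\Phi(\alpha))=Q(P_\alpha\Phi)/\mu(\{\alpha\})$, $\Phi\in\mathcal{D}$ (its sesquilinear form is obtained by polarisation). *)

theory Defs
  imports "HOL-Analysis.Analysis" "HOL-Algebra.Module"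
begin

section \<open>Complex Hilbert spaces with explicit carrier\<close>

text \<open>
  The fibres of a direct integral vary with the base point and the elements of the direct
  integral are equivalence classes, so Hilbert spaces are records over the module structures of
  \<open>HOL-Algebra\<close>, with scalar ring the complex numbers.  The inherited
  fields \<open>mult\<close> and \<open>one\<close> of these records play no role.
\<close>

definition complex_ring :: "complex ring"
  where "complex_ring = \<lparr> carrier = UNIV, mult = (*), one = 1, zero = 0, add = (+) \<rparr>"

record 'v hilbert = "(complex, 'v) module" +
  cinner :: "'v \<Rightarrow> 'v \<Rightarrow> complex" (\<open>\<langle>_,/ _\<rangle>\<index>\<close>)

definition hnorm :: "('v, 'z) hilbert_scheme \<Rightarrow> 'v \<Rightarrow> real"
  where "hnorm H x = sqrt (Re (cinner H x x))"

text \<open>The guard is needed because \<^locale>\<open>Metric_space\<close> asks for nonnegativity and symmetry everywhere.\<close>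

definition hdist :: "('v, 'z) hilbert_scheme \<Rightarrow> 'v \<Rightarrow> 'v \<Rightarrow> real"
  where "hdist H x y =
    (if x \<in> carrier H \<and> y \<in> carrier H then hnorm H (x \<ominus>\<^bsub>H\<^esub> y) else 0)"

definition htopology :: "('v, 'z) hilbert_scheme \<Rightarrow> 'v topology"
  where "htopology H = Metric_space.mtopology (carrier H) (hdist H)"

text \<open>Inner products are antilinear in the first entry.\<close>

locale complex_inner_space = Module.module complex_ring H
  for H :: "('v, 'z) hilbert_scheme" (structure) +
  assumes cinner_commute:
      "\<lbrakk>x \<in> carrier H; y \<in> carrier H\<rbrakk> \<Longrightarrow> \<langle>x, y\<rangle> = cnj \<langle>y, x\<rangle>"
    and cinner_add_right:
      "\<lbrakk>x \<in> carrier H; y \<in> carrier H; z \<in> carrier H\<rbrakk> \<Longrightarrow> \<langle>x, y \<oplus> z\<rangle> = \<langle>x, y\<rangle> + \<langle>x, z\<rangle>"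
    and cinner_smult_right:
      "\<lbrakk>x \<in> carrier H; y \<in> carrier H\<rbrakk> \<Longrightarrow> \<langle>x, c \<odot> y\<rangle> = c * \<langle>x, y\<rangle>"
    and cinner_ge_zero: "x \<in> carrier H \<Longrightarrow> 0 \<le> Re \<langle>x, x\<rangle>"
    and cinner_eq_zero: "\<lbrakk>x \<in> carrier H; \<langle>x, x\<rangle> = 0\<rbrakk> \<Longrightarrow> x = \<zero>"
begin

lemma cinner_zero_right: "x \<in> carrier H \<Longrightarrow> \<langle>x, \<zero>\<rangle> = 0"
  using cinner_add_right[of x \<zero> \<zero>] by simp

lemma cinner_uminus_right:
  assumes "x \<in> carrier H" "y \<in> carrier H"
  shows "\<langle>x, \<ominus> y\<rangle> = - \<langle>x, y\<rangle>"
proof -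
  have "\<langle>x, y \<oplus> \<ominus> y\<rangle> = \<langle>x, y\<rangle> + \<langle>x, \<ominus> y\<rangle>"
    using assms by (intro cinner_add_right) auto
  moreover have "\<langle>x, y \<oplus> \<ominus> y\<rangle> = 0"
    using assms by (simp add: M.r_neg cinner_zero_right)
  ultimately show ?thesis
    by (metis add.inverse_unique)
qed

lemma cinner_minus_right:
  "\<lbrakk>x \<in> carrier H; y \<in> carrier H; z \<in> carrier H\<rbrakk> \<Longrightarrow> \<langle>x, y \<ominus> z\<rangle> = \<langle>x, y\<rangle> - \<langle>x, z\<rangle>"
  by (simp add: a_minus_def cinner_add_right cinner_uminus_right)

lemma cinner_add_left:
  "\<lbrakk>x \<in> carrier H; y \<in> carrier H; z \<in> carrier H\<rbrakk> \<Longrightarrow> \<langle>x \<oplus> y, z\<rangle> = \<langle>x, z\<rangle> + \<langle>y, z\<rangle>"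
  using cinner_commute[of "x \<oplus> y" z] cinner_commute[of x z] cinner_commute[of y z]
  by (simp add: cinner_add_right)

lemma cinner_minus_left:
  "\<lbrakk>x \<in> carrier H; y \<in> carrier H; z \<in> carrier H\<rbrakk> \<Longrightarrow> \<langle>x \<ominus> y, z\<rangle> = \<langle>x, z\<rangle> - \<langle>y, z\<rangle>"
  using cinner_commute[of "x \<ominus> y" z] cinner_commute[of x z] cinner_commute[of y z]
  by (simp add: cinner_minus_right)

lemma smult_in_carrier: "x \<in> carrier H \<Longrightarrow> c \<odot> x \<in> carrier H"
  by (intro smult_closed) (auto simp: complex_ring_def)

lemma cinner_smult_left:
  "\<lbrakk>x \<in> carrier H; y \<in> carrier H\<rbrakk> \<Longrightarrow> \<langle>c \<odot> x, y\<rangle> = cnj c * \<langle>x, y\<rangle>"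
  using cinner_commute[of "c \<odot> x" y] cinner_commute[of x y]
  by (simp add: cinner_smult_right smult_in_carrier)

lemma cinner_self: "x \<in> carrier H \<Longrightarrow> \<langle>x, x\<rangle> = of_real ((hnorm H x)\<^sup>2)"
proof -
  assume x: "x \<in> carrier H"
  have "Im \<langle>x, x\<rangle> = 0"
    using arg_cong[OF cinner_commute[OF x x], of Im] by simp
  then show ?thesis
    using cinner_ge_zero[OF x] by (simp add: hnorm_def complex_eq_iff)
qed

lemma hnorm_ge_zero [simp]: "x \<in> carrier H \<Longrightarrow> 0 \<le> hnorm H x"
  by (simp add: hnorm_def cinner_ge_zero)

lemma hnorm_eq_zero_iff: "x \<in> carrier H \<Longrightarrow> hnorm H x = 0 \<longleftrightarrow> x = \<zero>"
  using cinner_self[of x] cinner_eq_zero[of x] cinner_zero_right[of \<zero>]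
  by (auto simp: hnorm_def)

lemma cinner_cauchy_schwarz:
  assumes x: "x \<in> carrier H" and y: "y \<in> carrier H"
  shows "cmod \<langle>x, y\<rangle> \<le> hnorm H x * hnorm H y"
proof (cases "y = \<zero>")
  case True
  then show ?thesis using x y by (simp add: cinner_zero_right)
next
  case False
  define n where "n = (hnorm H y)\<^sup>2"
  have n: "n > 0"
    using False hnorm_eq_zero_iff[OF y] by (simp add: n_def)
  define c where "c = \<langle>y, x\<rangle> / of_real n"
  have cy: "c \<odot> y \<in> carrier H" by (rule smult_in_carrier[OF y])
  have yx: "\<langle>x, y\<rangle> = cnj \<langle>y, x\<rangle>" by (rule cinner_commute[OF x y])
  have "\<langle>x \<ominus> c \<odot> y, x \<ominus> c \<odot> y\<rangle> =
      \<langle>x, x\<rangle> - c * \<langle>x, y\<rangle> - cnj c * \<langle>y, x\<rangle> + cnj c * c * \<langle>y, y\<rangle>"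
    using x y cy by (simp add: cinner_minus_right cinner_minus_left cinner_smult_left
        cinner_smult_right algebra_simps)
  also have "\<dots> = of_real ((hnorm H x)\<^sup>2 - (cmod \<langle>y, x\<rangle>)\<^sup>2 / n)"
    using n unfolding cinner_self[OF x] cinner_self[OF y] yx c_def
    by (simp add: n_def[symmetric] field_simps flip: complex_norm_square)
  finally have "0 \<le> (hnorm H x)\<^sup>2 - (cmod \<langle>y, x\<rangle>)\<^sup>2 / n"
    using cinner_ge_zero[of "x \<ominus> c \<odot> y"] x cy by simp
  then have "(cmod \<langle>x, y\<rangle>)\<^sup>2 \<le> (hnorm H x * hnorm H y)\<^sup>2"
    using n yx by (simp add: n_def field_simps)
  then show ?thesis
    using x y by (meson mult_nonneg_nonneg hnorm_ge_zero power2_le_imp_le)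
qed

lemma hnorm_triangle:
  assumes x: "x \<in> carrier H" and y: "y \<in> carrier H"
  shows "hnorm H (x \<oplus> y) \<le> hnorm H x + hnorm H y"
proof -
  have xy: "x \<oplus> y \<in> carrier H" using x y by simp
  have "of_real ((hnorm H (x \<oplus> y))\<^sup>2) = \<langle>x \<oplus> y, x \<oplus> y\<rangle>"
    using cinner_self[OF xy] by simp
  also have "\<dots> = \<langle>x, x\<rangle> + \<langle>x, y\<rangle> + cnj \<langle>x, y\<rangle> + \<langle>y, y\<rangle>"
    using x y cinner_commute[OF y x] by (simp add: cinner_add_left cinner_add_right)
  also have "\<dots> = of_real ((hnorm H x)\<^sup>2 + 2 * Re \<langle>x, y\<rangle> + (hnorm H y)\<^sup>2)"
    using cinner_self[OF x] cinner_self[OF y] by (simp add: complex_eq_iff)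
  finally have "(hnorm H (x \<oplus> y))\<^sup>2 = (hnorm H x)\<^sup>2 + 2 * Re \<langle>x, y\<rangle> + (hnorm H y)\<^sup>2"
    using of_real_eq_iff by blast
  also have "\<dots> \<le> (hnorm H x + hnorm H y)\<^sup>2"
    using cinner_cauchy_schwarz[OF x y] complex_Re_le_cmod[of "\<langle>x, y\<rangle>"]
    by (simp add: power2_sum)
  finally show ?thesis
    using x y by (meson add_nonneg_nonneg hnorm_ge_zero power2_le_imp_le)
qed

lemma hnorm_minus_commute:
  assumes x: "x \<in> carrier H" and y: "y \<in> carrier H"
  shows "hnorm H (x \<ominus> y) = hnorm H (y \<ominus> x)"
  using assms by (simp add: hnorm_def cinner_minus_left cinner_minus_right algebra_simps)

lemma minus_triangle_eq:
  assumes "x \<in> carrier H" "y \<in> carrier H" "z \<in> carrier H"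
  shows "x \<ominus> z = (x \<ominus> y) \<oplus> (y \<ominus> z)"
proof -
  have "(x \<ominus> y) \<oplus> (y \<ominus> z) = x \<oplus> ((\<ominus> y \<oplus> y) \<oplus> \<ominus> z)"
    using assms by (simp add: a_minus_def M.a_assoc)
  then show ?thesis
    using assms by (simp add: a_minus_def M.l_neg)
qed

lemma minus_eq_zero_iff:
  assumes "x \<in> carrier H" "y \<in> carrier H"
  shows "x \<ominus> y = \<zero> \<longleftrightarrow> x = y"
  using minus_triangle_eq[of x y y] assms M.minus_equality[of x "\<ominus> y"]
  by (auto simp: a_minus_def M.r_neg)

lemma Metric_space_hdist: "Metric_space (carrier H) (hdist H)"
proof
  fix x y z
  show "0 \<le> hdist H x y"
    by (simp add: hdist_def)
  show "hdist H x y = hdist H y x"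
    by (simp add: hdist_def hnorm_minus_commute)
  show "hdist H x y = 0 \<longleftrightarrow> x = y" if "x \<in> carrier H" "y \<in> carrier H"
    using that by (simp add: hdist_def hnorm_eq_zero_iff minus_eq_zero_iff)
  show "hdist H x z \<le> hdist H x y + hdist H y z"
    if "x \<in> carrier H" "y \<in> carrier H" "z \<in> carrier H"
    using that minus_triangle_eq[OF that] hnorm_triangle[of "x \<ominus> y" "y \<ominus> z"]
    by (simp add: hdist_def)
qed

end

locale hilbert_space = complex_inner_space +
  assumes complete: "Metric_space.mcomplete (carrier H) (hdist H)"
    and separable: "separable_space (htopology H)"

definition dense_in :: "('v, 'z) hilbert_scheme \<Rightarrow> 'v set \<Rightarrow> bool"
  where "dense_in H D \<longleftrightarrow> D \<subseteq> carrier H \<and> htopology H closure_of D = carrier H"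

definition linear_span :: "('v, 'z) hilbert_scheme \<Rightarrow> 'v set \<Rightarrow> 'v set"
  where "linear_span H S = (\<lambda>W. submodule W complex_ring H) hull S"

definition orth_proj :: "('v, 'z) hilbert_scheme \<Rightarrow> 'v set \<Rightarrow> 'v \<Rightarrow> 'v"
  where "orth_proj H W x =
    (THE y. y \<in> W \<and> (\<forall>z\<in>W. cinner H z (x \<ominus>\<^bsub>H\<^esub> y) = 0))"


section \<open>Hermitian quadratic forms\<close>

text \<open>
  The diagonal of a Hermitian sesquilinear form is real, and it determines the sesquilinear form
  by polarisation; so a Hermitian quadratic form is a real-valued function.
\<close>

definition hermitian_sesquilinear ::
    "('v, 'z) hilbert_scheme \<Rightarrow> 'v set \<Rightarrow> ('v \<Rightarrow> 'v \<Rightarrow> complex) \<Rightarrow> bool"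
  where "hermitian_sesquilinear H D B \<longleftrightarrow>
    (\<forall>x\<in>D. \<forall>y\<in>D. \<forall>z\<in>D. B x (y \<oplus>\<^bsub>H\<^esub> z) = B x y + B x z) \<and>
    (\<forall>x\<in>D. \<forall>y\<in>D. \<forall>c. B x (c \<odot>\<^bsub>H\<^esub> y) = c * B x y) \<and>
    (\<forall>x\<in>D. \<forall>y\<in>D. B x y = cnj (B y x))"

definition hermitian_quadratic_form ::
    "('v, 'z) hilbert_scheme \<Rightarrow> 'v set \<Rightarrow> ('v \<Rightarrow> real) \<Rightarrow> bool"
  where "hermitian_quadratic_form H D Q \<longleftrightarrow>
    submodule D complex_ring H \<and> dense_in H D \<and>
    (\<exists>B. hermitian_sesquilinear H D B \<and> (\<forall>x\<in>D. complex_of_real (Q x) = B x x))"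

definition closable_form ::
    "('v, 'z) hilbert_scheme \<Rightarrow> 'v set \<Rightarrow> ('v \<Rightarrow> real) \<Rightarrow> bool"
  where "closable_form H D Q \<longleftrightarrow>
    (\<forall>u :: nat \<Rightarrow> 'v.
      range u \<subseteq> D \<longrightarrow>
      limitin (htopology H) u \<zero>\<^bsub>H\<^esub> sequentially \<longrightarrow>
      ((\<lambda>(n, m). Q (u n \<ominus>\<^bsub>H\<^esub> u m)) \<longlongrightarrow> 0) (sequentially \<times>\<^sub>F sequentially) \<longrightarrow>
      (\<lambda>n. Q (u n)) \<longlonglongrightarrow> 0)"

definition form_extends ::
    "('v, 'z) hilbert_scheme \<Rightarrow> 'v set \<Rightarrow> ('v \<Rightarrow> real) \<Rightarrow> 'v set \<Rightarrow> ('v \<Rightarrow> real) \<Rightarrow> bool"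
  where "form_extends H D' Q' D Q \<longleftrightarrow>
    hermitian_quadratic_form H D' Q' \<and> D \<subseteq> D' \<and> (\<forall>x\<in>D. Q' x = Q x)"


section \<open>Self-adjoint operators and resolutions of the identity\<close>

text \<open>An unbounded operator is a partial map \<open>T\<close>, with domain \<^term>\<open>dom T\<close>.\<close>

definition densely_defined_operator ::
    "('v, 'z) hilbert_scheme \<Rightarrow> ('v \<rightharpoonup> 'v) \<Rightarrow> bool"
  where "densely_defined_operator H T \<longleftrightarrow>
    submodule (dom T) complex_ring H \<and> dense_in H (dom T) \<and> ran T \<subseteq> carrier H \<and>
    (\<forall>x\<in>dom T. \<forall>y\<in>dom T. the (T (x \<oplus>\<^bsub>H\<^esub> y)) = the (T x) \<oplus>\<^bsub>H\<^esub> the (T y)) \<and>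
    (\<forall>x\<in>dom T. \<forall>c. the (T (c \<odot>\<^bsub>H\<^esub> x)) = c \<odot>\<^bsub>H\<^esub> the (T x))"

definition adjoint_relation ::
    "('v, 'z) hilbert_scheme \<Rightarrow> ('v \<rightharpoonup> 'v) \<Rightarrow> 'v \<Rightarrow> 'v \<Rightarrow> bool"
  where "adjoint_relation H T x y \<longleftrightarrow>
    x \<in> carrier H \<and> y \<in> carrier H \<and> (\<forall>z\<in>dom T. cinner H x (the (T z)) = cinner H y z)"

definition adjoint_operator ::
    "('v, 'z) hilbert_scheme \<Rightarrow> ('v \<rightharpoonup> 'v) \<Rightarrow> ('v \<rightharpoonup> 'v)"
  where "adjoint_operator H T x =
    (if \<exists>y. adjoint_relation H T x y then Some (THE y. adjoint_relation H T x y) else None)"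

definition self_adjoint :: "('v, 'z) hilbert_scheme \<Rightarrow> ('v \<rightharpoonup> 'v) \<Rightarrow> bool"
  where "self_adjoint H T \<longleftrightarrow> densely_defined_operator H T \<and> adjoint_operator H T = T"

text \<open>The orthogonal projections are the symmetric idempotents; linearity is a consequence.\<close>

definition projection_operator :: "('v, 'z) hilbert_scheme \<Rightarrow> ('v \<Rightarrow> 'v) \<Rightarrow> bool"
  where "projection_operator H P \<longleftrightarrow>
    (\<forall>x\<in>carrier H. P x \<in> carrier H \<and> P (P x) = P x) \<and>
    (\<forall>x\<in>carrier H. \<forall>y\<in>carrier H. cinner H x (P y) = cinner H (P x) y)"

definition projection_valued_measure ::
    "('v, 'z) hilbert_scheme \<Rightarrow> (real set \<Rightarrow> 'v \<Rightarrow> 'v) \<Rightarrow> bool"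
  where "projection_valued_measure H E \<longleftrightarrow>
    (\<forall>\<sigma>\<in>sets borel. projection_operator H (E \<sigma>)) \<and>
    (\<forall>x\<in>carrier H. E UNIV x = x) \<and>
    (\<forall>\<sigma>\<in>sets borel. \<forall>\<tau>\<in>sets borel. \<forall>x\<in>carrier H. E (\<sigma> \<inter> \<tau>) x = E \<sigma> (E \<tau> x)) \<and>
    (\<forall>\<sigma> :: nat \<Rightarrow> real set. range \<sigma> \<subseteq> sets borel \<longrightarrow> disjoint_family \<sigma> \<longrightarrow>
      (\<forall>x\<in>carrier H. limitin (htopology H)
        (\<lambda>n. finsum H (\<lambda>i. E (\<sigma> i) x) {..<n}) (E (\<Union>i. \<sigma> i) x) sequentially))"

text \<open>The measure \<open>\<nu>\<^sub>x(\<sigma>) = \<parallel>E(\<sigma>) x\<parallel>\<^sup>2\<close>.\<close>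

definition spectral_measure ::
    "('v, 'z) hilbert_scheme \<Rightarrow> (real set \<Rightarrow> 'v \<Rightarrow> 'v) \<Rightarrow> 'v \<Rightarrow> real measure"
  where "spectral_measure H E x =
    measure_of UNIV (sets borel) (\<lambda>\<sigma>. ennreal ((hnorm H (E \<sigma> x))\<^sup>2))"

definition simple_spectral_integral ::
    "('v, 'z) hilbert_scheme \<Rightarrow> (real set \<Rightarrow> 'v \<Rightarrow> 'v) \<Rightarrow> (real \<Rightarrow> real) \<Rightarrow> 'v \<Rightarrow> 'v"
  where "simple_spectral_integral H E s x =
    finsum H (\<lambda>c. complex_of_real c \<odot>\<^bsub>H\<^esub> E (s -` {c}) x) (range s)"

text \<open>
  The operator \<open>\<integral> f dE\<close> with domain \<open>{x. \<integral> f\<^sup>2 d\<nu>\<^sub>x < \<infinity>}\<close>; its value at \<open>x\<close> is the common limit of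
  \<open>\<integral> s\<^sub>n dE x\<close> over all sequences of simple functions \<open>s\<^sub>n\<close> tending to \<open>f\<close> in \<open>L\<^sup>2(\<nu>\<^sub>x)\<close>.
\<close>

definition spectral_integral ::
    "('v, 'z) hilbert_scheme \<Rightarrow> (real set \<Rightarrow> 'v \<Rightarrow> 'v) \<Rightarrow> (real \<Rightarrow> real) \<Rightarrow> ('v \<rightharpoonup> 'v)"
  where "spectral_integral H E f x =
    (if x \<in> carrier H \<and> (\<integral>\<^sup>+ t. ennreal ((f t)\<^sup>2) \<partial>spectral_measure H E x) < \<infinity>
     then Some (THE y. \<forall>s :: nat \<Rightarrow> real \<Rightarrow> real.
       (\<forall>n. simple_function borel (s n)) \<longrightarrow>
       (\<lambda>n. \<integral>\<^sup>+ t. ennreal ((s n t - f t)\<^sup>2) \<partial>spectral_measure H E x) \<longlonglongrightarrow> 0 \<longrightarrow>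
       limitin (htopology H) (\<lambda>n. simple_spectral_integral H E (s n) x) y sequentially)
     else None)"

definition resolution_of_identity ::
    "('v, 'z) hilbert_scheme \<Rightarrow> (real set \<Rightarrow> 'v \<Rightarrow> 'v) \<Rightarrow> ('v \<rightharpoonup> 'v) \<Rightarrow> bool"
  where "resolution_of_identity H E T \<longleftrightarrow>
    projection_valued_measure H E \<and> T = spectral_integral H E (\<lambda>t. t)"

text \<open>
  Functions of the self-adjoint operator \<open>T\<close> are expressed through its resolution of the
  identity \<open>E\<close>: these are \<open>|T|\<^sup>1\<^sup>/\<^sup>2\<close> and \<open>sgn T\<close>.
\<close>

definition sqrt_abs_operator ::
    "('v, 'z) hilbert_scheme \<Rightarrow> (real set \<Rightarrow> 'v \<Rightarrow> 'v) \<Rightarrow> ('v \<rightharpoonup> 'v)"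
  where "sqrt_abs_operator H E = spectral_integral H E (\<lambda>t. sqrt \<bar>t\<bar>)"

definition sgn_operator ::
    "('v, 'z) hilbert_scheme \<Rightarrow> (real set \<Rightarrow> 'v \<Rightarrow> 'v) \<Rightarrow> 'v \<Rightarrow> 'v"
  where "sgn_operator H E x = E {0<..} x \<ominus>\<^bsub>H\<^esub> E {..<0} x"


section \<open>Strong representability\<close>

definition spectral_norm ::
    "('v, 'z) hilbert_scheme \<Rightarrow> (real set \<Rightarrow> 'v \<Rightarrow> 'v) \<Rightarrow> 'v \<Rightarrow> real"
  where "spectral_norm H E x = sqrt (\<integral>t. 1 + \<bar>t\<bar> \<partial>spectral_measure H E x)"

definition strong_representation ::
    "('v, 'z) hilbert_scheme \<Rightarrow> 'v set \<Rightarrow> ('v \<Rightarrow> real) \<Rightarrow> ('v \<rightharpoonup> 'v) \<Rightarrow>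
     (real set \<Rightarrow> 'v \<Rightarrow> 'v) \<Rightarrow> 'v set \<Rightarrow> ('v \<Rightarrow> real) \<Rightarrow> bool"
  where "strong_representation H D Q T E D' Q' \<longleftrightarrow>
    self_adjoint H T \<and> resolution_of_identity H E T \<and>
    form_extends H D' Q' D Q \<and> dom T \<subseteq> D' \<and> D \<subseteq> dom (sqrt_abs_operator H E) \<and>
    D' = {x \<in> dom (sqrt_abs_operator H E). \<forall>\<epsilon>>0. \<exists>y\<in>D. spectral_norm H E (x \<ominus>\<^bsub>H\<^esub> y) < \<epsilon>} \<and>
    (\<forall>x\<in>D'. Q' x = (\<integral>t. t \<partial>spectral_measure H E x))"

definition strongly_representable ::
    "('v, 'z) hilbert_scheme \<Rightarrow> 'v set \<Rightarrow> ('v \<Rightarrow> real) \<Rightarrow> ('v \<rightharpoonup> 'v) \<Rightarrow>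
     (real set \<Rightarrow> 'v \<Rightarrow> 'v) \<Rightarrow> bool"
  where "strongly_representable H D Q T E \<longleftrightarrow> (\<exists>D' Q'. strong_representation H D Q T E D' Q')"


section \<open>Direct integrals\<close>

text \<open>
  The measurable structure of the field is given by a fundamental sequence \<open>e\<close>; a section is
  measurable if its inner products with all \<open>e n\<close> are measurable.
\<close>

locale measurable_field =
  fixes M :: "'a measure" and F :: "'a \<Rightarrow> 'v hilbert" and e :: "nat \<Rightarrow> 'a \<Rightarrow> 'v"
  assumes fiber_hilbert: "\<alpha> \<in> space M \<Longrightarrow> hilbert_space (F \<alpha>)"
    and fundamental_closed: "\<alpha> \<in> space M \<Longrightarrow> e n \<alpha> \<in> carrier (F \<alpha>)"
    and fundamental_measurable:
      "(\<lambda>\<alpha>. cinner (F \<alpha>) (e m \<alpha>) (e n \<alpha>)) \<in> borel_measurable M"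
    and fundamental_total:
      "\<alpha> \<in> space M \<Longrightarrow> dense_in (F \<alpha>) (linear_span (F \<alpha>) (range (\<lambda>n. e n \<alpha>)))"

definition square_integrable_sections ::
    "'a measure \<Rightarrow> ('a \<Rightarrow> 'v hilbert) \<Rightarrow> (nat \<Rightarrow> 'a \<Rightarrow> 'v) \<Rightarrow> ('a \<Rightarrow> 'v) set"
  where "square_integrable_sections M F e =
    {x \<in> (\<Pi>\<^sub>E \<alpha>\<in>space M. carrier (F \<alpha>)).
      (\<forall>n. (\<lambda>\<alpha>. cinner (F \<alpha>) (e n \<alpha>) (x \<alpha>)) \<in> borel_measurable M) \<and>
      (\<integral>\<^sup>+ \<alpha>. ennreal ((hnorm (F \<alpha>) (x \<alpha>))\<^sup>2) \<partial>M) < \<infinity>}"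

definition ae_equal ::
    "'a measure \<Rightarrow> ('a \<Rightarrow> 'v hilbert) \<Rightarrow> (nat \<Rightarrow> 'a \<Rightarrow> 'v) \<Rightarrow> (('a \<Rightarrow> 'v) \<times> ('a \<Rightarrow> 'v)) set"
  where "ae_equal M F e =
    {(x, y). x \<in> square_integrable_sections M F e \<and> y \<in> square_integrable_sections M F e \<and>
      (AE \<alpha> in M. x \<alpha> = y \<alpha>)}"

definition section_class ::
    "'a measure \<Rightarrow> ('a \<Rightarrow> 'v hilbert) \<Rightarrow> (nat \<Rightarrow> 'a \<Rightarrow> 'v) \<Rightarrow> ('a \<Rightarrow> 'v) \<Rightarrow> ('a \<Rightarrow> 'v) set"
  where "section_class M F e x = ae_equal M F e `` {\<lambda>\<alpha>\<in>space M. x \<alpha>}"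

text \<open>
  Values of an element \<open>\<Phi>\<close> of the direct integral are taken from a representative; at an
  atom \<open>\<alpha>\<close> of the measure, the value \<open>\<Phi>(\<alpha>)\<close> does not depend on the choice.
\<close>

definition rep :: "('a \<Rightarrow> 'v) set \<Rightarrow> 'a \<Rightarrow> 'v"
  where "rep \<Phi> = (SOME x. x \<in> \<Phi>)"

definition direct_integral ::
    "'a measure \<Rightarrow> ('a \<Rightarrow> 'v hilbert) \<Rightarrow> (nat \<Rightarrow> 'a \<Rightarrow> 'v) \<Rightarrow> ('a \<Rightarrow> 'v) set hilbert"
  where "direct_integral M F e =
    \<lparr> carrier = square_integrable_sections M F e // ae_equal M F e,
      mult = undefined, one = undefined,
      zero = section_class M F e (\<lambda>\<alpha>. \<zero>\<^bsub>F \<alpha>\<^esub>),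
      add = (\<lambda>\<Phi> \<Psi>. section_class M F e (\<lambda>\<alpha>. rep \<Phi> \<alpha> \<oplus>\<^bsub>F \<alpha>\<^esub> rep \<Psi> \<alpha>)),
      smult = (\<lambda>c \<Phi>. section_class M F e (\<lambda>\<alpha>. c \<odot>\<^bsub>F \<alpha>\<^esub> rep \<Phi> \<alpha>)),
      cinner = (\<lambda>\<Phi> \<Psi>. \<integral>\<alpha>. cinner (F \<alpha>) (rep \<Phi> \<alpha>) (rep \<Psi> \<alpha>) \<partial>M) \<rparr>"

text \<open>The decomposable operator \<open>\<integral>\<^sup>\<oplus> A\<^sub>\<alpha> d\<mu>(\<alpha>)\<close> of a field of bounded operators.\<close>

definition decomposable_operator ::
    "'a measure \<Rightarrow> ('a \<Rightarrow> 'v hilbert) \<Rightarrow> (nat \<Rightarrow> 'a \<Rightarrow> 'v) \<Rightarrow> ('a \<Rightarrow> 'v \<Rightarrow> 'v) \<Rightarrow>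
     ('a \<Rightarrow> 'v) set \<Rightarrow> ('a \<Rightarrow> 'v) set"
  where "decomposable_operator M F e A \<Phi> = section_class M F e (\<lambda>\<alpha>. A \<alpha> (rep \<Phi> \<alpha>))"

text \<open>
  The direct integral over a measurable subset \<open>\<Delta>\<close>, as a subspace of the whole direct integral,
  and the orthogonal projection onto it.
\<close>

definition restricted_integral ::
    "'a measure \<Rightarrow> ('a \<Rightarrow> 'v hilbert) \<Rightarrow> (nat \<Rightarrow> 'a \<Rightarrow> 'v) \<Rightarrow> 'a set \<Rightarrow> ('a \<Rightarrow> 'v) set set"
  where "restricted_integral M F e \<Delta> =
    {\<Phi> \<in> carrier (direct_integral M F e). AE \<alpha> in M. \<alpha> \<notin> \<Delta> \<longrightarrow> rep \<Phi> \<alpha> = \<zero>\<^bsub>F \<alpha>\<^esub>}"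

definition restriction_proj ::
    "'a measure \<Rightarrow> ('a \<Rightarrow> 'v hilbert) \<Rightarrow> (nat \<Rightarrow> 'a \<Rightarrow> 'v) \<Rightarrow> 'a set \<Rightarrow>
     ('a \<Rightarrow> 'v) set \<Rightarrow> ('a \<Rightarrow> 'v) set"
  where "restriction_proj M F e \<Delta> =
    orth_proj (direct_integral M F e) (restricted_integral M F e \<Delta>)"

definition orthogonally_additive ::
    "'a measure \<Rightarrow> ('a \<Rightarrow> 'v hilbert) \<Rightarrow> (nat \<Rightarrow> 'a \<Rightarrow> 'v) \<Rightarrow>
     ('a \<Rightarrow> 'v) set set \<Rightarrow> (('a \<Rightarrow> 'v) set \<Rightarrow> real) \<Rightarrow> bool"
  where "orthogonally_additive M F e D Q \<longleftrightarrow>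
    (\<forall>\<Delta>\<in>sets M. restriction_proj M F e \<Delta> ` D \<subseteq> D) \<and>
    (\<forall>\<Phi>\<in>D. \<exists>C>0. \<forall>\<Delta>\<in>sets M. \<bar>Q (restriction_proj M F e \<Delta> \<Phi>)\<bar> < C) \<and>
    (\<forall>\<Delta>\<in>sets M. \<forall>N. \<forall>\<Delta>s :: nat \<Rightarrow> 'a set.
      \<Delta>s ` {1..N} \<subseteq> sets M \<longrightarrow> disjoint_family_on \<Delta>s {1..N} \<longrightarrow> (\<Union>i\<in>{1..N}. \<Delta>s i) = \<Delta> \<longrightarrow>
      (\<forall>\<Phi>\<in>D. Q (restriction_proj M F e \<Delta> \<Phi>) =
        (\<Sum>i = 1..N. Q (restriction_proj M F e (\<Delta>s i) \<Phi>))))"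

definition point_supported :: "'a measure \<Rightarrow> bool"
  where "point_supported M \<longleftrightarrow>
    countable (space M) \<and> sets M = Pow (space M) \<and>
    (\<forall>\<Delta>\<subseteq>space M. emeasure M \<Delta> = (\<Sum>\<^sub>\<infinity>\<alpha>\<in>\<Delta>. emeasure M {\<alpha>}))"

text \<open>
  The form \<open>q\<^sub>\<alpha>(\<Phi>(\<alpha>)) = Q(P\<^sub>\<alpha> \<Phi>) / \<mu>({\<alpha>})\<close> is well defined at atoms, where \<open>P\<^sub>\<alpha> \<Phi>\<close> depends
  only on \<open>\<Phi>(\<alpha>)\<close>.
\<close>

definition fiber_domain :: "('a \<Rightarrow> 'v) set set \<Rightarrow> 'a \<Rightarrow> 'v set"
  where "fiber_domain D \<alpha> = (\<lambda>\<Phi>. rep \<Phi> \<alpha>) ` D"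

definition fiber_form ::
    "'a measure \<Rightarrow> ('a \<Rightarrow> 'v hilbert) \<Rightarrow> (nat \<Rightarrow> 'a \<Rightarrow> 'v) \<Rightarrow>
     ('a \<Rightarrow> 'v) set set \<Rightarrow> (('a \<Rightarrow> 'v) set \<Rightarrow> real) \<Rightarrow> 'a \<Rightarrow> 'v \<Rightarrow> real"
  where "fiber_form M F e D Q \<alpha> v =
    (THE c. \<exists>\<Phi>\<in>D. rep \<Phi> \<alpha> = v \<and> c = Q (restriction_proj M F e {\<alpha>} \<Phi>) / measure M {\<alpha>})"

end

theory Submission
  imports Defs
begin

text \<open>
  The measure is atomic, so an element of the direct integral is a square-summable family
  \<open>\<Phi>(\<alpha>)\<close>, and \<open>\<nu>\<^sub>\<Phi> = \<Sum>\<^sub>\<alpha> \<mu>({\<alpha>}) \<nu>\<^sub>\<Phi>\<^sub>(\<^sub>\<alpha>\<^sub>)\<close>; in particular \<open>E\<close> is again a projection-valued measure and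
  \<open>T = \<integral> \<lambda> dE(\<lambda>)\<close> is self-adjoint.  For fixed \<open>\<Phi>\<close> the bounded charge \<open>\<Delta> \<mapsto> Q(P\<^sub>\<Delta> \<Phi>)\<close> has an absolutely
  convergent sum over the atoms, and closability forces this sum to be \<open>Q(\<Phi>)\<close>.  Together with
  \<open>Q(P\<^sub>\<alpha> \<Phi>) = \<mu>({\<alpha>}) q\<^sub>\<alpha>(\<Phi>(\<alpha>)) = \<mu>({\<alpha>}) \<integral> \<lambda> d\<nu>\<^sub>\<Phi>\<^sub>(\<^sub>\<alpha>\<^sub>)\<close> this gives \<open>Q(\<Phi>) = \<integral> \<lambda> d\<nu>\<^sub>\<Phi>\<close>.
  In each fiber the domain of \<open>T\<^sub>\<alpha>\<close> is dense in the form domain for the spectral norm, so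
  \<open>P\<^sub>\<alpha> \<D>\<close> is dense there as well; finite sums over atoms then show that \<open>\<D>\<close> is dense in
  the form domain of \<open>T\<close>.
\<close>

section \<open>Complex inner product spaces\<close>

text \<open>The inclusion of \<open>D\<close> in the form domain of T is an analytic input:
  representability in the fibers makes \<integral> |t| finite in each fiber separately, with no
  control of the sum over the atoms. With it, \<alpha> \<mapsto> \<integral> t over the spectral
  measure of \<Phi>(\<alpha>) is integrable and can be compared with the series for Q(\<Phi>).
  Closability enters through the tails of an enumeration of the atoms: the restrictions of \<Phi> to
  them tend to 0 in norm, their Q-values converge to Q(\<Phi>) minus the sum of the series, and by
  additivity the Q-value of a difference of two such restrictions is, up to sign, the difference of
  their Q-values. So closability forces that limit to be 0. Positive atoms leave only the empty null
  set, so classes of sections are singletons with well-defined values; finite atoms come from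
  \<sigma>-finiteness. Unboundedness is handled throughout by the cut-offs E({t. |f t| \<le> n}),
  which give density of domains, self-adjointness and density of D(T) in the form domain.
  Approximation in the spectral norm is measured by its square in [0, \<infinity>], where a factor 2
  replaces the triangle inequality.\<close>

context complex_inner_space
begin

text \<open>Membership of the sequence and the limit in the carrier switches off the guard of
  \<open>hdist\<close>. From here on convergence in \<open>htopology\<close> is handled as real
  convergence of norms.\<close>

lemma limitin_iff:
  assumes "\<And>n. u n \<in> carrier H" "l \<in> carrier H"
  shows "limitin (htopology H) u l sequentially \<longleftrightarrow> (\<lambda>n. hnorm H (u n \<ominus> l)) \<longlonglongrightarrow> 0"
proof -
  interpret Metric_space "carrier H" "hdist H" by (rule Metric_space_hdist)
  show ?thesis
    using assms
    by (auto simp: htopology_def limit_metric_sequentially LIMSEQ_def hdist_def)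
qed

lemma dense_in_iff:
  "dense_in H S \<longleftrightarrow>
    S \<subseteq> carrier H \<and> (\<forall>x\<in>carrier H. \<forall>\<epsilon>>0. \<exists>y\<in>S. hnorm H (x \<ominus> y) < \<epsilon>)"
proof -
  interpret Metric_space "carrier H" "hdist H" by (rule Metric_space_hdist)
  show ?thesis
    unfolding dense_in_def htopology_def metric_closure_of in_mball
    by (simp add: hdist_def subset_eq set_eq_iff) blast
qed

lemma mcomplete_iff:
  "Metric_space.mcomplete (carrier H) (hdist H) \<longleftrightarrow>
    (\<forall>u. range u \<subseteq> carrier H \<longrightarrow>
      (\<forall>\<epsilon>>0. \<exists>N. \<forall>n\<ge>N. \<forall>m\<ge>N. hnorm H (u n \<ominus> u m) < \<epsilon>) \<longrightarrow>
      (\<exists>l\<in>carrier H. (\<lambda>n. hnorm H (u n \<ominus> l)) \<longlonglongrightarrow> 0))"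
proof -
  interpret Metric_space "carrier H" "hdist H" by (rule Metric_space_hdist)
  have *: "MCauchy u \<longleftrightarrow> (\<forall>\<epsilon>>0. \<exists>N. \<forall>n\<ge>N. \<forall>m\<ge>N. hnorm H (u n \<ominus> u m) < \<epsilon>)"
    if "range u \<subseteq> carrier H" for u
    using that unfolding MCauchy_def by (auto simp: hdist_def subset_eq)
  have **: "(\<exists>l. limitin mtopology u l sequentially) \<longleftrightarrow>
      (\<exists>l\<in>carrier H. (\<lambda>n. hnorm H (u n \<ominus> l)) \<longlonglongrightarrow> 0)" if "range u \<subseteq> carrier H" for u
    using limitin_iff[of u] that limitin_mspace unfolding htopology_def by blast
  show ?thesis
    unfolding mcomplete_def
  proof (intro iffI allI impI)
    fix u :: "nat \<Rightarrow> 'v" assume c: "\<forall>\<sigma>. MCauchy \<sigma> \<longrightarrow> (\<exists>x. limitin mtopology \<sigma> x sequentially)"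
      and u: "range u \<subseteq> carrier H" "\<forall>\<epsilon>>0. \<exists>N. \<forall>n\<ge>N. \<forall>m\<ge>N. hnorm H (u n \<ominus> u m) < \<epsilon>"
    then have "MCauchy u" using *[OF u(1)] by blast
    then show "\<exists>l\<in>carrier H. (\<lambda>n. hnorm H (u n \<ominus> l)) \<longlonglongrightarrow> 0"
      using c **[OF u(1)] by blast
  next
    fix u assume c: "\<forall>u. range u \<subseteq> carrier H \<longrightarrow>
        (\<forall>\<epsilon>>0. \<exists>N. \<forall>n\<ge>N. \<forall>m\<ge>N. hnorm H (u n \<ominus> u m) < \<epsilon>) \<longrightarrow>
        (\<exists>l\<in>carrier H. (\<lambda>n. hnorm H (u n \<ominus> l)) \<longlonglongrightarrow> 0)" and u: "MCauchy u"
    then have r: "range u \<subseteq> carrier H" by (simp add: MCauchy_def)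
    then show "\<exists>x. limitin mtopology u x sequentially"
      using c u *[OF r] **[OF r] by blast
  qed
qed

lemma finsum_cinner_right:
  assumes "finite A" "x \<in> carrier H" "\<And>i. i \<in> A \<Longrightarrow> f i \<in> carrier H"
  shows "\<langle>x, finsum H f A\<rangle> = (\<Sum>i\<in>A. \<langle>x, f i\<rangle>)"
  using assms(1,3)
proof (induction A rule: finite_induct)
  case empty
  show ?case using assms(2) by (simp add: cinner_zero_right)
next
  case (insert i A)
  then have "finsum H f (insert i A) = f i \<oplus> finsum H f A"
    by (intro M.finsum_insert) auto
  then show ?case
    using insert assms(2) M.finsum_closed[of f A] by (simp add: cinner_add_right Pi_iff)
qed

lemma cinner_zero_left: "x \<in> carrier H \<Longrightarrow> \<langle>\<zero>, x\<rangle> = 0"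
  using cinner_commute[of \<zero> x] cinner_zero_right[of x] by simp

lemma finsum_cinner_left:
  assumes "finite A" "x \<in> carrier H" "\<And>i. i \<in> A \<Longrightarrow> f i \<in> carrier H"
  shows "\<langle>finsum H f A, x\<rangle> = (\<Sum>i\<in>A. \<langle>f i, x\<rangle>)"
proof -
  have "finsum H f A \<in> carrier H"
    using assms by (intro M.finsum_closed) auto
  then have "\<langle>finsum H f A, x\<rangle> = cnj (\<Sum>i\<in>A. \<langle>x, f i\<rangle>)"
    using cinner_commute[of "finsum H f A" x] finsum_cinner_right[of A x f] assms by simp
  also have "\<dots> = (\<Sum>i\<in>A. \<langle>f i, x\<rangle>)"
    unfolding cnj_sum using assms cinner_commute[of _ x] by (intro sum.cong) auto
  finally show ?thesis .
qed

lemma hnorm_power2: "x \<in> carrier H \<Longrightarrow> (hnorm H x)\<^sup>2 = Re \<langle>x, x\<rangle>"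
  by (simp add: hnorm_def cinner_ge_zero)

lemma hnorm_minus_power2:
  assumes "x \<in> carrier H" "y \<in> carrier H"
  shows "(hnorm H (x \<ominus> y))\<^sup>2 = (hnorm H x)\<^sup>2 - 2 * Re \<langle>x, y\<rangle> + (hnorm H y)\<^sup>2"
  using assms arg_cong[OF cinner_commute[of y x], of Re]
  by (simp add: hnorm_power2 cinner_minus_left cinner_minus_right)

lemma hnorm_add_power2:
  assumes "x \<in> carrier H" "y \<in> carrier H"
  shows "(hnorm H (x \<oplus> y))\<^sup>2 = (hnorm H x)\<^sup>2 + 2 * Re \<langle>x, y\<rangle> + (hnorm H y)\<^sup>2"
  using assms arg_cong[OF cinner_commute[of y x], of Re]
  by (simp add: hnorm_power2 cinner_add_left cinner_add_right)

lemma hnorm_add_power2_le: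
  assumes "x \<in> carrier H" "y \<in> carrier H"
  shows "(hnorm H (x \<oplus> y))\<^sup>2 \<le> 2 * (hnorm H x)\<^sup>2 + 2 * (hnorm H y)\<^sup>2"
proof -
  have "0 \<le> (hnorm H (x \<ominus> y))\<^sup>2" by simp
  then show ?thesis
    unfolding hnorm_minus_power2[OF assms] hnorm_add_power2[OF assms] by simp
qed

lemma hnorm_smult: "x \<in> carrier H \<Longrightarrow> hnorm H (c \<odot> x) = cmod c * hnorm H x"
proof -
  assume x: "x \<in> carrier H"
  have "\<langle>c \<odot> x, c \<odot> x\<rangle> = of_real ((cmod c * hnorm H x)\<^sup>2)"
    using x cinner_self[OF x]
    by (simp add: cinner_smult_left cinner_smult_right smult_in_carrier power_mult_distrib
        mult.assoc[symmetric] flip: complex_norm_square)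
  then show ?thesis
    using x unfolding hnorm_def[of H "c \<odot> x"] by simp
qed


text \<open>The inner product is definite, so vectors are determined by their pairings. Most vector
  identities below, including linearity of operators, are verified as scalar identities in this way
  instead of by module arithmetic.\<close>

lemma cinner_ext:
  assumes "x \<in> carrier H" "y \<in> carrier H" "\<And>z. z \<in> carrier H \<Longrightarrow> \<langle>z, x\<rangle> = \<langle>z, y\<rangle>"
  shows "x = y"
proof -
  have "\<langle>x \<ominus> y, x \<ominus> y\<rangle> = 0"
    using assms by (subst cinner_minus_right) auto
  then show ?thesis
    using assms cinner_eq_zero[of "x \<ominus> y"] minus_eq_zero_iff by auto
qed

text \<open>The difference w is orthogonal to S. If w were nonzero, some z in S would satisfy ||w -
  z|| < ||w||, and then ||w||^2 = Re <w, w - z> < ||w||^2.\<close>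

lemma cinner_ext_dense:
  assumes S: "dense_in H S" and x: "x \<in> carrier H" and y: "y \<in> carrier H"
    and eq: "\<And>z. z \<in> S \<Longrightarrow> \<langle>x, z\<rangle> = \<langle>y, z\<rangle>"
  shows "x = y"
proof (rule ccontr)
  define w where "w = x \<ominus> y"
  have w: "w \<in> carrier H" using x y by (simp add: w_def)
  assume "x \<noteq> y"
  then have "hnorm H w > 0"
    using x y w hnorm_eq_zero_iff[OF w] minus_eq_zero_iff[OF x y] hnorm_ge_zero[OF w]
    by (simp add: w_def less_le)
  then obtain z where z: "z \<in> S" "hnorm H (w \<ominus> z) < hnorm H w"
    using S w unfolding dense_in_iff by blast
  then have zH: "z \<in> carrier H"
    using S by (auto simp: dense_in_def)
  have "\<langle>w, z\<rangle> = 0"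
    using z zH x y eq by (simp add: w_def cinner_minus_left)
  then have "(hnorm H w)\<^sup>2 = Re \<langle>w, w \<ominus> z\<rangle>"
    using w zH by (simp add: hnorm_power2 cinner_minus_right)
  also have "\<dots> \<le> hnorm H w * hnorm H (w \<ominus> z)"
    using cinner_cauchy_schwarz[of w "w \<ominus> z"] complex_Re_le_cmod[of "\<langle>w, w \<ominus> z\<rangle>"] w zH by simp
  also have "\<dots> < hnorm H w * hnorm H w"
    using z \<open>hnorm H w > 0\<close> by simp
  finally show False by (simp add: power2_eq_square)
qed

lemma minus_closed [simp]: "\<lbrakk>x \<in> carrier H; y \<in> carrier H\<rbrakk> \<Longrightarrow> x \<ominus> y \<in> carrier H"
  by (rule M.minus_closed)

lemma hnorm_zero [simp]: "hnorm H \<zero> = 0"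
  by (simp add: hnorm_eq_zero_iff)

lemma hnorm_minus_triangle:
  assumes "x \<in> carrier H" "y \<in> carrier H" "z \<in> carrier H"
  shows "hnorm H (x \<ominus> z) \<le> hnorm H (x \<ominus> y) + hnorm H (y \<ominus> z)"
  using minus_triangle_eq[OF assms] hnorm_triangle[of "x \<ominus> y" "y \<ominus> z"] assms by simp

lemma minus_zero_right: "x \<in> carrier H \<Longrightarrow> x \<ominus> \<zero> = x"
  by (simp add: a_minus_def)

lemma abs_hnorm_diff_le:
  assumes "x \<in> carrier H" "y \<in> carrier H"
  shows "\<bar>hnorm H x - hnorm H y\<bar> \<le> hnorm H (x \<ominus> y)"
  using hnorm_minus_triangle[of x y \<zero>] hnorm_minus_triangle[of y x \<zero>] assms
  by (simp add: minus_zero_right hnorm_minus_commute[of y x])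

section \<open>Continuity of the inner product and the norm; complex subspaces\<close>

lemma tendsto_cinner_right:
  assumes "\<And>n. u n \<in> carrier H" "l \<in> carrier H" "x \<in> carrier H"
    and lim: "(\<lambda>n. hnorm H (u n \<ominus> l)) \<longlonglongrightarrow> 0"
  shows "(\<lambda>n. \<langle>x, u n\<rangle>) \<longlonglongrightarrow> \<langle>x, l\<rangle>"
proof -
  have "cmod (\<langle>x, u n\<rangle> - \<langle>x, l\<rangle>) \<le> hnorm H x * hnorm H (u n \<ominus> l)" for n
    using cinner_cauchy_schwarz[of x "u n \<ominus> l"] assms by (simp add: cinner_minus_right)
  moreover have "(\<lambda>n. hnorm H x * hnorm H (u n \<ominus> l)) \<longlonglongrightarrow> 0"
    using tendsto_mult_right_zero[OF lim] by simp
  ultimately have "(\<lambda>n. \<langle>x, u n\<rangle> - \<langle>x, l\<rangle>) \<longlonglongrightarrow> 0"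
    by (rule Lim_null_comparison[OF always_eventually[OF allI]])
  then show ?thesis by (simp add: LIM_zero_iff)
qed

lemma tendsto_cinner_left:
  assumes "\<And>n. u n \<in> carrier H" "l \<in> carrier H" "x \<in> carrier H"
    and lim: "(\<lambda>n. hnorm H (u n \<ominus> l)) \<longlonglongrightarrow> 0"
  shows "(\<lambda>n. \<langle>u n, x\<rangle>) \<longlonglongrightarrow> \<langle>l, x\<rangle>"
  using tendsto_cnj[OF tendsto_cinner_right[OF assms]] cinner_commute[of _ x] assms by simp

lemma tendsto_hnorm:
  assumes "\<And>n. u n \<in> carrier H" "l \<in> carrier H"
    and lim: "(\<lambda>n. hnorm H (u n \<ominus> l)) \<longlonglongrightarrow> 0"
  shows "(\<lambda>n. hnorm H (u n)) \<longlonglongrightarrow> hnorm H l"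
proof -
  have "(\<lambda>n. hnorm H (u n) - hnorm H l) \<longlonglongrightarrow> 0"
    using assms by (intro Lim_null_comparison[OF always_eventually[OF allI] lim])
      (simp add: abs_hnorm_diff_le)
  then show ?thesis by (simp add: LIM_zero_iff)
qed

lemma hlimit_unique:
  assumes u: "\<And>n. u n \<in> carrier H" and l: "l \<in> carrier H" "l' \<in> carrier H"
    and lim: "(\<lambda>n. hnorm H (u n \<ominus> l)) \<longlonglongrightarrow> 0" "(\<lambda>n. hnorm H (u n \<ominus> l')) \<longlonglongrightarrow> 0"
  shows "l = l'"
  using LIMSEQ_unique[OF tendsto_cinner_right[OF u l(1) _ lim(1)]
      tendsto_cinner_right[OF u l(2) _ lim(2)]]
  by (intro cinner_ext l)

lemma submoduleI_complex:
  assumes "S \<subseteq> carrier H" "\<zero> \<in> S" "\<And>x y. x \<in> S \<Longrightarrow> y \<in> S \<Longrightarrow> x \<oplus> y \<in> S"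
    and smult: "\<And>c x. x \<in> S \<Longrightarrow> c \<odot> x \<in> S"
  shows "submodule S complex_ring H"
proof (rule submoduleI)
  fix x assume x: "x \<in> S"
  then have xH: "x \<in> carrier H" using assms(1) by auto
  have "\<ominus> x = (- 1) \<odot> x"
    using xH by (intro cinner_ext)
      (auto simp: cinner_uminus_right cinner_smult_right smult_in_carrier)
  then show "\<ominus> x \<in> S" using smult[OF x] by simp
qed (use assms in auto)

lemma submodule_complexD:
  assumes "submodule S complex_ring H"
  shows "S \<subseteq> carrier H" "\<zero> \<in> S" "x \<in> S \<Longrightarrow> y \<in> S \<Longrightarrow> x \<oplus> y \<in> S" "x \<in> S \<Longrightarrow> c \<odot> x \<in> S"
    "x \<in> S \<Longrightarrow> y \<in> S \<Longrightarrow> x \<ominus> y \<in> S"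
proof -
  show S: "S \<subseteq> carrier H" and add: "\<And>x y. x \<in> S \<Longrightarrow> y \<in> S \<Longrightarrow> x \<oplus> y \<in> S"
    and smult: "\<And>c x. x \<in> S \<Longrightarrow> c \<odot> x \<in> S"
    using submoduleE[OF assms] by (auto simp: complex_ring_def)
  obtain z where z: "z \<in> S" using submoduleE(2)[OF assms] by auto
  have "\<zero> = 0 \<odot> z"
    using z S by (intro cinner_ext) (auto simp: cinner_zero_right cinner_smult_right smult_in_carrier)
  then show "\<zero> \<in> S" using smult[OF z, of 0] by simp
  show "x \<in> S \<Longrightarrow> y \<in> S \<Longrightarrow> x \<ominus> y \<in> S"
    using submoduleE(3)[OF assms] add by (auto simp: a_minus_def)
qed

section \<open>Orthogonal projections and projection-valued measures\<close>

lemma proj_closed: "\<lbrakk>projection_operator H P; x \<in> carrier H\<rbrakk> \<Longrightarrow> P x \<in> carrier H"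
  and proj_idem: "\<lbrakk>projection_operator H P; x \<in> carrier H\<rbrakk> \<Longrightarrow> P (P x) = P x"
  and proj_symmetric:
    "\<lbrakk>projection_operator H P; x \<in> carrier H; y \<in> carrier H\<rbrakk> \<Longrightarrow> \<langle>x, P y\<rangle> = \<langle>P x, y\<rangle>"
  by (auto simp: projection_operator_def)

lemma proj_cinner_self:
  assumes "projection_operator H P" "x \<in> carrier H"
  shows "\<langle>x, P x\<rangle> = of_real ((hnorm H (P x))\<^sup>2)"
  using proj_symmetric[of P x "P x"] assms
  by (simp add: proj_closed proj_idem cinner_self)

text \<open>Symmetry alone yields linearity: P moves to the other entry, where it acts on the fixed
  test vector.\<close>

lemma proj_add:
  assumes "projection_operator H P" "x \<in> carrier H" "y \<in> carrier H"
  shows "P (x \<oplus> y) = P x \<oplus> P y"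
  using assms by (intro cinner_ext) (simp_all add: proj_symmetric proj_closed cinner_add_right)

lemma proj_smult:
  assumes "projection_operator H P" "x \<in> carrier H"
  shows "P (c \<odot> x) = c \<odot> P x"
  using assms
  by (intro cinner_ext)
    (simp_all add: proj_symmetric proj_closed cinner_smult_right smult_in_carrier)

text \<open>||P x||^2 = <x, P x>, so Cauchy-Schwarz gives the bound after division by ||P
  x||.\<close>

lemma proj_hnorm_le:
  assumes "projection_operator H P" "x \<in> carrier H"
  shows "hnorm H (P x) \<le> hnorm H x"
proof -
  have "(hnorm H (P x))\<^sup>2 \<le> hnorm H x * hnorm H (P x)"
    using cinner_cauchy_schwarz[of x "P x"] assms proj_closed[OF assms]
    by (simp add: proj_cinner_self norm_power)
  then show ?thesis
    using assms proj_closed[OF assms] hnorm_ge_zero[of "P x"] hnorm_ge_zero[of x]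
      mult_right_le_imp_le[of "hnorm H (P x)" "hnorm H (P x)" "hnorm H x"]
    by (cases "hnorm H (P x) = 0") (auto simp: power2_eq_square less_le)
qed

text \<open>Strong convergence of the sums of E(\<sigma> i) x is equivalent here to convergence of
  the squared norms, since the summands are mutually orthogonal. This form suits direct integrals,
  where a squared norm is an integral of nonnegative functions.\<close>

lemma projection_valued_measureI:
  assumes proj: "\<And>\<sigma>. \<sigma> \<in> sets borel \<Longrightarrow> projection_operator H (E \<sigma>)"
    and UNIV: "\<And>x. x \<in> carrier H \<Longrightarrow> E UNIV x = x"
    and Int: "\<And>\<sigma> \<tau> x. \<lbrakk>\<sigma> \<in> sets borel; \<tau> \<in> sets borel; x \<in> carrier H\<rbrakk> \<Longrightarrow> E (\<sigma> \<inter> \<tau>) x = E \<sigma> (E \<tau> x)"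
    and sums: "\<And>\<sigma> :: nat \<Rightarrow> real set. \<And>x. \<lbrakk>range \<sigma> \<subseteq> sets borel; disjoint_family \<sigma>; x \<in> carrier H\<rbrakk> \<Longrightarrow>
      (\<lambda>i. (hnorm H (E (\<sigma> i) x))\<^sup>2) sums (hnorm H (E (\<Union>i. \<sigma> i) x))\<^sup>2"
  shows "projection_valued_measure H E"
  unfolding projection_valued_measure_def
proof (intro conjI ballI allI impI)
  fix \<sigma> :: "nat \<Rightarrow> real set" and x
  assume \<sigma>: "range \<sigma> \<subseteq> sets borel" and disj: "disjoint_family \<sigma>" and x: "x \<in> carrier H"
  define U where "U = (\<Union>i. \<sigma> i)"
  define u where "u n = finsum H (\<lambda>i. E (\<sigma> i) x) {..<n}" for n
  have \<sigma>': "\<sigma> i \<in> sets borel" for i using \<sigma> by auto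
  have U: "U \<in> sets borel" unfolding U_def using \<sigma>' by auto
  have c: "E \<tau> x \<in> carrier H" if "\<tau> \<in> sets borel" for \<tau>
    using proj_closed[OF proj] that x by auto
  have u: "u n \<in> carrier H" for n
    unfolding u_def using c \<sigma>' by (intro M.finsum_closed) auto
  \<comment> \<open>The empty set repeated forever is a disjoint family, so a constant series
    converges and its term must be 0.\<close>
  have empty: "hnorm H (E {} x) = 0"
  proof -
    have "(\<lambda>i::nat. (hnorm H (E {} x))\<^sup>2) sums (hnorm H (E {} x))\<^sup>2"
      using sums[of "\<lambda>_. {}" x] x by (simp add: disjoint_family_on_def)
    then have "(hnorm H (E {} x))\<^sup>2 = 0"
      using summable_const_iff sums_summable by blast
    then show ?thesis by simp
  qed
  have inner: "\<langle>E \<tau> x, E \<rho> x\<rangle> = of_real ((hnorm H (E (\<tau> \<inter> \<rho>) x))\<^sup>2)"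
    if "\<tau> \<in> sets borel" "\<rho> \<in> sets borel" for \<tau> \<rho>
    using proj_symmetric[OF proj[of \<tau>], of x "E \<rho> x"] that x c
    by (simp add: Int[symmetric] proj_cinner_self proj)
  have 1: "\<langle>E U x, u n\<rangle> = of_real (\<Sum>i<n. (hnorm H (E (\<sigma> i) x))\<^sup>2)" for n
  proof -
    have "\<langle>E U x, u n\<rangle> = (\<Sum>i<n. \<langle>E U x, E (\<sigma> i) x\<rangle>)"
      unfolding u_def using c U \<sigma>' by (intro finsum_cinner_right) auto
    moreover have "U \<inter> \<sigma> i = \<sigma> i" for i by (auto simp: U_def)
    ultimately show ?thesis using U \<sigma>' by (simp add: inner)
  qed
  have 2: "\<langle>u n, u n\<rangle> = of_real (\<Sum>i<n. (hnorm H (E (\<sigma> i) x))\<^sup>2)" for n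
  proof -
    have "\<langle>u n, u n\<rangle> = (\<Sum>i<n. \<langle>E (\<sigma> i) x, u n\<rangle>)"
      using c \<sigma>' u unfolding u_def by (intro finsum_cinner_left) auto
    also have "\<dots> = (\<Sum>i<n. \<Sum>j<n. \<langle>E (\<sigma> i) x, E (\<sigma> j) x\<rangle>)"
      unfolding u_def using c \<sigma>' by (intro sum.cong finsum_cinner_right) auto
    also have "\<dots> = (\<Sum>i<n. \<Sum>j<n. if j = i then of_real ((hnorm H (E (\<sigma> i) x))\<^sup>2) else 0)"
    proof (intro sum.cong refl)
      fix i j
      show "\<langle>E (\<sigma> i) x, E (\<sigma> j) x\<rangle> = (if j = i then of_real ((hnorm H (E (\<sigma> i) x))\<^sup>2) else 0)"
        using disj \<sigma>' empty by (cases "i = j") (auto simp: inner disjoint_family_on_def)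
    qed
    also have "\<dots> = of_real (\<Sum>i<n. (hnorm H (E (\<sigma> i) x))\<^sup>2)"
      by (simp add: sum.delta)
    finally show ?thesis .
  qed
  \<comment> \<open>Pythagoras: both <E U x, u n> and ||u n||^2 equal the partial sum of the squared
    norms.\<close>
  have "(hnorm H (u n \<ominus> E U x))\<^sup>2 = (hnorm H (E U x))\<^sup>2 - (\<Sum>i<n. (hnorm H (E (\<sigma> i) x))\<^sup>2)" for n
    using hnorm_minus_power2[OF c[OF U] u[of n]] hnorm_minus_commute[OF u[of n] c[OF U]]
      1[of n] 2[of n] hnorm_power2[OF u[of n]] by simp
  moreover have "(\<lambda>n. (hnorm H (E U x))\<^sup>2 - (\<Sum>i<n. (hnorm H (E (\<sigma> i) x))\<^sup>2)) \<longlonglongrightarrow> 0"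
    using sums[OF \<sigma> disj x] unfolding U_def[symmetric] sums_def
    by (auto intro: tendsto_eq_intros)
  ultimately have "(\<lambda>n. (hnorm H (u n \<ominus> E U x))\<^sup>2) \<longlonglongrightarrow> 0"
    by simp
  then have "(\<lambda>n. hnorm H (u n \<ominus> E U x)) \<longlonglongrightarrow> 0"
    by (simp add: power_tendsto_0_iff)
  then show "limitin (htopology H) (\<lambda>n. finsum H (\<lambda>i. E (\<sigma> i) x) {..<n}) (E (\<Union>i. \<sigma> i) x) sequentially"
    unfolding U_def[symmetric] u_def[symmetric] using u c[OF U] by (subst limitin_iff) auto
qed (use proj UNIV Int in auto)

end

section \<open>Spectral integrals\<close>

text \<open>One theory of spectral integrals serves twice: it is interpreted in every fiber and in
  the direct integral itself.\<close>

locale spectral_resolution = complex_inner_space H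
  for H :: "('v, 'z) hilbert_scheme" (structure) +
  fixes E :: "real set \<Rightarrow> 'v \<Rightarrow> 'v"
  assumes complete: "Metric_space.mcomplete (carrier H) (hdist H)"
    and pvm: "projection_valued_measure H E"
begin

abbreviation \<nu> :: "'v \<Rightarrow> real measure"
  where "\<nu> \<equiv> spectral_measure H E"

lemma E_proj: "\<sigma> \<in> sets borel \<Longrightarrow> projection_operator H (E \<sigma>)"
  and E_UNIV: "x \<in> carrier H \<Longrightarrow> E UNIV x = x"
  and E_Int: "\<lbrakk>\<sigma> \<in> sets borel; \<tau> \<in> sets borel; x \<in> carrier H\<rbrakk> \<Longrightarrow> E \<sigma> (E \<tau> x) = E (\<sigma> \<inter> \<tau>) x"
  using pvm by (auto simp: projection_valued_measure_def)

lemma E_closed [simp]: "\<lbrakk>\<sigma> \<in> sets borel; x \<in> carrier H\<rbrakk> \<Longrightarrow> E \<sigma> x \<in> carrier H"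
  using proj_closed[OF E_proj] .

lemma E_cinner:
  assumes "\<sigma> \<in> sets borel" "\<tau> \<in> sets borel" "x \<in> carrier H"
  shows "\<langle>E \<sigma> x, E \<tau> x\<rangle> = of_real ((hnorm H (E (\<sigma> \<inter> \<tau>) x))\<^sup>2)"
  using proj_symmetric[OF E_proj[of \<sigma>], of x "E \<tau> x"] assms
  by (simp add: E_Int proj_cinner_self[OF E_proj])

lemma E_sums:
  assumes \<sigma>: "range \<sigma> \<subseteq> sets borel" and disj: "disjoint_family \<sigma>" and x: "x \<in> carrier H"
  shows "(\<lambda>i. (hnorm H (E (\<sigma> i) x))\<^sup>2) sums (hnorm H (E (\<Union>i. \<sigma> i) x))\<^sup>2"
proof -
  have \<sigma>': "\<sigma> i \<in> sets borel" for i using \<sigma> by auto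
  then have U: "(\<Union>i. \<sigma> i) \<in> sets borel" by auto
  have fin: "finsum H (\<lambda>i. E (\<sigma> i) x) {..<n} \<in> carrier H" for n
    using \<sigma>' x by (intro M.finsum_closed) auto
  have "limitin (htopology H) (\<lambda>n. finsum H (\<lambda>i. E (\<sigma> i) x) {..<n}) (E (\<Union>i. \<sigma> i) x) sequentially"
    using pvm \<sigma> disj x unfolding projection_valued_measure_def by blast
  then have "(\<lambda>n. hnorm H (finsum H (\<lambda>i. E (\<sigma> i) x) {..<n} \<ominus> E (\<Union>i. \<sigma> i) x)) \<longlonglongrightarrow> 0"
    using fin U x by (subst (asm) limitin_iff) auto
  then have "(\<lambda>n. \<langle>x, finsum H (\<lambda>i. E (\<sigma> i) x) {..<n}\<rangle>) \<longlonglongrightarrow> \<langle>x, E (\<Union>i. \<sigma> i) x\<rangle>"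
    using fin U x by (intro tendsto_cinner_right) auto
  moreover have "\<langle>x, finsum H (\<lambda>i. E (\<sigma> i) x) {..<n}\<rangle> = of_real (\<Sum>i<n. (hnorm H (E (\<sigma> i) x))\<^sup>2)" for n
    using \<sigma>' x by (subst finsum_cinner_right) (auto simp: proj_cinner_self[OF E_proj])
  ultimately show ?thesis
    using U x unfolding sums_def
    by (simp add: proj_cinner_self[OF E_proj] tendsto_of_real_iff del: of_real_power of_real_sum)
qed

lemma E_empty: "x \<in> carrier H \<Longrightarrow> hnorm H (E {} x) = 0"
proof -
  assume "x \<in> carrier H"
  then have "(\<lambda>i::nat. (hnorm H (E {} x))\<^sup>2) sums (hnorm H (E {} x))\<^sup>2"
    using E_sums[of "\<lambda>_. {}" x] by (simp add: disjoint_family_on_def)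
  then have "(hnorm H (E {} x))\<^sup>2 = 0"
    using summable_const_iff sums_summable by blast
  then show ?thesis by simp
qed

lemma sets_spectral_measure [measurable_cong]: "sets (\<nu> x) = sets borel"
  unfolding spectral_measure_def
  by (subst sets_measure_of) (auto simp: sets.sigma_sets_eq[of borel, simplified])

lemma space_spectral_measure [simp]: "space (\<nu> x) = UNIV"
  by (simp add: spectral_measure_def space_measure_of_conv)

lemma measurable_spectral_measure [simp]: "measurable (\<nu> x) N = measurable borel N"
  by (rule measurable_cong_sets[OF sets_spectral_measure refl])

lemma emeasure_spectral_measure:
  assumes x: "x \<in> carrier H" and \<sigma>: "\<sigma> \<in> sets borel"
  shows "emeasure (\<nu> x) \<sigma> = ennreal ((hnorm H (E \<sigma> x))\<^sup>2)"
  unfolding spectral_measure_def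
proof (rule emeasure_measure_of_sigma)
  show "sigma_algebra UNIV (sets (borel :: real measure))"
    using sets.sigma_algebra_axioms[of "borel :: real measure"] by simp
  show "positive (sets borel) (\<lambda>\<sigma>. ennreal ((hnorm H (E \<sigma> x))\<^sup>2))"
    using E_empty[OF x] by (simp add: positive_def)
  show "countably_additive (sets borel) (\<lambda>\<sigma>. ennreal ((hnorm H (E \<sigma> x))\<^sup>2))"
    unfolding countably_additive_def
    by (intro allI impI suminf_ennreal_eq E_sums x) simp_all
qed (rule \<sigma>)

lemma measure_spectral_measure:
  "\<lbrakk>x \<in> carrier H; \<sigma> \<in> sets borel\<rbrakk> \<Longrightarrow> measure (\<nu> x) \<sigma> = (hnorm H (E \<sigma> x))\<^sup>2"
  by (simp add: measure_def emeasure_spectral_measure)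

lemma emeasure_spectral_measure_UNIV:
  "x \<in> carrier H \<Longrightarrow> emeasure (\<nu> x) UNIV = ennreal ((hnorm H x)\<^sup>2)"
  by (simp add: emeasure_spectral_measure E_UNIV)

lemma finite_spectral_measure: "x \<in> carrier H \<Longrightarrow> finite_measure (\<nu> x)"
  by (rule finite_measureI) (simp add: emeasure_spectral_measure_UNIV)

section \<open>Integrals of simple functions and their completion\<close>

abbreviation simple_int :: "(real \<Rightarrow> real) \<Rightarrow> 'v \<Rightarrow> 'v"
  where "simple_int \<equiv> simple_spectral_integral H E"

lemma simple_borel:
  assumes "simple_function borel (s :: real \<Rightarrow> real)"
  shows "finite (range s)" "s -` {c} \<in> sets borel"
  using simple_functionD[OF assms] by auto

lemma simple_int_closed [simp]:
  assumes "simple_function borel s" "x \<in> carrier H"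
  shows "simple_int s x \<in> carrier H"
  unfolding simple_spectral_integral_def
  using simple_borel[OF assms(1)] assms(2) by (intro M.finsum_closed) (auto intro: smult_in_carrier)

lemma cinner_simple_int_right:
  assumes "simple_function borel s" "x \<in> carrier H" "z \<in> carrier H"
  shows "\<langle>z, simple_int s x\<rangle> = (\<Sum>c\<in>range s. of_real c * \<langle>z, E (s -` {c}) x\<rangle>)"
  unfolding simple_spectral_integral_def
  using simple_borel[OF assms(1)] assms(2,3)
  by (subst finsum_cinner_right) (auto simp: cinner_smult_right smult_in_carrier)

lemma cinner_simple_int_left:
  assumes "simple_function borel s" "x \<in> carrier H" "z \<in> carrier H"
  shows "\<langle>simple_int s x, z\<rangle> = (\<Sum>c\<in>range s. of_real c * \<langle>E (s -` {c}) x, z\<rangle>)"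
  unfolding simple_spectral_integral_def
  using simple_borel[OF assms(1)] assms(2,3)
  by (subst finsum_cinner_left) (auto simp: cinner_smult_left smult_in_carrier)

text \<open>The coefficients are real and the projections symmetric. Linearity in the vector then
  follows as for projections.\<close>

lemma simple_int_symmetric:
  assumes "simple_function borel s" "x \<in> carrier H" "z \<in> carrier H"
  shows "\<langle>z, simple_int s x\<rangle> = \<langle>simple_int s z, x\<rangle>"
  unfolding cinner_simple_int_right[OF assms] cinner_simple_int_left[OF assms(1,3,2)]
  using assms simple_borel[OF assms(1)]
  by (intro sum.cong) (auto simp: proj_symmetric[OF E_proj])

lemma simple_int_add:
  assumes s: "simple_function borel s" and "x \<in> carrier H" "y \<in> carrier H"
  shows "simple_int s (x \<oplus> y) = simple_int s x \<oplus> simple_int s y"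
  using assms
  by (intro cinner_ext) (auto simp: simple_int_symmetric cinner_add_right)

lemma simple_int_smult:
  assumes s: "simple_function borel s" and "x \<in> carrier H"
  shows "simple_int s (c \<odot> x) = c \<odot> simple_int s x"
  using assms
  by (intro cinner_ext) (auto simp: simple_int_symmetric cinner_smult_right smult_in_carrier)

lemma simple_int_E:
  assumes s: "simple_function borel s" and x: "x \<in> carrier H" and \<tau>: "\<tau> \<in> sets borel"
  shows "simple_int s (E \<tau> x) = E \<tau> (simple_int s x)"
proof (rule cinner_ext)
  fix z assume z: "z \<in> carrier H"
  have "\<langle>z, E \<tau> (simple_int s x)\<rangle> = \<langle>E \<tau> z, simple_int s x\<rangle>"
    using s x \<tau> z by (simp add: proj_symmetric[OF E_proj])
  also have "\<dots> = (\<Sum>c\<in>range s. of_real c * \<langle>z, E \<tau> (E (s -` {c}) x)\<rangle>)"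
    using s x \<tau> z simple_borel[OF s]
    by (simp add: cinner_simple_int_right proj_symmetric[OF E_proj])
  also have "\<dots> = \<langle>z, simple_int s (E \<tau> x)\<rangle>"
    using s x \<tau> z simple_borel[OF s]
    by (simp add: cinner_simple_int_right E_Int Int_commute)
  finally show "\<langle>z, simple_int s (E \<tau> x)\<rangle> = \<langle>z, E \<tau> (simple_int s x)\<rangle>" ..
qed (use assms in auto)

lemma simple_function_eq_sum:
  assumes "simple_function borel (s :: real \<Rightarrow> real)"
  shows "s t = (\<Sum>c\<in>range s. c * indicator (s -` {c}) t)"
proof -
  have "(\<Sum>c\<in>range s. c * indicator (s -` {c}) t) = (\<Sum>c\<in>range s. if c = s t then c else 0)"
    by (intro sum.cong) (auto simp: indicator_def)
  then show ?thesis
    using simple_borel(1)[OF assms] by (simp add: sum.delta)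
qed

text \<open>The spectral isometry in polarised form: expanding over level sets leaves the \<nu>
  x-measures of their intersections. With a product of two functions, the square of a difference s -
  r can be expanded termwise, without a common partition for s and r.\<close>

lemma has_bochner_integral_simple:
  assumes s: "simple_function borel s" and r: "simple_function borel r" and x: "x \<in> carrier H"
  shows "has_bochner_integral (\<nu> x) (\<lambda>t. s t * r t) (Re \<langle>simple_int s x, simple_int r x\<rangle>)"
proof -
  interpret finite_measure "\<nu> x" by (rule finite_spectral_measure[OF x])
  have "\<langle>simple_int s x, simple_int r x\<rangle> =
      (\<Sum>c\<in>range s. \<Sum>d\<in>range r. of_real (c * d * measure (\<nu> x) (s -` {c} \<inter> r -` {d})))"
    using s r x simple_borel[OF s] simple_borel[OF r]
    by (simp add: cinner_simple_int_left cinner_simple_int_right E_cinner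
        measure_spectral_measure sets.Int sum_distrib_left mult_ac)
      (subst sum.swap, simp add: mult_ac)
  then have 1: "Re \<langle>simple_int s x, simple_int r x\<rangle> =
      (\<Sum>c\<in>range s. \<Sum>d\<in>range r. c * d * measure (\<nu> x) (s -` {c} \<inter> r -` {d}))"
    by simp
  have "s t * r t = (\<Sum>c\<in>range s. \<Sum>d\<in>range r. c * d * indicator (s -` {c} \<inter> r -` {d}) t)" for t
  proof -
    have "s t * r t = (\<Sum>c\<in>range s. c * indicator (s -` {c}) t) * (\<Sum>d\<in>range r. d * indicator (r -` {d}) t)"
      by (rule arg_cong2[where f = "(*)", OF simple_function_eq_sum[OF s] simple_function_eq_sum[OF r]])
    also have "\<dots> = (\<Sum>c\<in>range s. \<Sum>d\<in>range r. c * d * indicator (s -` {c} \<inter> r -` {d}) t)"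
      unfolding sum_product by (intro sum.cong refl) (simp add: indicator_inter_arith)
    finally show ?thesis .
  qed
  moreover have "has_bochner_integral (\<nu> x)
      (\<lambda>t. \<Sum>c\<in>range s. \<Sum>d\<in>range r. c * d * indicator (s -` {c} \<inter> r -` {d}) t)
      (Re \<langle>simple_int s x, simple_int r x\<rangle>)"
    unfolding 1
  proof (intro has_bochner_integral_sum has_bochner_integral_mult_right
      has_bochner_integral_real_indicator)
    fix c d
    show "s -` {c} \<inter> r -` {d} \<in> sets (\<nu> x)"
      using simple_borel(2)[OF s] simple_borel(2)[OF r] by (simp add: sets_spectral_measure)
    show "emeasure (\<nu> x) (s -` {c} \<inter> r -` {d}) < \<infinity>"
      by (simp add: less_top[symmetric])
  qed
  ultimately show ?thesis by simp
qed

lemma nn_integral_simple_diff: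
  assumes s: "simple_function borel s" and r: "simple_function borel r" and x: "x \<in> carrier H"
  shows "(\<integral>\<^sup>+ t. ennreal ((s t - r t)\<^sup>2) \<partial>\<nu> x) =
    ennreal ((hnorm H (simple_int s x \<ominus> simple_int r x))\<^sup>2)"
proof -
  have "has_bochner_integral (\<nu> x) (\<lambda>t. s t * s t - 2 * (s t * r t) + r t * r t)
      (Re \<langle>simple_int s x, simple_int s x\<rangle> - 2 * Re \<langle>simple_int s x, simple_int r x\<rangle> +
        Re \<langle>simple_int r x, simple_int r x\<rangle>)"
    by (intro has_bochner_integral_add has_bochner_integral_diff has_bochner_integral_mult_right
        has_bochner_integral_simple assms)
  moreover have "(\<lambda>t. s t * s t - 2 * (s t * r t) + r t * r t) = (\<lambda>t. (s t - r t)\<^sup>2)"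
    by (simp add: fun_eq_iff power2_eq_square algebra_simps)
  moreover have "Re \<langle>simple_int s x, simple_int s x\<rangle> - 2 * Re \<langle>simple_int s x, simple_int r x\<rangle> +
      Re \<langle>simple_int r x, simple_int r x\<rangle> = (hnorm H (simple_int s x \<ominus> simple_int r x))\<^sup>2"
    using assms by (simp add: hnorm_minus_power2 hnorm_power2[symmetric])
  ultimately have "has_bochner_integral (\<nu> x) (\<lambda>t. (s t - r t)\<^sup>2)
      ((hnorm H (simple_int s x \<ominus> simple_int r x))\<^sup>2)"
    by simp
  then show ?thesis
    by (auto simp: has_bochner_integral_iff nn_integral_eq_integral)
qed

lemma nn_integral_simple:
  assumes s: "simple_function borel s" and x: "x \<in> carrier H"
  shows "(\<integral>\<^sup>+ t. ennreal ((s t)\<^sup>2) \<partial>\<nu> x) = ennreal ((hnorm H (simple_int s x))\<^sup>2)"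
proof -
  have "has_bochner_integral (\<nu> x) (\<lambda>t. (s t)\<^sup>2) ((hnorm H (simple_int s x))\<^sup>2)"
    using has_bochner_integral_simple[OF s s x]
    unfolding hnorm_power2[OF simple_int_closed[OF assms]] by (simp only: power2_eq_square)
  then show ?thesis
    by (auto simp: has_bochner_integral_iff nn_integral_eq_integral)
qed

text \<open>The approximating sequence depends only on f, not on the vector x; this uniformity is
  what later allows values of the operator at different vectors to be compared along one
  sequence.\<close>

lemma obtain_simple_approx:
  fixes f :: "real \<Rightarrow> real"
  assumes f [measurable]: "f \<in> borel_measurable borel"
  obtains s :: "nat \<Rightarrow> real \<Rightarrow> real" where "\<And>n. simple_function borel (s n)"
    and "\<And>x. (\<integral>\<^sup>+ t. ennreal ((f t)\<^sup>2) \<partial>\<nu> x) < \<infinity> \<Longrightarrow>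
      (\<lambda>n. \<integral>\<^sup>+ t. ennreal ((s n t - f t)\<^sup>2) \<partial>\<nu> x) \<longlonglongrightarrow> 0"
    and "\<And>x. (\<integral>\<^sup>+ t. ennreal ((f t)\<^sup>2) \<partial>\<nu> x) < \<infinity> \<Longrightarrow>
      (\<lambda>n. \<integral>\<^sup>+ t. ennreal ((s n t)\<^sup>2) \<partial>\<nu> x) \<longlonglongrightarrow> (\<integral>\<^sup>+ t. ennreal ((f t)\<^sup>2) \<partial>\<nu> x)"
proof -
  obtain s where s: "\<And>n. simple_function borel (s n)" and lim: "\<And>t. (\<lambda>n. s n t) \<longlonglongrightarrow> f t"
    and bound: "\<And>n t. dist (s n t) 0 \<le> 2 * dist (f t) 0"
    using borel_measurable_implies_sequence_metric[OF f, of 0] by auto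
  have [measurable]: "s n \<in> borel_measurable borel" for n
    using s borel_measurable_simple_function by blast
  show thesis
  proof (rule that[of s])
    fix x assume fin: "(\<integral>\<^sup>+ t. ennreal ((f t)\<^sup>2) \<partial>\<nu> x) < \<infinity>"
    have b: "\<bar>s n t\<bar> \<le> 2 * \<bar>f t\<bar>" for n t using bound[of n t] by (simp add: dist_real_def)
    \<comment> \<open>From |s n| \<le> 2 |f| one gets |s n - f| \<le> 3 |f|. The majorant 9 f^2
      needed for the difference is also used for s n, where 4 f^2 would do.\<close>
    have b1: "(s n t)\<^sup>2 \<le> 9 * (f t)\<^sup>2" for n t
    proof -
      have "(s n t)\<^sup>2 \<le> 4 * (f t)\<^sup>2"
        using power_mono[OF b[of n t], of 2] by (simp add: power_mult_distrib)
      then show ?thesis using zero_le_power2[of "f t"] by linarith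
    qed
    have b2: "(s n t - f t)\<^sup>2 \<le> 9 * (f t)\<^sup>2" for n t
    proof -
      have "\<bar>s n t - f t\<bar> \<le> 3 * \<bar>f t\<bar>" using b[of n t] by linarith
      from power_mono[OF this, of 2] show ?thesis by (simp add: power_mult_distrib)
    qed
    have w: "(\<integral>\<^sup>+ t. ennreal (9 * (f t)\<^sup>2) \<partial>\<nu> x) < \<infinity>"
      using fin by (simp add: ennreal_mult nn_integral_cmult ennreal_mult_less_top)
    have "(\<lambda>n. \<integral>\<^sup>+ t. ennreal ((s n t - f t)\<^sup>2) \<partial>\<nu> x) \<longlonglongrightarrow> (\<integral>\<^sup>+ t. ennreal ((f t - f t)\<^sup>2) \<partial>\<nu> x)"
    proof (rule nn_integral_dominated_convergence[OF _ _ _ _ w])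
      show "AE t in \<nu> x. (\<lambda>n. ennreal ((s n t - f t)\<^sup>2)) \<longlonglongrightarrow> ennreal ((f t - f t)\<^sup>2)"
        by (intro AE_I2 tendsto_ennrealI tendsto_intros lim)
    qed (auto intro!: AE_I2 ennreal_leI b2)
    then show "(\<lambda>n. \<integral>\<^sup>+ t. ennreal ((s n t - f t)\<^sup>2) \<partial>\<nu> x) \<longlonglongrightarrow> 0" by simp
    show "(\<lambda>n. \<integral>\<^sup>+ t. ennreal ((s n t)\<^sup>2) \<partial>\<nu> x) \<longlonglongrightarrow> (\<integral>\<^sup>+ t. ennreal ((f t)\<^sup>2) \<partial>\<nu> x)"
    proof (rule nn_integral_dominated_convergence[OF _ _ _ _ w])
      show "AE t in \<nu> x. (\<lambda>n. ennreal ((s n t)\<^sup>2)) \<longlonglongrightarrow> ennreal ((f t)\<^sup>2)"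
        by (intro AE_I2 tendsto_ennrealI tendsto_intros lim)
    qed (auto intro!: AE_I2 ennreal_leI b1)
  qed (rule s)
qed

text \<open>A substitute for Minkowski's inequality that holds in [0, \<infinity>] with no
  finiteness conditions; the pointwise estimate rests on ((a - c) + (b - c))^2 \<ge> 0.\<close>

lemma nn_integral_power2_triangle:
  assumes [measurable]: "f \<in> borel_measurable borel" "g \<in> borel_measurable borel"
    "h \<in> borel_measurable borel"
  shows "(\<integral>\<^sup>+ t. ennreal ((f t - g t)\<^sup>2) \<partial>\<nu> x) \<le>
    2 * (\<integral>\<^sup>+ t. ennreal ((f t - h t)\<^sup>2) \<partial>\<nu> x) + 2 * (\<integral>\<^sup>+ t. ennreal ((g t - h t)\<^sup>2) \<partial>\<nu> x)"
proof -
  have *: "(a - b)\<^sup>2 \<le> 2 * (a - c)\<^sup>2 + 2 * (b - c)\<^sup>2" for a b c :: real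
    using zero_le_power2[of "(a - c) + (b - c)"] by (simp add: power2_eq_square algebra_simps)
  have "(\<integral>\<^sup>+ t. ennreal ((f t - g t)\<^sup>2) \<partial>\<nu> x) \<le>
      (\<integral>\<^sup>+ t. 2 * ennreal ((f t - h t)\<^sup>2) + 2 * ennreal ((g t - h t)\<^sup>2) \<partial>\<nu> x)"
  proof (rule nn_integral_mono)
    fix t
    show "ennreal ((f t - g t)\<^sup>2) \<le> 2 * ennreal ((f t - h t)\<^sup>2) + 2 * ennreal ((g t - h t)\<^sup>2)"
      using ennreal_leI[OF *[of "f t" "g t" "h t"]] by (simp add: ennreal_plus ennreal_mult)
  qed
  then show ?thesis by (simp add: nn_integral_add nn_integral_cmult)
qed

text \<open>By the isometry, simple functions converging in L2 of \<nu> x have Cauchy integrals, and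
  any two such sequences have the same limit; so the definite description in
  \<open>spectral_integral\<close> denotes.\<close>

lemma spectral_integral_SomeE:
  assumes f [measurable]: "f \<in> borel_measurable borel" and x: "x \<in> carrier H"
    and fin: "(\<integral>\<^sup>+ t. ennreal ((f t)\<^sup>2) \<partial>\<nu> x) < \<infinity>"
  obtains y where "y \<in> carrier H" "spectral_integral H E f x = Some y"
    "\<And>s. \<lbrakk>\<And>n. simple_function borel (s n);
        (\<lambda>n. \<integral>\<^sup>+ t. ennreal ((s n t - f t)\<^sup>2) \<partial>\<nu> x) \<longlonglongrightarrow> 0\<rbrakk> \<Longrightarrow>
      (\<lambda>n. hnorm H (simple_int (s n) x \<ominus> y)) \<longlonglongrightarrow> 0"
proof -
  let ?d = "\<lambda>s. \<integral>\<^sup>+ t. ennreal ((s t - f t)\<^sup>2) \<partial>\<nu> x"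
  obtain s where s: "\<And>n. simple_function borel (s n)" and s_lim: "(\<lambda>n. ?d (s n)) \<longlonglongrightarrow> 0"
    using fin by (rule_tac obtain_simple_approx[OF f]) blast
  have meas: "r \<in> borel_measurable borel" if "simple_function borel r" for r :: "real \<Rightarrow> real"
    using that borel_measurable_simple_function by blast
  have le: "ennreal ((hnorm H (simple_int r x \<ominus> simple_int r' x))\<^sup>2) \<le> 2 * ?d r + 2 * ?d r'"
    if "simple_function borel r" "simple_function borel r'" for r r'
    unfolding nn_integral_simple_diff[OF that x, symmetric]
    using that by (intro nn_integral_power2_triangle meas f)
  have "\<exists>N. \<forall>n\<ge>N. \<forall>m\<ge>N. hnorm H (simple_int (s n) x \<ominus> simple_int (s m) x) < \<epsilon>" if "\<epsilon> > 0" for \<epsilon>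
  proof -
    \<comment> \<open>Two errors below \<epsilon>^2 / 8, each doubled by \<open>le\<close>, add up
      to \<epsilon>^2 / 2 < \<epsilon>^2.\<close>
    have "\<forall>\<^sub>F n in sequentially. ?d (s n) < ennreal (\<epsilon>\<^sup>2 / 8)"
      using s_lim that by (intro order_tendstoD) auto
    then obtain N where N: "\<And>n. n \<ge> N \<Longrightarrow> ?d (s n) < ennreal (\<epsilon>\<^sup>2 / 8)"
      by (auto simp: eventually_sequentially)
    have "hnorm H (simple_int (s n) x \<ominus> simple_int (s m) x) < \<epsilon>" if "n \<ge> N" "m \<ge> N" for n m
    proof -
      have "ennreal ((hnorm H (simple_int (s n) x \<ominus> simple_int (s m) x))\<^sup>2) \<le>
          2 * ?d (s n) + 2 * ?d (s m)"
        using s by (intro le)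
      also have "\<dots> \<le> 2 * ennreal (\<epsilon>\<^sup>2 / 8) + 2 * ennreal (\<epsilon>\<^sup>2 / 8)"
        using N[OF that(1)] N[OF that(2)] by (intro add_mono mult_left_mono) auto
      also have "\<dots> = ennreal (\<epsilon>\<^sup>2 / 2)"
        by (simp add: ennreal_mult[symmetric] ennreal_plus[symmetric] flip: ennreal_numeral del: ennreal_plus)
      finally have "(hnorm H (simple_int (s n) x \<ominus> simple_int (s m) x))\<^sup>2 \<le> \<epsilon>\<^sup>2 / 2"
        by (simp add: ennreal_le_iff)
      also have "\<dots> < \<epsilon>\<^sup>2" using \<open>\<epsilon> > 0\<close> by simp
      finally show ?thesis using \<open>\<epsilon> > 0\<close> by (simp add: power2_less_imp_less)
    qed
    then show ?thesis by blast
  qed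
  moreover have "range (\<lambda>n. simple_int (s n) x) \<subseteq> carrier H"
    using s x by auto
  ultimately obtain y where y: "y \<in> carrier H" "(\<lambda>n. hnorm H (simple_int (s n) x \<ominus> y)) \<longlonglongrightarrow> 0"
    using complete[unfolded mcomplete_iff, rule_format, of "\<lambda>n. simple_int (s n) x"] by blast
  have lim: "(\<lambda>n. hnorm H (simple_int (r n) x \<ominus> y)) \<longlonglongrightarrow> 0"
    if r: "\<And>n. simple_function borel (r n)" "(\<lambda>n. ?d (r n)) \<longlonglongrightarrow> 0" for r
  proof -
    have "(\<lambda>n. 2 * ?d (r n) + 2 * ?d (s n)) \<longlonglongrightarrow> 2 * 0 + 2 * 0"
      by (intro tendsto_add ennreal_tendsto_cmult r s_lim) auto
    then have "(\<lambda>n. 2 * ?d (r n) + 2 * ?d (s n)) \<longlonglongrightarrow> 0" by simp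
    then have "(\<lambda>n. ennreal ((hnorm H (simple_int (r n) x \<ominus> simple_int (s n) x))\<^sup>2)) \<longlonglongrightarrow> 0"
    proof (rule tendsto_sandwich[OF always_eventually always_eventually tendsto_const, rotated 2])
      show "\<forall>n. ennreal ((hnorm H (simple_int (r n) x \<ominus> simple_int (s n) x))\<^sup>2) \<le>
          2 * ?d (r n) + 2 * ?d (s n)"
        using le r(1) s by blast
    qed simp_all
    then have "(\<lambda>n. hnorm H (simple_int (r n) x \<ominus> simple_int (s n) x)) \<longlonglongrightarrow> 0"
      by (simp add: ennreal_tendsto_0_iff)
    from tendsto_add[OF this y(2)]
    have "(\<lambda>n. hnorm H (simple_int (r n) x \<ominus> simple_int (s n) x) +
        hnorm H (simple_int (s n) x \<ominus> y)) \<longlonglongrightarrow> 0" by simp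
    then show ?thesis
    proof (rule tendsto_sandwich[OF always_eventually always_eventually tendsto_const, rotated 2])
      show "\<forall>n. hnorm H (simple_int (r n) x \<ominus> y) \<le>
          hnorm H (simple_int (r n) x \<ominus> simple_int (s n) x) + hnorm H (simple_int (s n) x \<ominus> y)"
        using r(1) s x y(1) by (intro allI hnorm_minus_triangle simple_int_closed)
      show "\<forall>n. 0 \<le> hnorm H (simple_int (r n) x \<ominus> y)"
        using r(1) x y(1) by simp
    qed
  qed
  let ?P = "\<lambda>y. \<forall>s :: nat \<Rightarrow> real \<Rightarrow> real. (\<forall>n. simple_function borel (s n)) \<longrightarrow>
      (\<lambda>n. ?d (s n)) \<longlonglongrightarrow> 0 \<longrightarrow> limitin (htopology H) (\<lambda>n. simple_int (s n) x) y sequentially"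
  have "(THE y. ?P y) = y"
  proof (rule the_equality)
    show "?P y" using lim x y by (auto simp: limitin_iff)
    \<comment> \<open>Uniqueness needs at least one admissible sequence, as \<open>?P\<close> would
      otherwise hold vacuously; the sequence \<open>s\<close> obtained at the start supplies
      it.\<close>
    fix y' assume "?P y'"
    then have lim': "limitin (htopology H) (\<lambda>n. simple_int (s n) x) y' sequentially"
      using s s_lim by auto
    interpret Metric_space "carrier H" "hdist H" by (rule Metric_space_hdist)
    have y': "y' \<in> carrier H"
      using limitin_mspace[OF lim'[unfolded htopology_def]] .
    then show "y' = y"
      using hlimit_unique[of "\<lambda>n. simple_int (s n) x" y' y] lim' s x y by (simp add: limitin_iff)
  qed
  then show thesis
    using that[OF y(1) _ lim] x fin by (simp add: spectral_integral_def)
qed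

lemma in_dom_spectral_integral:
  "x \<in> dom (spectral_integral H E f) \<longleftrightarrow>
    x \<in> carrier H \<and> (\<integral>\<^sup>+ t. ennreal ((f t)\<^sup>2) \<partial>\<nu> x) < \<infinity>"
  by (auto simp: spectral_integral_def dom_def)

end

text \<open>Passes a setwise bound to integrals by the usual induction on nonnegative measurable
  functions. It is applied with c = 2 to the spectral measures of x \<oplus> y, x and y.\<close>

lemma nn_integral_le_two_measures:
  assumes f: "f \<in> borel_measurable M"
    and sets [measurable_cong]: "sets N1 = sets M" "sets N2 = sets M"
    and le: "\<And>A. A \<in> sets M \<Longrightarrow> emeasure M A \<le> c * emeasure N1 A + c * emeasure N2 A"
  shows "(\<integral>\<^sup>+ t. f t \<partial>M) \<le> c * (\<integral>\<^sup>+ t. f t \<partial>N1) + c * (\<integral>\<^sup>+ t. f t \<partial>N2)"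
  using f
proof induction
  case (cong f g)
  have "space N1 = space M" "space N2 = space M"
    using sets by (auto dest: sets_eq_imp_space_eq)
  then have "nn_integral N f = nn_integral N g" if "N \<in> {M, N1, N2}" for N
    using that cong(3) by (auto intro!: nn_integral_cong)
  then show ?case using cong(4) by simp
next
  case (set A)
  then show ?case using le[OF set] sets by simp
next
  case (mult u a)
  then have "u \<in> borel_measurable N1" "u \<in> borel_measurable N2" by measurable
  with mult have "(\<integral>\<^sup>+ t. a * u t \<partial>M) \<le> a * (c * (\<integral>\<^sup>+ t. u t \<partial>N1) + c * (\<integral>\<^sup>+ t. u t \<partial>N2))"
    by (simp add: nn_integral_cmult mult_left_mono)
  then show ?case
    using mult \<open>u \<in> borel_measurable N1\<close> \<open>u \<in> borel_measurable N2\<close>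
    by (simp add: nn_integral_cmult distrib_left mult_ac)
next
  case (add u v)
  then have [measurable]: "u \<in> borel_measurable N1" "u \<in> borel_measurable N2"
    "v \<in> borel_measurable N1" "v \<in> borel_measurable N2" by measurable
  have "(\<integral>\<^sup>+ t. v t + u t \<partial>M) = (\<integral>\<^sup>+ t. v t \<partial>M) + (\<integral>\<^sup>+ t. u t \<partial>M)"
    using add by (intro nn_integral_add)
  also have "\<dots> \<le> (c * (\<integral>\<^sup>+ t. v t \<partial>N1) + c * (\<integral>\<^sup>+ t. v t \<partial>N2)) +
      (c * (\<integral>\<^sup>+ t. u t \<partial>N1) + c * (\<integral>\<^sup>+ t. u t \<partial>N2))"
    using add by (intro add_mono)
  finally show ?case
    by (simp add: nn_integral_add distrib_left add_ac)
next
  case (seq U)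
  then have [measurable]: "U i \<in> borel_measurable N1" "U i \<in> borel_measurable N2" for i
    by measurable
  have "(\<integral>\<^sup>+ t. (SUP i. U i) t \<partial>M) = (SUP i. \<integral>\<^sup>+ t. U i t \<partial>M)"
    using seq by (simp add: nn_integral_monotone_convergence_SUP image_comp)
  also have "\<dots> \<le> c * (\<integral>\<^sup>+ t. (SUP i. U i) t \<partial>N1) + c * (\<integral>\<^sup>+ t. (SUP i. U i) t \<partial>N2)"
  proof (rule SUP_least)
    fix i
    have "U i t \<le> (SUP i. U i) t" for t
      unfolding SUP_apply by (rule SUP_upper) simp
    then have "c * (\<integral>\<^sup>+ t. U i t \<partial>N1) + c * (\<integral>\<^sup>+ t. U i t \<partial>N2) \<le>
        c * (\<integral>\<^sup>+ t. (SUP i. U i) t \<partial>N1) + c * (\<integral>\<^sup>+ t. (SUP i. U i) t \<partial>N2)"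
      by (intro add_mono mult_left_mono nn_integral_mono) auto
    with seq.IH[of i] show "(\<integral>\<^sup>+ t. U i t \<partial>M) \<le>
        c * (\<integral>\<^sup>+ t. (SUP i. U i) t \<partial>N1) + c * (\<integral>\<^sup>+ t. (SUP i. U i) t \<partial>N2)"
      by (rule order_trans)
  qed
  finally show ?case .
qed

section \<open>The operator \<integral> f dE: linearity, isometry, cut-offs,
  self-adjointness\<close>

context spectral_resolution
begin

abbreviation spec_op :: "(real \<Rightarrow> real) \<Rightarrow> 'v \<Rightarrow> 'v"
  where "spec_op f x \<equiv> the (spectral_integral H E f x)"

abbreviation spec_dom :: "(real \<Rightarrow> real) \<Rightarrow> 'v set"
  where "spec_dom f \<equiv> dom (spectral_integral H E f)"

lemma spec_dom_carrier: "x \<in> spec_dom f \<Longrightarrow> x \<in> carrier H"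
  by (simp add: in_dom_spectral_integral)

text \<open>One sequence of simple functions approximates the operator at every vector of its domain
  simultaneously; isometry, symmetry, linearity and commutation with E then follow by passing to the
  limit.\<close>

lemma obtain_spec_op_approx:
  assumes f: "f \<in> borel_measurable borel"
  obtains s :: "nat \<Rightarrow> real \<Rightarrow> real" where "\<And>n. simple_function borel (s n)"
    and "\<And>x. x \<in> spec_dom f \<Longrightarrow> spec_op f x \<in> carrier H"
    and "\<And>x. x \<in> spec_dom f \<Longrightarrow> (\<lambda>n. hnorm H (simple_int (s n) x \<ominus> spec_op f x)) \<longlonglongrightarrow> 0"
    and "\<And>x. x \<in> spec_dom f \<Longrightarrow>
      (\<lambda>n. \<integral>\<^sup>+ t. ennreal ((s n t)\<^sup>2) \<partial>\<nu> x) \<longlonglongrightarrow> (\<integral>\<^sup>+ t. ennreal ((f t)\<^sup>2) \<partial>\<nu> x)"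
proof -
  obtain s where s: "\<And>n. simple_function borel (s n)"
    and s1: "\<And>x. (\<integral>\<^sup>+ t. ennreal ((f t)\<^sup>2) \<partial>\<nu> x) < \<infinity> \<Longrightarrow>
      (\<lambda>n. \<integral>\<^sup>+ t. ennreal ((s n t - f t)\<^sup>2) \<partial>\<nu> x) \<longlonglongrightarrow> 0"
    and s2: "\<And>x. (\<integral>\<^sup>+ t. ennreal ((f t)\<^sup>2) \<partial>\<nu> x) < \<infinity> \<Longrightarrow>
      (\<lambda>n. \<integral>\<^sup>+ t. ennreal ((s n t)\<^sup>2) \<partial>\<nu> x) \<longlonglongrightarrow> (\<integral>\<^sup>+ t. ennreal ((f t)\<^sup>2) \<partial>\<nu> x)"
    by (rule obtain_simple_approx[OF f]) blast
  have "spec_op f x \<in> carrier H \<and> (\<lambda>n. hnorm H (simple_int (s n) x \<ominus> spec_op f x)) \<longlonglongrightarrow> 0"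
    if "x \<in> spec_dom f" for x
  proof -
    from that have x: "x \<in> carrier H" and fin: "(\<integral>\<^sup>+ t. ennreal ((f t)\<^sup>2) \<partial>\<nu> x) < \<infinity>"
      by (auto simp: in_dom_spectral_integral)
    obtain y where "y \<in> carrier H" "spectral_integral H E f x = Some y"
      and "\<And>s. \<lbrakk>\<And>n. simple_function borel (s n);
        (\<lambda>n. \<integral>\<^sup>+ t. ennreal ((s n t - f t)\<^sup>2) \<partial>\<nu> x) \<longlonglongrightarrow> 0\<rbrakk> \<Longrightarrow>
      (\<lambda>n. hnorm H (simple_int (s n) x \<ominus> y)) \<longlonglongrightarrow> 0"
      by (rule spectral_integral_SomeE[OF f x fin]) blast
    then show ?thesis using s s1[OF fin] by simp
  qed
  with s s2 show thesis
    by (intro that[of s]) (auto simp: in_dom_spectral_integral)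
qed

lemma spec_op_closed:
  assumes "f \<in> borel_measurable borel" "x \<in> spec_dom f"
  shows "spec_op f x \<in> carrier H"
  using assms(2) by (rule_tac obtain_spec_op_approx[OF assms(1)]) blast

lemma hnorm_spec_op:
  assumes f: "f \<in> borel_measurable borel" and x: "x \<in> spec_dom f"
  shows "ennreal ((hnorm H (spec_op f x))\<^sup>2) = (\<integral>\<^sup>+ t. ennreal ((f t)\<^sup>2) \<partial>\<nu> x)"
proof -
  obtain s where s: "\<And>n. simple_function borel (s n)"
    and l1: "(\<lambda>n. hnorm H (simple_int (s n) x \<ominus> spec_op f x)) \<longlonglongrightarrow> 0"
    and l2: "(\<lambda>n. \<integral>\<^sup>+ t. ennreal ((s n t)\<^sup>2) \<partial>\<nu> x) \<longlonglongrightarrow> (\<integral>\<^sup>+ t. ennreal ((f t)\<^sup>2) \<partial>\<nu> x)"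
    using x by (rule_tac obtain_spec_op_approx[OF f]) blast
  have xH: "x \<in> carrier H" using x by (rule spec_dom_carrier)
  have "(\<lambda>n. ennreal ((hnorm H (simple_int (s n) x))\<^sup>2)) \<longlonglongrightarrow> ennreal ((hnorm H (spec_op f x))\<^sup>2)"
    using s xH spec_op_closed[OF f x] l1
    by (intro tendsto_ennrealI tendsto_power tendsto_hnorm) auto
  moreover have "(\<lambda>n. ennreal ((hnorm H (simple_int (s n) x))\<^sup>2)) \<longlonglongrightarrow>
      (\<integral>\<^sup>+ t. ennreal ((f t)\<^sup>2) \<partial>\<nu> x)"
    using l2 by (simp only: nn_integral_simple[OF s xH])
  ultimately show ?thesis by (rule LIMSEQ_unique)
qed

lemma spec_op_symmetric:
  assumes f: "f \<in> borel_measurable borel" and x: "x \<in> spec_dom f" and z: "z \<in> spec_dom f"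
  shows "\<langle>z, spec_op f x\<rangle> = \<langle>spec_op f z, x\<rangle>"
proof -
  obtain s where s: "\<And>n. simple_function borel (s n)"
    and c: "\<And>x. x \<in> spec_dom f \<Longrightarrow> spec_op f x \<in> carrier H"
    and l: "\<And>x. x \<in> spec_dom f \<Longrightarrow> (\<lambda>n. hnorm H (simple_int (s n) x \<ominus> spec_op f x)) \<longlonglongrightarrow> 0"
    by (rule obtain_spec_op_approx[OF f]) blast
  note H = spec_dom_carrier[OF x] spec_dom_carrier[OF z]
  have "(\<lambda>n. \<langle>z, simple_int (s n) x\<rangle>) \<longlonglongrightarrow> \<langle>z, spec_op f x\<rangle>"
    using s c x H l by (intro tendsto_cinner_right) auto
  moreover have "(\<lambda>n. \<langle>z, simple_int (s n) x\<rangle>) \<longlonglongrightarrow> \<langle>spec_op f z, x\<rangle>"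
    unfolding simple_int_symmetric[OF s H]
    using s c z H l by (intro tendsto_cinner_left) auto
  ultimately show ?thesis by (rule LIMSEQ_unique)
qed

text \<open>Multiplicativity of E turns cutting off the vector by E \<tau> into restricting its
  spectral measure to \<tau>.\<close>

lemma spectral_measure_E:
  assumes x: "x \<in> carrier H" and \<tau>: "\<tau> \<in> sets borel"
  shows "\<nu> (E \<tau> x) = density (\<nu> x) (indicator \<tau>)"
proof (rule measure_eqI)
  fix A assume "A \<in> sets (\<nu> (E \<tau> x))"
  then have A: "A \<in> sets borel" by (simp add: sets_spectral_measure)
  have "emeasure (density (\<nu> x) (indicator \<tau>)) A = emeasure (\<nu> x) (\<tau> \<inter> A)"
    using A \<tau> by (simp add: emeasure_density sets_spectral_measure flip: indicator_inter_arith)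
  then show "emeasure (\<nu> (E \<tau> x)) A = emeasure (density (\<nu> x) (indicator \<tau>)) A"
    using A \<tau> x by (simp add: emeasure_spectral_measure E_Int Int_commute)
qed (simp add: sets_spectral_measure)

lemma nn_integral_spectral_measure_E:
  assumes "x \<in> carrier H" "\<tau> \<in> sets borel" "f \<in> borel_measurable borel"
  shows "(\<integral>\<^sup>+ t. f t \<partial>\<nu> (E \<tau> x)) = (\<integral>\<^sup>+ t. f t * indicator \<tau> t \<partial>\<nu> x)"
  using assms
  by (simp add: spectral_measure_E nn_integral_density mult.commute)

text \<open>The cross term in ||E(A) x + E(A) y||^2 has no sign and is absorbed by doubling both
  squares. In particular the domain of a spectral integral is closed under addition.\<close>

lemma nn_integral_spectral_measure_add_le:
  assumes x: "x \<in> carrier H" and y: "y \<in> carrier H" and f: "f \<in> borel_measurable borel"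
  shows "(\<integral>\<^sup>+ t. f t \<partial>\<nu> (x \<oplus> y)) \<le> 2 * (\<integral>\<^sup>+ t. f t \<partial>\<nu> x) + 2 * (\<integral>\<^sup>+ t. f t \<partial>\<nu> y)"
proof (rule nn_integral_le_two_measures)
  fix A assume "A \<in> sets (\<nu> (x \<oplus> y))"
  then have A: "A \<in> sets borel" by (simp add: sets_spectral_measure)
  have "ennreal ((hnorm H (E A (x \<oplus> y)))\<^sup>2) \<le> ennreal (2 * (hnorm H (E A x))\<^sup>2 + 2 * (hnorm H (E A y))\<^sup>2)"
    using hnorm_add_power2_le[of "E A x" "E A y"] x y A
    by (intro ennreal_leI) (simp add: proj_add[OF E_proj])
  then show "emeasure (\<nu> (x \<oplus> y)) A \<le> 2 * emeasure (\<nu> x) A + 2 * emeasure (\<nu> y) A"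
    using x y A by (simp add: emeasure_spectral_measure ennreal_plus ennreal_mult)
qed (use f in \<open>simp_all add: sets_spectral_measure\<close>)

lemma spectral_measure_smult:
  assumes "x \<in> carrier H"
  shows "\<nu> (c \<odot> x) = scale_measure (ennreal ((cmod c)\<^sup>2)) (\<nu> x)"
proof (rule measure_eqI)
  fix A assume "A \<in> sets (\<nu> (c \<odot> x))"
  then have A: "A \<in> sets borel" by (simp add: sets_spectral_measure)
  then show "emeasure (\<nu> (c \<odot> x)) A = emeasure (scale_measure (ennreal ((cmod c)\<^sup>2)) (\<nu> x)) A"
    using assms
    by (simp add: emeasure_spectral_measure smult_in_carrier proj_smult[OF E_proj] hnorm_smult
        power_mult_distrib ennreal_mult)
qed (simp add: sets_spectral_measure)

lemma nn_integral_spectral_measure_smult: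
  assumes "x \<in> carrier H" "f \<in> borel_measurable borel"
  shows "(\<integral>\<^sup>+ t. f t \<partial>\<nu> (c \<odot> x)) = ennreal ((cmod c)\<^sup>2) * (\<integral>\<^sup>+ t. f t \<partial>\<nu> x)"
  using assms by (simp add: spectral_measure_smult nn_integral_scale_measure)

lemma submodule_spec_dom:
  assumes [measurable]: "f \<in> borel_measurable borel"
  shows "submodule (spec_dom f) complex_ring H"
proof (rule submoduleI_complex)
  show "spec_dom f \<subseteq> carrier H" by (rule subsetI) (rule spec_dom_carrier)
  have *: "c \<odot> x \<in> spec_dom f" if "x \<in> spec_dom f" for c x
    using that
    by (auto simp: in_dom_spectral_integral smult_in_carrier nn_integral_spectral_measure_smult
        ennreal_mult_less_top)
  then show "\<And>c x. x \<in> spec_dom f \<Longrightarrow> c \<odot> x \<in> spec_dom f" .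
  \<comment> \<open>The spectral measure of the zero vector is the null measure, so every integral
    against it vanishes.\<close>
  have "emeasure (\<nu> \<zero>) UNIV = 0"
    by (simp add: emeasure_spectral_measure_UNIV)
  then have "AE t in \<nu> \<zero>. False"
    by (intro AE_I[of _ _ UNIV]) (auto simp: sets_spectral_measure)
  then have "(\<integral>\<^sup>+ t. ennreal ((f t)\<^sup>2) \<partial>\<nu> \<zero>) = (\<integral>\<^sup>+ t. 0 \<partial>\<nu> \<zero>)"
    by (intro nn_integral_cong_AE) auto
  then show "\<zero> \<in> spec_dom f" by (simp add: in_dom_spectral_integral)
  fix x y assume "x \<in> spec_dom f" "y \<in> spec_dom f"
  then show "x \<oplus> y \<in> spec_dom f"
    using nn_integral_spectral_measure_add_le[of x y "\<lambda>t. ennreal ((f t)\<^sup>2)"]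
    by (auto simp: in_dom_spectral_integral ennreal_mult_less_top elim!: le_less_trans)
qed

lemma E_spec_dom:
  assumes [measurable]: "f \<in> borel_measurable borel" "\<tau> \<in> sets borel" and x: "x \<in> spec_dom f"
  shows "E \<tau> x \<in> spec_dom f"
proof -
  have "(\<integral>\<^sup>+ t. ennreal ((f t)\<^sup>2) * indicator \<tau> t \<partial>\<nu> x) \<le> (\<integral>\<^sup>+ t. ennreal ((f t)\<^sup>2) \<partial>\<nu> x)"
    by (intro nn_integral_mono) (auto simp: indicator_def)
  then show ?thesis
    using x by (auto simp: in_dom_spectral_integral nn_integral_spectral_measure_E)
qed

text \<open>The measure \<nu> x is finite and f^2 \<le> b^2 on \<tau>. Such vectors E \<tau> x are
  the supply of domain elements in all density arguments.\<close>

lemma E_bounded_spec_dom: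
  assumes [measurable]: "f \<in> borel_measurable borel" "\<tau> \<in> sets borel" and x: "x \<in> carrier H"
    and b: "\<And>t. t \<in> \<tau> \<Longrightarrow> \<bar>f t\<bar> \<le> b"
  shows "E \<tau> x \<in> spec_dom f"
proof -
  interpret finite_measure "\<nu> x" by (rule finite_spectral_measure[OF x])
  have "(\<integral>\<^sup>+ t. ennreal ((f t)\<^sup>2) * indicator \<tau> t \<partial>\<nu> x) \<le> (\<integral>\<^sup>+ t. ennreal (b\<^sup>2) \<partial>\<nu> x)"
    using b by (intro nn_integral_mono) (auto simp: indicator_def abs_le_square_iff[symmetric]
        intro!: ennreal_leI order_trans[OF b])
  also have "\<dots> < \<infinity>"
    using emeasure_finite by (simp add: ennreal_mult_eq_top_iff less_top[symmetric])
  finally show ?thesis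
    using x by (auto simp: in_dom_spectral_integral nn_integral_spectral_measure_E)
qed

lemma spec_op_add:
  assumes f: "f \<in> borel_measurable borel" and x: "x \<in> spec_dom f" and y: "y \<in> spec_dom f"
  shows "spec_op f (x \<oplus> y) = spec_op f x \<oplus> spec_op f y"
proof -
  obtain s where s: "\<And>n. simple_function borel (s n)"
    and c: "\<And>x. x \<in> spec_dom f \<Longrightarrow> spec_op f x \<in> carrier H"
    and l: "\<And>x. x \<in> spec_dom f \<Longrightarrow> (\<lambda>n. hnorm H (simple_int (s n) x \<ominus> spec_op f x)) \<longlonglongrightarrow> 0"
    by (rule obtain_spec_op_approx[OF f]) blast
  have xy: "x \<oplus> y \<in> spec_dom f" using submodule_complexD(3)[OF submodule_spec_dom[OF f] x y] .
  note H = spec_dom_carrier[OF x] spec_dom_carrier[OF y] spec_dom_carrier[OF xy]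
  show ?thesis
  proof (rule cinner_ext)
    fix z assume z: "z \<in> carrier H"
    have 1: "(\<lambda>n. \<langle>z, simple_int (s n) u\<rangle>) \<longlonglongrightarrow> \<langle>z, spec_op f u\<rangle>" if "u \<in> spec_dom f" for u
      using s c that spec_dom_carrier[OF that] l z by (intro tendsto_cinner_right) auto
    from tendsto_add[OF 1[OF x] 1[OF y]]
    have "(\<lambda>n. \<langle>z, simple_int (s n) (x \<oplus> y)\<rangle>) \<longlonglongrightarrow> \<langle>z, spec_op f x\<rangle> + \<langle>z, spec_op f y\<rangle>"
      using s H z by (simp add: simple_int_add cinner_add_right)
    from LIMSEQ_unique[OF 1[OF xy] this]
    show "\<langle>z, spec_op f (x \<oplus> y)\<rangle> = \<langle>z, spec_op f x \<oplus> spec_op f y\<rangle>"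
      using c[OF x] c[OF y] z by (simp add: cinner_add_right)
  qed (use c x y xy in auto)
qed

lemma spec_op_smult:
  assumes f: "f \<in> borel_measurable borel" and x: "x \<in> spec_dom f"
  shows "spec_op f (a \<odot> x) = a \<odot> spec_op f x"
proof -
  obtain s where s: "\<And>n. simple_function borel (s n)"
    and c: "\<And>x. x \<in> spec_dom f \<Longrightarrow> spec_op f x \<in> carrier H"
    and l: "\<And>x. x \<in> spec_dom f \<Longrightarrow> (\<lambda>n. hnorm H (simple_int (s n) x \<ominus> spec_op f x)) \<longlonglongrightarrow> 0"
    by (rule obtain_spec_op_approx[OF f]) blast
  have ax: "a \<odot> x \<in> spec_dom f" using submodule_complexD(4)[OF submodule_spec_dom[OF f] x] .
  note H = spec_dom_carrier[OF x] spec_dom_carrier[OF ax]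
  show ?thesis
  proof (rule cinner_ext)
    fix z assume z: "z \<in> carrier H"
    have 1: "(\<lambda>n. \<langle>z, simple_int (s n) u\<rangle>) \<longlonglongrightarrow> \<langle>z, spec_op f u\<rangle>" if "u \<in> spec_dom f" for u
      using s c that spec_dom_carrier[OF that] l z by (intro tendsto_cinner_right) auto
    from tendsto_mult[OF tendsto_const[of a] 1[OF x]]
    have "(\<lambda>n. \<langle>z, simple_int (s n) (a \<odot> x)\<rangle>) \<longlonglongrightarrow> a * \<langle>z, spec_op f x\<rangle>"
      using s H z by (simp add: simple_int_smult cinner_smult_right)
    from LIMSEQ_unique[OF 1[OF ax] this]
    show "\<langle>z, spec_op f (a \<odot> x)\<rangle> = \<langle>z, a \<odot> spec_op f x\<rangle>"
      using c[OF x] z by (simp add: cinner_smult_right)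
  qed (use c x ax in \<open>auto intro: smult_in_carrier\<close>)
qed

lemma spec_op_E:
  assumes f: "f \<in> borel_measurable borel" and \<tau>: "\<tau> \<in> sets borel" and x: "x \<in> spec_dom f"
  shows "spec_op f (E \<tau> x) = E \<tau> (spec_op f x)"
proof -
  obtain s where s: "\<And>n. simple_function borel (s n)"
    and c: "\<And>x. x \<in> spec_dom f \<Longrightarrow> spec_op f x \<in> carrier H"
    and l: "\<And>x. x \<in> spec_dom f \<Longrightarrow> (\<lambda>n. hnorm H (simple_int (s n) x \<ominus> spec_op f x)) \<longlonglongrightarrow> 0"
    by (rule obtain_spec_op_approx[OF f]) blast
  have ex: "E \<tau> x \<in> spec_dom f" by (rule E_spec_dom[OF f \<tau> x])
  note H = spec_dom_carrier[OF x] spec_dom_carrier[OF ex]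
  show ?thesis
  proof (rule cinner_ext)
    fix z assume z: "z \<in> carrier H"
    have 1: "(\<lambda>n. \<langle>z, simple_int (s n) u\<rangle>) \<longlonglongrightarrow> \<langle>z, spec_op f u\<rangle>"
      if "u \<in> spec_dom f" "z \<in> carrier H" for u z
      using s c that spec_dom_carrier[OF that(1)] l by (intro tendsto_cinner_right) auto
    have "(\<lambda>n. \<langle>z, simple_int (s n) (E \<tau> x)\<rangle>) \<longlonglongrightarrow> \<langle>E \<tau> z, spec_op f x\<rangle>"
      using 1[OF x, of "E \<tau> z"] s H z \<tau> by (simp add: simple_int_E proj_symmetric[OF E_proj])
    from LIMSEQ_unique[OF 1[OF ex z] this]
    show "\<langle>z, spec_op f (E \<tau> x)\<rangle> = \<langle>z, E \<tau> (spec_op f x)\<rangle>"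
      using c[OF x] z \<tau> by (simp add: proj_symmetric[OF E_proj])
  qed (use c x ex \<tau> in auto)
qed

text \<open>The definition of a projection-valued measure offers additivity only as a limit of sums.
  The finite case is read off from the measure \<nu> x: expanding the squared norm of the difference
  of both sides gives 0.\<close>

lemma E_Compl:
  assumes x: "x \<in> carrier H" and \<tau>: "\<tau> \<in> sets borel"
  shows "E (- \<tau>) x = x \<ominus> E \<tau> x"
proof -
  interpret finite_measure "\<nu> x" by (rule finite_spectral_measure[OF x])
  have \<tau>': "- \<tau> \<in> sets borel" using \<tau> by auto
  have Re_cinner: "Re \<langle>x, E \<sigma> x\<rangle> = (hnorm H (E \<sigma> x))\<^sup>2" if "\<sigma> \<in> sets borel" for \<sigma>
    using that x by (simp add: proj_cinner_self[OF E_proj])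
  have sum: "(hnorm H (E (- \<tau>) x))\<^sup>2 = (hnorm H x)\<^sup>2 - (hnorm H (E \<tau> x))\<^sup>2"
    using finite_measure_compl[of \<tau>] x \<tau> \<tau>'
    by (simp add: sets_spectral_measure measure_spectral_measure E_UNIV Compl_eq_Diff_UNIV)
  have "\<langle>E (- \<tau>) x, E \<tau> x\<rangle> = 0"
    using x \<tau> \<tau>' by (simp add: E_cinner E_empty)
  moreover have "Re \<langle>E (- \<tau>) x, x\<rangle> = (hnorm H (E (- \<tau>) x))\<^sup>2"
    using Re_cinner[OF \<tau>'] arg_cong[OF cinner_commute[of x "E (- \<tau>) x"], of Re] x \<tau>' by simp
  ultimately have "(hnorm H (E (- \<tau>) x \<ominus> (x \<ominus> E \<tau> x)))\<^sup>2 = 0"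
    using x \<tau> \<tau>' sum Re_cinner[OF \<tau>]
    by (simp add: hnorm_minus_power2 cinner_minus_right)
  then show ?thesis
    using x \<tau> \<tau>' by (simp add: hnorm_eq_zero_iff minus_eq_zero_iff)
qed

abbreviation cutoff :: "(real \<Rightarrow> real) \<Rightarrow> nat \<Rightarrow> 'v \<Rightarrow> 'v"
  where "cutoff f n \<equiv> E {t. \<bar>f t\<bar> \<le> real n}"

text \<open>The remainder x \<ominus> E({|f| \<le> n}) x equals E({|f| > n}) x, so its integral is
  the part of \<integral> g over {|f| > n}, which vanishes in the limit by dominated convergence.
  The choice g = 1 gives density in norm, g = 1 + |t| density in the spectral norm.\<close>

lemma tendsto_cutoff:
  assumes [measurable]: "f \<in> borel_measurable borel" and x: "x \<in> carrier H"
    and [measurable]: "g \<in> borel_measurable borel" and fin: "(\<integral>\<^sup>+ t. g t \<partial>\<nu> x) < \<infinity>"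
  shows "(\<lambda>n. \<integral>\<^sup>+ t. g t \<partial>\<nu> (x \<ominus> cutoff f n x)) \<longlonglongrightarrow> 0"
proof -
  have "(\<integral>\<^sup>+ t. g t \<partial>\<nu> (x \<ominus> cutoff f n x)) = (\<integral>\<^sup>+ t. g t * indicator (- {t. \<bar>f t\<bar> \<le> real n}) t \<partial>\<nu> x)" for n
    using x by (simp add: E_Compl[symmetric] nn_integral_spectral_measure_E)
  moreover have "(\<lambda>n. \<integral>\<^sup>+ t. g t * indicator (- {t. \<bar>f t\<bar> \<le> real n}) t \<partial>\<nu> x) \<longlonglongrightarrow> (\<integral>\<^sup>+ t. 0 \<partial>\<nu> x)"
  proof (rule nn_integral_dominated_convergence[OF _ _ _ _ fin])
    have "(\<lambda>n. g t * indicator (- {t. \<bar>f t\<bar> \<le> real n}) t) \<longlonglongrightarrow> 0" for t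
    proof (rule tendsto_eventually)
      obtain N :: nat where "\<bar>f t\<bar> \<le> real N" using real_arch_simple by blast
      then show "\<forall>\<^sub>F n in sequentially. g t * indicator (- {t. \<bar>f t\<bar> \<le> real n}) t = 0"
        by (intro eventually_sequentiallyI[of N]) (auto simp: indicator_def)
    qed
    then show "AE t in \<nu> x. (\<lambda>n. g t * indicator (- {t. \<bar>f t\<bar> \<le> real n}) t) \<longlonglongrightarrow> 0" by simp
  qed (auto intro!: AE_I2 simp: indicator_def)
  ultimately show ?thesis by simp
qed

lemma dense_spec_dom:
  assumes f [measurable]: "f \<in> borel_measurable borel"
  shows "dense_in H (spec_dom f)"
  unfolding dense_in_iff
proof (intro conjI ballI allI impI)
  show "spec_dom f \<subseteq> carrier H" by (rule subsetI) (rule spec_dom_carrier)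
  fix x and \<epsilon> :: real assume x: "x \<in> carrier H" and "\<epsilon> > 0"
  have [simp]: "{t. \<bar>f t\<bar> \<le> real n} \<in> sets borel" for n by measurable
  have "(\<lambda>n. \<integral>\<^sup>+ t. 1 \<partial>\<nu> (x \<ominus> cutoff f n x)) \<longlonglongrightarrow> 0"
    using x by (intro tendsto_cutoff) (auto simp: emeasure_spectral_measure_UNIV)
  then have "(\<lambda>n. ennreal ((hnorm H (x \<ominus> cutoff f n x))\<^sup>2)) \<longlonglongrightarrow> 0"
    using x by (simp add: emeasure_spectral_measure_UNIV)
  then have "(\<lambda>n. hnorm H (x \<ominus> cutoff f n x)) \<longlonglongrightarrow> 0"
    by (simp add: ennreal_tendsto_0_iff)
  from order_tendstoD(2)[OF this \<open>\<epsilon> > 0\<close>] obtain n where "hnorm H (x \<ominus> cutoff f n x) < \<epsilon>"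
    by (auto simp: eventually_sequentially)
  moreover have "cutoff f n x \<in> spec_dom f"
    using x by (intro E_bounded_spec_dom[where b = "real n"]) auto
  ultimately show "\<exists>y\<in>spec_dom f. hnorm H (x \<ominus> y) < \<epsilon>" by blast
qed

text \<open>If \<open>y = T\<^sup>* x\<close>, then \<open>T E\<^sub>n x = E\<^sub>n y\<close> for the cut-offs \<open>E\<^sub>n\<close>; so the integrals of \<open>f\<^sup>2\<close> over
  \<open>{\<bar>f\<bar> \<le> n}\<close> are bounded by \<open>\<parallel>y\<parallel>\<^sup>2\<close>, and \<open>x\<close> lies in the domain of \<open>T\<close>.\<close>

lemma self_adjoint_spectral_integral:
  assumes f [measurable]: "f \<in> borel_measurable borel"
  shows "self_adjoint H (spectral_integral H E f)"
proof -
  let ?T = "spectral_integral H E f"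
  have adj: "adjoint_relation H ?T x y \<longleftrightarrow> ?T x = Some y" for x y
  proof
    assume "?T x = Some y"
    then have "x \<in> spec_dom f" "y = spec_op f x" by auto
    then show "adjoint_relation H ?T x y"
      using spec_op_closed[OF f] spec_op_symmetric[OF f] spec_dom_carrier[of x f]
      by (auto simp: adjoint_relation_def)
  next
    assume a: "adjoint_relation H ?T x y"
    then have x: "x \<in> carrier H" and y: "y \<in> carrier H"
      and eq: "\<And>z. z \<in> spec_dom f \<Longrightarrow> \<langle>x, spec_op f z\<rangle> = \<langle>y, z\<rangle>"
      by (auto simp: adjoint_relation_def)
    have \<tau> [simp]: "{t. \<bar>f t\<bar> \<le> real n} \<in> sets borel" for n by measurable
    have cdom: "cutoff f n u \<in> spec_dom f" if "u \<in> carrier H" for n u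
      using that by (intro E_bounded_spec_dom[where b = "real n"]) auto
    have cut: "spec_op f (cutoff f n x) = cutoff f n y" for n
    proof (rule cinner_ext)
      fix u assume u: "u \<in> carrier H"
      define v where "v = cutoff f n u"
      have v: "v \<in> spec_dom f" "v \<in> carrier H" "cutoff f n v = v"
        using u cdom by (auto simp: v_def E_Int)
      note Tc = spec_op_closed[OF f]
      \<comment> \<open>The cut-off is doubled by idempotence and one copy is moved onto u. The
        resulting v lies in the domain, so the adjoint relation, given only for domain elements,
        applies to it.\<close>
      have "\<langle>u, spec_op f (cutoff f n x)\<rangle> = \<langle>u, spec_op f (cutoff f n (cutoff f n x))\<rangle>"
        using x by (simp add: E_Int)
      also have "\<dots> = \<langle>v, spec_op f (cutoff f n x)\<rangle>"
        using u x Tc[OF cdom[OF x]] unfolding v_def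
        by (subst spec_op_E[OF f]) (auto simp: cdom proj_symmetric[OF E_proj])
      also have "\<dots> = \<langle>spec_op f v, cutoff f n x\<rangle>"
        using v cdom[OF x] by (intro spec_op_symmetric[OF f])
      also have "\<dots> = \<langle>spec_op f v, x\<rangle>"
        using v x Tc[OF v(1)] spec_op_E[OF f \<tau> v(1), of n] by (simp add: proj_symmetric[OF E_proj])
      also have "\<dots> = \<langle>v, y\<rangle>"
        using eq[OF v(1)] cinner_commute[OF Tc[OF v(1)] x] cinner_commute[OF v(2) y] by simp
      also have "\<dots> = \<langle>u, cutoff f n y\<rangle>"
        using u y by (simp add: v_def proj_symmetric[OF E_proj])
      finally show "\<langle>u, spec_op f (cutoff f n x)\<rangle> = \<langle>u, cutoff f n y\<rangle>" .
    qed (use x y cdom spec_op_closed[OF f] in auto)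
    \<comment> \<open>At each t the indicators are eventually 1, so the integrand is a limit
      inferior and Fatou's lemma transfers the uniform bound ||y||^2 to the whole integral.\<close>
    have "(\<integral>\<^sup>+ t. ennreal ((f t)\<^sup>2) \<partial>\<nu> x) =
        (\<integral>\<^sup>+ t. liminf (\<lambda>n. ennreal ((f t)\<^sup>2) * indicator {t. \<bar>f t\<bar> \<le> real n} t) \<partial>\<nu> x)"
    proof (rule nn_integral_cong)
      fix t
      obtain N :: nat where "\<bar>f t\<bar> \<le> real N" using real_arch_simple by blast
      then have "(\<lambda>n. ennreal ((f t)\<^sup>2) * indicator {t. \<bar>f t\<bar> \<le> real n} t) \<longlonglongrightarrow> ennreal ((f t)\<^sup>2)"
        by (intro tendsto_eventually eventually_sequentiallyI[of N]) (auto simp: indicator_def)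
      then show "ennreal ((f t)\<^sup>2) = liminf (\<lambda>n. ennreal ((f t)\<^sup>2) * indicator {t. \<bar>f t\<bar> \<le> real n} t)"
        by (simp add: lim_imp_Liminf)
    qed
    also have "\<dots> \<le> liminf (\<lambda>n. \<integral>\<^sup>+ t. ennreal ((f t)\<^sup>2) * indicator {t. \<bar>f t\<bar> \<le> real n} t \<partial>\<nu> x)"
      by (intro nn_integral_liminf) simp
    also have "\<dots> \<le> liminf (\<lambda>n. ennreal ((hnorm H y)\<^sup>2))"
    proof (intro Liminf_mono always_eventually allI)
      fix n
      have "(\<integral>\<^sup>+ t. ennreal ((f t)\<^sup>2) * indicator {t. \<bar>f t\<bar> \<le> real n} t \<partial>\<nu> x) =
          ennreal ((hnorm H (cutoff f n y))\<^sup>2)"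
        using hnorm_spec_op[OF f cdom[OF x, of n]] x by (simp add: cut nn_integral_spectral_measure_E)
      then show "(\<integral>\<^sup>+ t. ennreal ((f t)\<^sup>2) * indicator {t. \<bar>f t\<bar> \<le> real n} t \<partial>\<nu> x) \<le>
          ennreal ((hnorm H y)\<^sup>2)"
        using proj_hnorm_le[OF E_proj[OF \<tau>] y] y
        by (simp add: ennreal_leI power_mono)
    qed
    finally have "(\<integral>\<^sup>+ t. ennreal ((f t)\<^sup>2) \<partial>\<nu> x) < \<infinity>"
      by (simp add: Liminf_const le_less_trans)
    then have xd: "x \<in> spec_dom f" using x by (simp add: in_dom_spectral_integral)
    \<comment> \<open>Once x is in the domain, symmetry gives <T x, z> = <x, T z> = <y, z> for z in
      the dense domain.\<close>
    have "spec_op f x = y"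
      using spec_op_symmetric[OF f _ xd] eq
      by (intro cinner_ext_dense[OF dense_spec_dom[OF f]] spec_op_closed[OF f xd] y) simp
    then show "?T x = Some y" using xd by auto
  qed
  have "adjoint_operator H ?T = ?T"
  proof
    fix x show "adjoint_operator H ?T x = ?T x"
      unfolding adjoint_operator_def adj by (cases "?T x") auto
  qed
  moreover have "ran ?T \<subseteq> carrier H"
  proof
    fix y assume "y \<in> ran ?T"
    then obtain x where "?T x = Some y" by (auto simp: ran_def)
    then show "y \<in> carrier H" using spec_op_closed[OF f, of x] by force
  qed
  then have "densely_defined_operator H ?T"
    unfolding densely_defined_operator_def
    using submodule_spec_dom[OF f] dense_spec_dom[OF f] spec_op_add[OF f] spec_op_smult[OF f]
    by blast
  ultimately show ?thesis by (simp add: self_adjoint_def)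
qed

end

section \<open>The quadratic form of a spectral integral\<close>

context spectral_resolution
begin

abbreviation form_dom :: "'v set"
  where "form_dom \<equiv> spec_dom (\<lambda>t. sqrt \<bar>t\<bar>)"

lemma sqrt_abs_measurable [measurable, simp]: "(\<lambda>t::real. sqrt \<bar>t\<bar>) \<in> borel_measurable borel"
  by measurable

lemma form_dom_iff: "x \<in> form_dom \<longleftrightarrow> x \<in> carrier H \<and> (\<integral>\<^sup>+ t. ennreal \<bar>t\<bar> \<partial>\<nu> x) < \<infinity>"
  by (simp add: in_dom_spectral_integral)

lemma sgn_operator_closed [simp]: "x \<in> carrier H \<Longrightarrow> sgn_operator H E x \<in> carrier H"
  by (simp add: sgn_operator_def)

lemma sgn_operator_symmetric:
  "\<lbrakk>x \<in> carrier H; y \<in> carrier H\<rbrakk> \<Longrightarrow> \<langle>x, sgn_operator H E y\<rangle> = \<langle>sgn_operator H E x, y\<rangle>"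
  by (simp add: sgn_operator_def cinner_minus_right cinner_minus_left proj_symmetric[OF E_proj])

text \<open>For y = |T|^(1/2) x the measure \<sigma> \<mapsto> ||E \<sigma> y||^2 has density |t|
  with respect to \<nu> x, because E commutes with |T|^(1/2). The sign operator then subtracts the
  part over the negative half-line from the part over the positive one.\<close>

lemma cinner_sgn_operator:
  assumes x: "x \<in> form_dom"
  defines "y \<equiv> spec_op (\<lambda>t. sqrt \<bar>t\<bar>) x"
  shows "\<langle>y, sgn_operator H E y\<rangle> = complex_of_real (\<integral>t. t \<partial>\<nu> x)"
proof -
  have xH: "x \<in> carrier H" and fin: "(\<integral>\<^sup>+ t. ennreal \<bar>t\<bar> \<partial>\<nu> x) < \<infinity>"
    using x unfolding form_dom_iff by blast+
  have y: "y \<in> carrier H" unfolding y_def by (intro spec_op_closed x) simp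
  have *: "(hnorm H (E \<sigma> y))\<^sup>2 = enn2real (\<integral>\<^sup>+ t. ennreal \<bar>t\<bar> * indicator \<sigma> t \<partial>\<nu> x)"
    if \<sigma>: "\<sigma> \<in> sets borel" for \<sigma>
  proof -
    have "E \<sigma> y = spec_op (\<lambda>t. sqrt \<bar>t\<bar>) (E \<sigma> x)"
      unfolding y_def using \<sigma> x by (simp add: spec_op_E)
    moreover have "ennreal ((hnorm H (spec_op (\<lambda>t. sqrt \<bar>t\<bar>) (E \<sigma> x)))\<^sup>2) =
        (\<integral>\<^sup>+ t. ennreal ((sqrt \<bar>t\<bar>)\<^sup>2) \<partial>\<nu> (E \<sigma> x))"
      by (rule hnorm_spec_op[OF _ E_spec_dom[OF _ \<sigma> x]]) simp_all
    ultimately have "ennreal ((hnorm H (E \<sigma> y))\<^sup>2) = (\<integral>\<^sup>+ t. ennreal \<bar>t\<bar> * indicator \<sigma> t \<partial>\<nu> x)"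
      using xH \<sigma> by (simp add: nn_integral_spectral_measure_E)
    from arg_cong[OF this, of enn2real] show ?thesis by simp
  qed
  have "integrable (\<nu> x) (\<lambda>t. t)"
    using fin by (intro integrableI_bounded) auto
  then have "(\<integral>t. t \<partial>\<nu> x) = enn2real (\<integral>\<^sup>+ t. ennreal t \<partial>\<nu> x) - enn2real (\<integral>\<^sup>+ t. ennreal (- t) \<partial>\<nu> x)"
    by (rule real_lebesgue_integral_def)
  also have "(\<integral>\<^sup>+ t. ennreal t \<partial>\<nu> x) = (\<integral>\<^sup>+ t. ennreal \<bar>t\<bar> * indicator {0<..} t \<partial>\<nu> x)"
    by (intro nn_integral_cong) (auto simp: indicator_def ennreal_neg)
  also have "(\<integral>\<^sup>+ t. ennreal (- t) \<partial>\<nu> x) = (\<integral>\<^sup>+ t. ennreal \<bar>t\<bar> * indicator {..<0} t \<partial>\<nu> x)"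
    by (intro nn_integral_cong) (auto simp: indicator_def ennreal_neg)
  finally have "(\<integral>t. t \<partial>\<nu> x) = (hnorm H (E {0<..} y))\<^sup>2 - (hnorm H (E {..<0} y))\<^sup>2"
    by (simp add: *)
  then show ?thesis
    using y by (simp add: sgn_operator_def cinner_minus_right proj_cinner_self[OF E_proj])
qed

text \<open>The integral formula only describes the diagonal; the required sesquilinear form is
  \<open>?B\<close>, that is <|T|^(1/2) x, sgn T |T|^(1/2) y>, whose symmetry is that of the sign
  operator.\<close>

lemma hermitian_quadratic_form_spectral:
  "hermitian_quadratic_form H form_dom (\<lambda>x. \<integral>t. t \<partial>\<nu> x)"
  unfolding hermitian_quadratic_form_def
proof (intro conjI exI)
  let ?S = "spec_op (\<lambda>t. sqrt \<bar>t\<bar>)"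
  let ?B = "\<lambda>x y. \<langle>?S x, sgn_operator H E (?S y)\<rangle>"
  show "submodule form_dom complex_ring H" by (rule submodule_spec_dom) simp
  show "dense_in H form_dom" by (rule dense_spec_dom) simp
  have c: "?S x \<in> carrier H" if "x \<in> form_dom" for x
    using that by (intro spec_op_closed) simp
  show "hermitian_sesquilinear H form_dom ?B"
    unfolding hermitian_sesquilinear_def
  proof (intro conjI ballI allI)
    fix x y z a assume x: "x \<in> form_dom" and y: "y \<in> form_dom"
    show "?B x (a \<odot> y) = a * ?B x y"
      using c[OF x] c[OF y] spec_op_smult[OF sqrt_abs_measurable y]
      by (simp add: sgn_operator_symmetric cinner_smult_right smult_in_carrier)
    show "?B x y = cnj (?B y x)"
      using c[OF x] c[OF y] cinner_commute[of "?S x" "sgn_operator H E (?S y)"]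
      by (simp add: sgn_operator_symmetric)
    assume z: "z \<in> form_dom"
    show "?B x (y \<oplus> z) = ?B x y + ?B x z"
      using c[OF x] c[OF y] c[OF z] spec_op_add[OF sqrt_abs_measurable y z]
      by (simp add: sgn_operator_symmetric cinner_add_right)
  qed
  show "\<forall>x\<in>form_dom. complex_of_real (\<integral>t. t \<partial>\<nu> x) = ?B x x"
    using cinner_sgn_operator by (intro ballI) simp
qed

text \<open>The square of \<open>spectral_norm\<close>, taken in [0, \<infinity>]: infinity marks
  the vectors outside the form domain, whereas the Bochner integral in \<open>spectral_norm\<close>
  defaults to 0 there. Comparisons of the two are therefore made on the form domain only.\<close>

definition energy :: "'v \<Rightarrow> ennreal"
  where "energy x = (\<integral>\<^sup>+ t. ennreal (1 + \<bar>t\<bar>) \<partial>\<nu> x)"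

lemma energy_finite_iff:
  assumes "x \<in> carrier H"
  shows "energy x < \<infinity> \<longleftrightarrow> x \<in> form_dom"
proof -
  have "energy x = (\<integral>\<^sup>+ t. 1 + ennreal \<bar>t\<bar> \<partial>\<nu> x)"
    unfolding energy_def by (intro nn_integral_cong) (simp add: ennreal_plus)
  also have "\<dots> = ennreal ((hnorm H x)\<^sup>2) + (\<integral>\<^sup>+ t. ennreal \<bar>t\<bar> \<partial>\<nu> x)"
    using assms by (subst nn_integral_add) (auto simp: emeasure_spectral_measure_UNIV)
  finally show ?thesis
    using assms unfolding form_dom_iff by (simp add: less_top)
qed

lemma energy_add_le:
  "\<lbrakk>x \<in> carrier H; y \<in> carrier H\<rbrakk> \<Longrightarrow> energy (x \<oplus> y) \<le> 2 * energy x + 2 * energy y"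
  unfolding energy_def by (rule nn_integral_spectral_measure_add_le) auto

lemma energy_zero [simp]: "energy \<zero> = 0"
proof -
  have "\<zero> = 0 \<odot> \<zero>"
    by (intro cinner_ext) (auto simp: cinner_zero_right cinner_smult_right smult_in_carrier)
  moreover have "energy (0 \<odot> \<zero>) = 0"
    unfolding energy_def by (subst nn_integral_spectral_measure_smult) auto
  ultimately show ?thesis by simp
qed

lemma spectral_norm_less_iff:
  assumes x: "x \<in> form_dom" and "\<epsilon> > 0"
  shows "spectral_norm H E x < \<epsilon> \<longleftrightarrow> energy x < ennreal (\<epsilon>\<^sup>2)"
proof -
  have fin: "energy x < \<infinity>"
    using x energy_finite_iff[OF spec_dom_carrier[OF x]] by blast
  have "(\<integral>t. 1 + \<bar>t\<bar> \<partial>\<nu> x) = enn2real (energy x)"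
    unfolding energy_def by (intro integral_eq_nn_integral) auto
  then have "spectral_norm H E x < \<epsilon> \<longleftrightarrow> enn2real (energy x) < \<epsilon>\<^sup>2"
    using assms(2) by (simp add: spectral_norm_def real_less_lsqrt real_sqrt_less_iff
        flip: real_sqrt_less_iff[of _ "\<epsilon>\<^sup>2"])
  also have "\<dots> \<longleftrightarrow> energy x < ennreal (\<epsilon>\<^sup>2)"
    using fin by (cases "energy x") (auto simp: ennreal_less_iff)
  finally show ?thesis .
qed

text \<open>Matches the set that \<open>strong_representation\<close> prescribes as the domain of
  the extension, so that this domain is determined by S and E.\<close>

definition form_closure :: "'v set \<Rightarrow> 'v set"
  where "form_closure S = {x \<in> form_dom. \<forall>\<epsilon>>0. \<exists>y\<in>S. spectral_norm H E (x \<ominus> y) < \<epsilon>}"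

lemma form_closure_iff:
  assumes S: "S \<subseteq> form_dom"
  shows "x \<in> form_closure S \<longleftrightarrow>
    x \<in> form_dom \<and> (\<forall>\<epsilon>>0. \<exists>y\<in>S. energy (x \<ominus> y) < ennreal \<epsilon>)"
proof (cases "x \<in> form_dom")
  case True
  have xy: "x \<ominus> y \<in> form_dom" if "y \<in> S" for y
    using that True S by (intro submodule_complexD(5)[OF submodule_spec_dom]) (simp, blast+)
  show ?thesis
  proof
    assume x: "x \<in> form_closure S"
    have "\<exists>y\<in>S. energy (x \<ominus> y) < ennreal \<epsilon>" if "\<epsilon> > 0" for \<epsilon>
    proof -
      have "sqrt \<epsilon> > 0" using that by simp
      with x obtain y where y: "y \<in> S" "spectral_norm H E (x \<ominus> y) < sqrt \<epsilon>"
        unfolding form_closure_def by blast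
      with spectral_norm_less_iff[OF xy[OF y(1)] \<open>sqrt \<epsilon> > 0\<close>] that
      have "energy (x \<ominus> y) < ennreal \<epsilon>" by simp
      with y show ?thesis by blast
    qed
    with True show "x \<in> form_dom \<and> (\<forall>\<epsilon>>0. \<exists>y\<in>S. energy (x \<ominus> y) < ennreal \<epsilon>)" by blast
  next
    assume r: "x \<in> form_dom \<and> (\<forall>\<epsilon>>0. \<exists>y\<in>S. energy (x \<ominus> y) < ennreal \<epsilon>)"
    have "\<exists>y\<in>S. spectral_norm H E (x \<ominus> y) < \<epsilon>" if "\<epsilon> > 0" for \<epsilon>
    proof -
      have "\<epsilon>\<^sup>2 > 0" using that by simp
      with r obtain y where "y \<in> S" "energy (x \<ominus> y) < ennreal (\<epsilon>\<^sup>2)" by blast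
      with spectral_norm_less_iff[OF xy that] show ?thesis by blast
    qed
    with True show "x \<in> form_closure S" unfolding form_closure_def by blast
  qed
next
  case False
  then show ?thesis unfolding form_closure_def by blast
qed

lemma form_closure_closed:
  assumes S: "S \<subseteq> form_dom" and x: "x \<in> form_dom"
    and approx: "\<And>\<epsilon>. \<epsilon> > 0 \<Longrightarrow> \<exists>y\<in>form_closure S. energy (x \<ominus> y) < ennreal \<epsilon>"
  shows "x \<in> form_closure S"
  unfolding form_closure_iff[OF S]
proof (intro conjI allI impI x)
  fix \<epsilon> :: real assume "\<epsilon> > 0"
  \<comment> \<open>Two errors below \<epsilon> / 8, each doubled by \<open>energy_add_le\<close>,
    give at most \<epsilon> / 2 < \<epsilon>.\<close>
  then have e: "\<epsilon> / 8 > 0" by simp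
  obtain y where y: "y \<in> form_closure S" "energy (x \<ominus> y) < ennreal (\<epsilon> / 8)"
    using approx[OF e] by blast
  obtain z where z: "z \<in> S" "energy (y \<ominus> z) < ennreal (\<epsilon> / 8)"
    using y(1) e unfolding form_closure_iff[OF S] by blast
  have c: "x \<in> carrier H" "y \<in> carrier H" "z \<in> carrier H"
    using x y(1) z(1) S unfolding form_closure_iff[OF S] by (blast intro: spec_dom_carrier)+
  have "energy (x \<ominus> z) \<le> 2 * energy (x \<ominus> y) + 2 * energy (y \<ominus> z)"
    using energy_add_le[of "x \<ominus> y" "y \<ominus> z"] minus_triangle_eq[OF c] c by simp
  also have "\<dots> \<le> 2 * ennreal (\<epsilon> / 8) + 2 * ennreal (\<epsilon> / 8)"
    using y(2) z(2) by (intro add_mono mult_left_mono) auto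
  also have "\<dots> = ennreal (\<epsilon> / 2)"
    using \<open>\<epsilon> > 0\<close> by (simp add: ennreal_mult[symmetric] ennreal_plus[symmetric]
        flip: ennreal_numeral del: ennreal_plus)
  also have "\<dots> < ennreal \<epsilon>" using \<open>\<epsilon> > 0\<close> by (intro ennreal_lessI) auto
  finally show "\<exists>y\<in>S. energy (x \<ominus> y) < ennreal \<epsilon>" using z(1) by blast
qed

lemma form_closure_add:
  assumes S: "submodule S complex_ring H" "S \<subseteq> form_dom"
    and x: "x \<in> form_closure S" and y: "y \<in> form_closure S"
  shows "x \<oplus> y \<in> form_closure S"
  unfolding form_closure_iff[OF S(2)]
proof (intro conjI allI impI)
  note xd = x[unfolded form_closure_iff[OF S(2)]] and yd = y[unfolded form_closure_iff[OF S(2)]]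
  show "x \<oplus> y \<in> form_dom"
    using xd yd by (intro submodule_complexD(3)[OF submodule_spec_dom]) (simp, blast+)
  fix \<epsilon> :: real assume "\<epsilon> > 0"
  then have e: "\<epsilon> / 8 > 0" by simp
  obtain u where u: "u \<in> S" "energy (x \<ominus> u) < ennreal (\<epsilon> / 8)"
    using xd e by blast
  obtain v where v: "v \<in> S" "energy (y \<ominus> v) < ennreal (\<epsilon> / 8)"
    using yd e by blast
  have c: "x \<in> carrier H" "y \<in> carrier H" "u \<in> carrier H" "v \<in> carrier H"
    using xd yd u(1) v(1) S(2) by (blast intro: spec_dom_carrier)+
  have "(x \<oplus> y) \<ominus> (u \<oplus> v) = (x \<ominus> u) \<oplus> (y \<ominus> v)"
    using c by (intro cinner_ext) (auto simp: cinner_minus_right cinner_add_right)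
  then have "energy ((x \<oplus> y) \<ominus> (u \<oplus> v)) \<le> 2 * energy (x \<ominus> u) + 2 * energy (y \<ominus> v)"
    using energy_add_le[of "x \<ominus> u" "y \<ominus> v"] c by simp
  also have "\<dots> \<le> 2 * ennreal (\<epsilon> / 8) + 2 * ennreal (\<epsilon> / 8)"
    using u(2) v(2) by (intro add_mono mult_left_mono) auto
  also have "\<dots> = ennreal (\<epsilon> / 2)"
    using \<open>\<epsilon> > 0\<close> by (simp add: ennreal_mult[symmetric] ennreal_plus[symmetric]
        flip: ennreal_numeral del: ennreal_plus)
  also have "\<dots> < ennreal \<epsilon>" using \<open>\<epsilon> > 0\<close> by (intro ennreal_lessI) auto
  finally show "\<exists>w\<in>S. energy (x \<oplus> y \<ominus> w) < ennreal \<epsilon>"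
    using submodule_complexD(3)[OF S(1) u(1) v(1)] by blast
qed

lemma subset_form_closure:
  assumes "S \<subseteq> form_dom"
  shows "S \<subseteq> form_closure S"
proof
  fix x assume x: "x \<in> S"
  then have xV: "x \<in> form_dom" using assms by blast
  then have xH: "x \<in> carrier H" by (rule spec_dom_carrier)
  have "energy (x \<ominus> x) = 0"
    using xH minus_eq_zero_iff[of x x] by simp
  with x xV show "x \<in> form_closure S"
    unfolding form_closure_iff[OF assms] by (metis ennreal_eq_0_iff not_le not_gr_zero)
qed

text \<open>D(T) is dense in the form domain for the spectral norm, since the cut-offs of any x lie
  in D(T) and converge to x in energy. A closed set containing D(T) is therefore everything. In the
  fibers this turns D(T) \<subseteq> D' into density of the fiber domain.\<close>

lemma form_closure_eq_form_dom:
  assumes S: "S \<subseteq> form_dom" and T: "spec_dom (\<lambda>t. t) \<subseteq> form_closure S"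
  shows "form_closure S = form_dom"
proof (intro subset_antisym subsetI)
  show "x \<in> form_dom" if "x \<in> form_closure S" for x
    using that unfolding form_closure_def by blast
  fix x assume x: "x \<in> form_dom"
  then have xH: "x \<in> carrier H" by (rule spec_dom_carrier)
  have fin: "energy x < \<infinity>" using x energy_finite_iff[OF xH] by blast
  have lim: "(\<lambda>n. energy (x \<ominus> cutoff (\<lambda>t. t) n x)) \<longlonglongrightarrow> 0"
    using fin xH unfolding energy_def by (intro tendsto_cutoff) auto
  have cut: "cutoff (\<lambda>t. t) n x \<in> form_closure S" for n
  proof (rule subsetD[OF T], rule E_bounded_spec_dom)
    show "\<And>t. t \<in> {t. \<bar>t\<bar> \<le> real n} \<Longrightarrow> \<bar>t\<bar> \<le> real n" by simp
  qed (use xH in auto)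
  have "\<exists>y\<in>form_closure S. energy (x \<ominus> y) < ennreal \<epsilon>" if "\<epsilon> > 0" for \<epsilon>
  proof -
    have "\<forall>\<^sub>F n in sequentially. energy (x \<ominus> cutoff (\<lambda>t. t) n x) < ennreal \<epsilon>"
      using lim that by (intro order_tendstoD) auto
    then obtain n where "energy (x \<ominus> cutoff (\<lambda>t. t) n x) < ennreal \<epsilon>"
      by (auto simp: eventually_sequentially)
    with cut show ?thesis by blast
  qed
  then show "x \<in> form_closure S" by (rule form_closure_closed[OF S x])
qed

text \<open>Since |t| \<le> 1 + t^2 and \<nu> x is finite, a second moment controls the first
  absolute moment.\<close>

lemma spec_dom_subset_form_dom: "spec_dom (\<lambda>t. t) \<subseteq> form_dom"
proof
  fix x assume "x \<in> spec_dom (\<lambda>t. t)"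
  then have x: "x \<in> carrier H" and fin: "(\<integral>\<^sup>+ t. ennreal (t\<^sup>2) \<partial>\<nu> x) < \<infinity>"
    by (simp_all only: in_dom_spectral_integral)
  have "(\<integral>\<^sup>+ t. ennreal \<bar>t\<bar> \<partial>\<nu> x) \<le> (\<integral>\<^sup>+ t. 1 + ennreal (t\<^sup>2) \<partial>\<nu> x)"
  proof (rule nn_integral_mono)
    fix t :: real
    have "\<bar>t\<bar> \<le> 1 + t\<^sup>2"
      using zero_le_power2[of "\<bar>t\<bar> - 1"] by (simp add: power2_diff)
    then show "ennreal \<bar>t\<bar> \<le> 1 + ennreal (t\<^sup>2)"
      by (metis ennreal_1 ennreal_leI ennreal_plus zero_le_one zero_le_power2)
  qed
  also have "\<dots> = ennreal ((hnorm H x)\<^sup>2) + (\<integral>\<^sup>+ t. ennreal (t\<^sup>2) \<partial>\<nu> x)"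
    using x by (subst nn_integral_add) (auto simp: emeasure_spectral_measure_UNIV)
  also have "\<dots> < \<infinity>" using fin by simp
  finally show "x \<in> form_dom" using x unfolding form_dom_iff by blast
qed

end

section \<open>Direct integrals over atomic measures\<close>

lemma cring_complex_ring: "cring complex_ring"
proof (rule cringI)
  show "abelian_group complex_ring"
    by (rule abelian_groupI)
      (auto simp: complex_ring_def intro: exI[of _ "- x" for x] add.commute)
  show "comm_monoid complex_ring"
    by (rule comm_monoidI) (auto simp: complex_ring_def)
qed (auto simp: complex_ring_def distrib_right)

locale atomic_field = measurable_field M F e
  for M :: "'a measure" and F :: "'a \<Rightarrow> 'v hilbert" and e :: "nat \<Rightarrow> 'a \<Rightarrow> 'v" +
  assumes sets_M: "sets M = Pow (space M)"
    and countable_space: "countable (space M)"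
    and atom_pos: "\<alpha> \<in> space M \<Longrightarrow> emeasure M {\<alpha>} > 0"
    and atom_finite: "\<alpha> \<in> space M \<Longrightarrow> emeasure M {\<alpha>} < \<infinity>"
begin

abbreviation H :: "('a \<Rightarrow> 'v) set hilbert"
  where "H \<equiv> direct_integral M F e"

abbreviation \<mu> :: "'a \<Rightarrow> real"
  where "\<mu> \<alpha> \<equiv> measure M {\<alpha>}"

abbreviation mk :: "('a \<Rightarrow> 'v) \<Rightarrow> ('a \<Rightarrow> 'v) set"
  where "mk \<equiv> section_class M F e"

lemma fiber: "\<alpha> \<in> space M \<Longrightarrow> complex_inner_space (F \<alpha>)"
  using fiber_hilbert by (simp add: hilbert_space_def)

lemma measurable_M: "f \<in> space M \<rightarrow> space N \<Longrightarrow> f \<in> measurable M N"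
  by (auto simp: measurable_def sets_M)

text \<open>The \<sigma>-algebra is the full power set; as a simp rule this discharges the
  measurability conditions over M.\<close>

lemma borel_measurable_M [measurable, simp]: "f \<in> borel_measurable M"
  by (rule measurable_M) simp

lemma emeasure_atom: "\<alpha> \<in> space M \<Longrightarrow> emeasure M {\<alpha>} = ennreal (\<mu> \<alpha>)"
  using atom_finite[of \<alpha>] by (intro emeasure_eq_ennreal_measure) (simp add: less_top)

lemma atom_measure_pos: "\<alpha> \<in> space M \<Longrightarrow> \<mu> \<alpha> > 0"
  using atom_pos emeasure_atom by fastforce

text \<open>A null set cannot contain an atom of positive mass, hence is empty.\<close>

lemma AE_iff: "(AE \<alpha> in M. P \<alpha>) \<longleftrightarrow> (\<forall>\<alpha>\<in>space M. P \<alpha>)"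
proof
  assume "AE \<alpha> in M. P \<alpha>"
  then obtain N where N: "{\<alpha> \<in> space M. \<not> P \<alpha>} \<subseteq> N" "emeasure M N = 0" "N \<in> sets M"
    by (rule AE_E)
  show "\<forall>\<alpha>\<in>space M. P \<alpha>"
  proof (intro ballI, rule ccontr)
    fix \<alpha> assume \<alpha>: "\<alpha> \<in> space M" "\<not> P \<alpha>"
    then have "emeasure M {\<alpha>} \<le> emeasure M N"
      using N by (intro emeasure_mono) auto
    with N atom_pos[OF \<alpha>(1)] show False by simp
  qed
qed (rule AE_I2, blast)

lemma atom_le_nn_integral:
  assumes "\<alpha> \<in> space M"
  shows "f \<alpha> * ennreal (\<mu> \<alpha>) \<le> (\<integral>\<^sup>+ \<beta>. f \<beta> \<partial>M)"
proof -
  have "f \<alpha> * ennreal (\<mu> \<alpha>) = (\<integral>\<^sup>+ \<beta>. f \<alpha> * indicator {\<alpha>} \<beta> \<partial>M)"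
    using assms by (simp add: nn_integral_cmult_indicator sets_M emeasure_atom)
  also have "\<dots> \<le> (\<integral>\<^sup>+ \<beta>. f \<beta> \<partial>M)"
    by (intro nn_integral_mono) (auto simp: indicator_def)
  finally show ?thesis .
qed

lemma sections_iff:
  "x \<in> square_integrable_sections M F e \<longleftrightarrow>
    x \<in> (\<Pi>\<^sub>E \<alpha>\<in>space M. carrier (F \<alpha>)) \<and> (\<integral>\<^sup>+ \<alpha>. ennreal ((hnorm (F \<alpha>) (x \<alpha>))\<^sup>2) \<partial>M) < \<infinity>"
  by (simp add: square_integrable_sections_def)

text \<open>Almost everywhere equal sections agree on all of \<open>space M\<close>, and
  extensionality of the sections settles the points outside. The quotient thus consists of
  singletons and \<open>rep\<close> involves no real choice.\<close>

lemma ae_equal_Image: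
  assumes "x \<in> square_integrable_sections M F e"
  shows "ae_equal M F e `` {x} = {x}"
proof -
  have "y = x" if "y \<in> square_integrable_sections M F e" "\<forall>\<alpha>\<in>space M. x \<alpha> = y \<alpha>" for y
    using that assms unfolding sections_iff by (intro PiE_ext[of _ "space M"]) auto
  then show ?thesis
    using assms by (auto simp: ae_equal_def AE_iff)
qed

lemma carrier_H: "carrier H = (\<lambda>x. {x}) ` square_integrable_sections M F e"
  by (auto simp: direct_integral_def quotient_def ae_equal_Image)

lemma rep_singleton [simp]: "rep {x} = x"
  by (simp add: rep_def)

lemma rep_section: "\<Phi> \<in> carrier H \<Longrightarrow> rep \<Phi> \<in> square_integrable_sections M F e"
  by (auto simp: carrier_H)

lemma rep_closed [simp]: "\<lbrakk>\<Phi> \<in> carrier H; \<alpha> \<in> space M\<rbrakk> \<Longrightarrow> rep \<Phi> \<alpha> \<in> carrier (F \<alpha>)"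
  using rep_section[of \<Phi>] by (auto simp: sections_iff)

lemma rep_finite:
  "\<Phi> \<in> carrier H \<Longrightarrow> (\<integral>\<^sup>+ \<alpha>. ennreal ((hnorm (F \<alpha>) (rep \<Phi> \<alpha>))\<^sup>2) \<partial>M) < \<infinity>"
  using rep_section[of \<Phi>] by (simp add: sections_iff)

lemma H_eqI:
  assumes "\<Phi> \<in> carrier H" "\<Psi> \<in> carrier H" "\<And>\<alpha>. \<alpha> \<in> space M \<Longrightarrow> rep \<Phi> \<alpha> = rep \<Psi> \<alpha>"
  shows "\<Phi> = \<Psi>"
proof -
  have "rep \<Phi> = rep \<Psi>"
    using assms rep_section[of \<Phi>] rep_section[of \<Psi>]
    unfolding sections_iff by (intro PiE_ext[of _ "space M"]) auto
  then show ?thesis using assms(1,2) by (auto simp: carrier_H)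
qed

lemma section_class:
  assumes "\<And>\<alpha>. \<alpha> \<in> space M \<Longrightarrow> x \<alpha> \<in> carrier (F \<alpha>)"
    and "(\<integral>\<^sup>+ \<alpha>. ennreal ((hnorm (F \<alpha>) (x \<alpha>))\<^sup>2) \<partial>M) < \<infinity>"
  shows "mk x \<in> carrier H" and "\<alpha> \<in> space M \<Longrightarrow> rep (mk x) \<alpha> = x \<alpha>"
proof -
  have "(\<integral>\<^sup>+ \<alpha>. ennreal ((hnorm (F \<alpha>) ((\<lambda>\<alpha>\<in>space M. x \<alpha>) \<alpha>))\<^sup>2) \<partial>M) =
      (\<integral>\<^sup>+ \<alpha>. ennreal ((hnorm (F \<alpha>) (x \<alpha>))\<^sup>2) \<partial>M)"
    by (intro nn_integral_cong) simp
  then have r: "(\<lambda>\<alpha>\<in>space M. x \<alpha>) \<in> square_integrable_sections M F e"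
    using assms by (simp add: sections_iff)
  then have mk: "mk x = {\<lambda>\<alpha>\<in>space M. x \<alpha>}"
    by (simp add: section_class_def ae_equal_Image)
  show "mk x \<in> carrier H" using r by (auto simp: mk carrier_H)
  show "\<alpha> \<in> space M \<Longrightarrow> rep (mk x) \<alpha> = x \<alpha>" by (simp add: mk)
qed

text \<open>Square integrability by comparison with a given element. Used with b = |c| for scalar
  multiples and with b = 1 for restrictions and for the projections E \<sigma>.\<close>

lemma section_class_bounded:
  assumes c: "\<And>\<alpha>. \<alpha> \<in> space M \<Longrightarrow> x \<alpha> \<in> carrier (F \<alpha>)" and \<Phi>: "\<Phi> \<in> carrier H"
    and b: "\<And>\<alpha>. \<alpha> \<in> space M \<Longrightarrow> hnorm (F \<alpha>) (x \<alpha>) \<le> b * hnorm (F \<alpha>) (rep \<Phi> \<alpha>)"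
  shows "mk x \<in> carrier H" and "\<alpha> \<in> space M \<Longrightarrow> rep (mk x) \<alpha> = x \<alpha>"
proof -
  have "(\<integral>\<^sup>+ \<alpha>. ennreal ((hnorm (F \<alpha>) (x \<alpha>))\<^sup>2) \<partial>M) \<le>
      (\<integral>\<^sup>+ \<alpha>. ennreal (b\<^sup>2) * ennreal ((hnorm (F \<alpha>) (rep \<Phi> \<alpha>))\<^sup>2) \<partial>M)"
  proof (rule nn_integral_mono)
    fix \<alpha> assume \<alpha>: "\<alpha> \<in> space M"
    then interpret A: complex_inner_space "F \<alpha>" by (rule fiber)
    show "ennreal ((hnorm (F \<alpha>) (x \<alpha>))\<^sup>2) \<le> ennreal (b\<^sup>2) * ennreal ((hnorm (F \<alpha>) (rep \<Phi> \<alpha>))\<^sup>2)"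
      using power_mono[OF b[OF \<alpha>], of 2] A.hnorm_ge_zero[OF c[OF \<alpha>]]
      by (simp add: ennreal_mult[symmetric] power_mult_distrib ennreal_leI)
  qed
  also have "\<dots> < \<infinity>"
    using rep_finite[OF \<Phi>] by (simp add: nn_integral_cmult ennreal_mult_less_top)
  finally have fin: "(\<integral>\<^sup>+ \<alpha>. ennreal ((hnorm (F \<alpha>) (x \<alpha>))\<^sup>2) \<partial>M) < \<infinity>" .
  show "mk x \<in> carrier H" "\<alpha> \<in> space M \<Longrightarrow> rep (mk x) \<alpha> = x \<alpha>"
    using section_class[OF c fin] by auto
qed

section \<open>Fiberwise operations, inner product and completeness\<close>

lemma H_add:
  assumes "\<Phi> \<in> carrier H" "\<Psi> \<in> carrier H"
  shows "\<Phi> \<oplus>\<^bsub>H\<^esub> \<Psi> \<in> carrier H"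
    and "\<alpha> \<in> space M \<Longrightarrow> rep (\<Phi> \<oplus>\<^bsub>H\<^esub> \<Psi>) \<alpha> = rep \<Phi> \<alpha> \<oplus>\<^bsub>F \<alpha>\<^esub> rep \<Psi> \<alpha>"
proof -
  have c: "rep \<Phi> \<alpha> \<oplus>\<^bsub>F \<alpha>\<^esub> rep \<Psi> \<alpha> \<in> carrier (F \<alpha>)" if "\<alpha> \<in> space M" for \<alpha>
  proof -
    interpret A: complex_inner_space "F \<alpha>" by (rule fiber[OF that])
    show ?thesis using assms that by simp
  qed
  have "(\<integral>\<^sup>+ \<alpha>. ennreal ((hnorm (F \<alpha>) (rep \<Phi> \<alpha> \<oplus>\<^bsub>F \<alpha>\<^esub> rep \<Psi> \<alpha>))\<^sup>2) \<partial>M) \<le>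
      (\<integral>\<^sup>+ \<alpha>. 2 * ennreal ((hnorm (F \<alpha>) (rep \<Phi> \<alpha>))\<^sup>2) + 2 * ennreal ((hnorm (F \<alpha>) (rep \<Psi> \<alpha>))\<^sup>2) \<partial>M)"
  proof (rule nn_integral_mono)
    fix \<alpha> assume \<alpha>: "\<alpha> \<in> space M"
    then interpret A: complex_inner_space "F \<alpha>" by (rule fiber)
    show "ennreal ((hnorm (F \<alpha>) (rep \<Phi> \<alpha> \<oplus>\<^bsub>F \<alpha>\<^esub> rep \<Psi> \<alpha>))\<^sup>2) \<le>
        2 * ennreal ((hnorm (F \<alpha>) (rep \<Phi> \<alpha>))\<^sup>2) + 2 * ennreal ((hnorm (F \<alpha>) (rep \<Psi> \<alpha>))\<^sup>2)"
      using ennreal_leI[OF A.hnorm_add_power2_le[of "rep \<Phi> \<alpha>" "rep \<Psi> \<alpha>"]] assms \<alpha>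
      by (simp add: ennreal_mult)
  qed
  also have "\<dots> < \<infinity>"
    using assms[THEN rep_finite] by (simp add: nn_integral_add nn_integral_cmult ennreal_mult_less_top)
  finally show "\<Phi> \<oplus>\<^bsub>H\<^esub> \<Psi> \<in> carrier H"
    and "\<alpha> \<in> space M \<Longrightarrow> rep (\<Phi> \<oplus>\<^bsub>H\<^esub> \<Psi>) \<alpha> = rep \<Phi> \<alpha> \<oplus>\<^bsub>F \<alpha>\<^esub> rep \<Psi> \<alpha>"
    using section_class[of "\<lambda>\<alpha>. rep \<Phi> \<alpha> \<oplus>\<^bsub>F \<alpha>\<^esub> rep \<Psi> \<alpha>"] c by (auto simp: direct_integral_def)
qed

lemma H_smult:
  assumes "\<Phi> \<in> carrier H"
  shows "c \<odot>\<^bsub>H\<^esub> \<Phi> \<in> carrier H" and "\<alpha> \<in> space M \<Longrightarrow> rep (c \<odot>\<^bsub>H\<^esub> \<Phi>) \<alpha> = c \<odot>\<^bsub>F \<alpha>\<^esub> rep \<Phi> \<alpha>"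
proof -
  have "c \<odot>\<^bsub>F \<alpha>\<^esub> rep \<Phi> \<alpha> \<in> carrier (F \<alpha>)"
    "hnorm (F \<alpha>) (c \<odot>\<^bsub>F \<alpha>\<^esub> rep \<Phi> \<alpha>) \<le> cmod c * hnorm (F \<alpha>) (rep \<Phi> \<alpha>)" if "\<alpha> \<in> space M" for \<alpha>
  proof -
    interpret A: complex_inner_space "F \<alpha>" by (rule fiber[OF that])
    show "c \<odot>\<^bsub>F \<alpha>\<^esub> rep \<Phi> \<alpha> \<in> carrier (F \<alpha>)"
      "hnorm (F \<alpha>) (c \<odot>\<^bsub>F \<alpha>\<^esub> rep \<Phi> \<alpha>) \<le> cmod c * hnorm (F \<alpha>) (rep \<Phi> \<alpha>)"
      using assms that by (simp_all add: A.smult_in_carrier A.hnorm_smult)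
  qed
  from section_class_bounded[of "\<lambda>\<alpha>. c \<odot>\<^bsub>F \<alpha>\<^esub> rep \<Phi> \<alpha>", OF this(1) assms this(2)]
  show "c \<odot>\<^bsub>H\<^esub> \<Phi> \<in> carrier H" "\<alpha> \<in> space M \<Longrightarrow> rep (c \<odot>\<^bsub>H\<^esub> \<Phi>) \<alpha> = c \<odot>\<^bsub>F \<alpha>\<^esub> rep \<Phi> \<alpha>"
    by (simp_all add: direct_integral_def)
qed

lemma H_zero:
  shows "\<zero>\<^bsub>H\<^esub> \<in> carrier H" and "\<alpha> \<in> space M \<Longrightarrow> rep \<zero>\<^bsub>H\<^esub> \<alpha> = \<zero>\<^bsub>F \<alpha>\<^esub>"
proof -
  have z: "\<zero>\<^bsub>F \<alpha>\<^esub> \<in> carrier (F \<alpha>)" "hnorm (F \<alpha>) \<zero>\<^bsub>F \<alpha>\<^esub> = 0" if "\<alpha> \<in> space M" for \<alpha>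
  proof -
    interpret A: complex_inner_space "F \<alpha>" by (rule fiber[OF that])
    show "\<zero>\<^bsub>F \<alpha>\<^esub> \<in> carrier (F \<alpha>)" "hnorm (F \<alpha>) \<zero>\<^bsub>F \<alpha>\<^esub> = 0" by simp_all
  qed
  have "(\<integral>\<^sup>+ \<alpha>. ennreal ((hnorm (F \<alpha>) \<zero>\<^bsub>F \<alpha>\<^esub>)\<^sup>2) \<partial>M) = (\<integral>\<^sup>+ \<alpha>. 0 \<partial>M)"
    using z by (intro nn_integral_cong) simp
  then show "\<zero>\<^bsub>H\<^esub> \<in> carrier H" "\<alpha> \<in> space M \<Longrightarrow> rep \<zero>\<^bsub>H\<^esub> \<alpha> = \<zero>\<^bsub>F \<alpha>\<^esub>"
    using section_class[of "\<lambda>\<alpha>. \<zero>\<^bsub>F \<alpha>\<^esub>"] z by (simp_all add: direct_integral_def)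
qed

lemma cinner_H: "cinner H \<Phi> \<Psi> = (\<integral>\<alpha>. cinner (F \<alpha>) (rep \<Phi> \<alpha>) (rep \<Psi> \<alpha>) \<partial>M)"
  by (simp add: direct_integral_def)

lemma integrable_cinner:
  assumes "\<Phi> \<in> carrier H" "\<Psi> \<in> carrier H"
  shows "integrable M (\<lambda>\<alpha>. cinner (F \<alpha>) (rep \<Phi> \<alpha>) (rep \<Psi> \<alpha>))"
proof (rule integrableI_bounded)
  have "(\<integral>\<^sup>+ \<alpha>. ennreal (cmod (cinner (F \<alpha>) (rep \<Phi> \<alpha>) (rep \<Psi> \<alpha>))) \<partial>M) \<le>
      (\<integral>\<^sup>+ \<alpha>. ennreal ((hnorm (F \<alpha>) (rep \<Phi> \<alpha>))\<^sup>2) + ennreal ((hnorm (F \<alpha>) (rep \<Psi> \<alpha>))\<^sup>2) \<partial>M)"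
  proof (rule nn_integral_mono)
    fix \<alpha> assume \<alpha>: "\<alpha> \<in> space M"
    then interpret A: complex_inner_space "F \<alpha>" by (rule fiber)
    have "cmod (cinner (F \<alpha>) (rep \<Phi> \<alpha>) (rep \<Psi> \<alpha>)) \<le> hnorm (F \<alpha>) (rep \<Phi> \<alpha>) * hnorm (F \<alpha>) (rep \<Psi> \<alpha>)"
      using assms \<alpha> by (intro A.cinner_cauchy_schwarz) auto
    also have "\<dots> \<le> (hnorm (F \<alpha>) (rep \<Phi> \<alpha>))\<^sup>2 + (hnorm (F \<alpha>) (rep \<Psi> \<alpha>))\<^sup>2"
    proof -
      have "0 \<le> hnorm (F \<alpha>) (rep \<Phi> \<alpha>) * hnorm (F \<alpha>) (rep \<Psi> \<alpha>)"
        using assms \<alpha> by simp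
      then show ?thesis
        using sum_squares_bound[of "hnorm (F \<alpha>) (rep \<Phi> \<alpha>)" "hnorm (F \<alpha>) (rep \<Psi> \<alpha>)"] by linarith
    qed
    finally show "ennreal (cmod (cinner (F \<alpha>) (rep \<Phi> \<alpha>) (rep \<Psi> \<alpha>))) \<le>
        ennreal ((hnorm (F \<alpha>) (rep \<Phi> \<alpha>))\<^sup>2) + ennreal ((hnorm (F \<alpha>) (rep \<Psi> \<alpha>))\<^sup>2)"
      by (simp add: ennreal_leI flip: ennreal_plus)
  qed
  also have "\<dots> < \<infinity>"
    using assms[THEN rep_finite] by (simp add: nn_integral_add)
  finally show "(\<integral>\<^sup>+ \<alpha>. ennreal (cmod (cinner (F \<alpha>) (rep \<Phi> \<alpha>) (rep \<Psi> \<alpha>))) \<partial>M) < \<infinity>" .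
qed simp

lemma Re_cinner_H:
  assumes "\<Phi> \<in> carrier H"
  shows "ennreal (Re (cinner H \<Phi> \<Phi>)) = (\<integral>\<^sup>+ \<alpha>. ennreal ((hnorm (F \<alpha>) (rep \<Phi> \<alpha>))\<^sup>2) \<partial>M)"
    and "Re (cinner H \<Phi> \<Phi>) \<ge> 0"
proof -
  have int: "integrable M (\<lambda>\<alpha>. Re (cinner (F \<alpha>) (rep \<Phi> \<alpha>) (rep \<Phi> \<alpha>)))"
    using integrable_cinner[OF assms assms] by simp
  have Re: "Re (cinner H \<Phi> \<Phi>) = (\<integral>\<alpha>. Re (cinner (F \<alpha>) (rep \<Phi> \<alpha>) (rep \<Phi> \<alpha>)) \<partial>M)"
    unfolding cinner_H using integrable_cinner[OF assms assms] by simp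
  have eq: "Re (cinner (F \<alpha>) (rep \<Phi> \<alpha>) (rep \<Phi> \<alpha>)) = (hnorm (F \<alpha>) (rep \<Phi> \<alpha>))\<^sup>2" if "\<alpha> \<in> space M" for \<alpha>
    using complex_inner_space.hnorm_power2[OF fiber[OF that]] assms that by simp
  then have "AE \<alpha> in M. 0 \<le> Re (cinner (F \<alpha>) (rep \<Phi> \<alpha>) (rep \<Phi> \<alpha>))"
    by (simp add: AE_iff)
  with int have "ennreal (Re (cinner H \<Phi> \<Phi>)) = (\<integral>\<^sup>+ \<alpha>. ennreal (Re (cinner (F \<alpha>) (rep \<Phi> \<alpha>) (rep \<Phi> \<alpha>))) \<partial>M)"
    unfolding Re by (rule nn_integral_eq_integral[symmetric])
  also have "\<dots> = (\<integral>\<^sup>+ \<alpha>. ennreal ((hnorm (F \<alpha>) (rep \<Phi> \<alpha>))\<^sup>2) \<partial>M)"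
    by (intro nn_integral_cong) (simp add: eq)
  finally show "ennreal (Re (cinner H \<Phi> \<Phi>)) = (\<integral>\<^sup>+ \<alpha>. ennreal ((hnorm (F \<alpha>) (rep \<Phi> \<alpha>))\<^sup>2) \<partial>M)" .
  show "Re (cinner H \<Phi> \<Phi>) \<ge> 0"
    unfolding Re by (intro integral_nonneg_AE) (simp add: AE_iff eq)
qed

lemma hnorm_H:
  assumes "\<Phi> \<in> carrier H"
  shows "ennreal ((hnorm H \<Phi>)\<^sup>2) = (\<integral>\<^sup>+ \<alpha>. ennreal ((hnorm (F \<alpha>) (rep \<Phi> \<alpha>))\<^sup>2) \<partial>M)"
  using Re_cinner_H[OF assms] by (simp add: hnorm_def[of H])

lemma module_H: "module complex_ring H"
proof (rule moduleI[OF cring_complex_ring])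
  show "abelian_group H"
  proof (rule abelian_groupI)
    fix \<Phi> \<Psi> X assume c: "\<Phi> \<in> carrier H" "\<Psi> \<in> carrier H" "X \<in> carrier H"
    show "\<Phi> \<oplus>\<^bsub>H\<^esub> \<Psi> \<oplus>\<^bsub>H\<^esub> X = \<Phi> \<oplus>\<^bsub>H\<^esub> (\<Psi> \<oplus>\<^bsub>H\<^esub> X)"
    proof (rule H_eqI)
      fix \<alpha> assume \<alpha>: "\<alpha> \<in> space M"
      then interpret A: complex_inner_space "F \<alpha>" by (rule fiber)
      show "rep (\<Phi> \<oplus>\<^bsub>H\<^esub> \<Psi> \<oplus>\<^bsub>H\<^esub> X) \<alpha> = rep (\<Phi> \<oplus>\<^bsub>H\<^esub> (\<Psi> \<oplus>\<^bsub>H\<^esub> X)) \<alpha>"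
        using c \<alpha> by (simp add: H_add A.M.a_assoc)
    qed (use c in \<open>simp_all add: H_add\<close>)
  next
    fix \<Phi> \<Psi> assume c: "\<Phi> \<in> carrier H" "\<Psi> \<in> carrier H"
    show "\<Phi> \<oplus>\<^bsub>H\<^esub> \<Psi> = \<Psi> \<oplus>\<^bsub>H\<^esub> \<Phi>"
    proof (rule H_eqI)
      fix \<alpha> assume \<alpha>: "\<alpha> \<in> space M"
      then interpret A: complex_inner_space "F \<alpha>" by (rule fiber)
      show "rep (\<Phi> \<oplus>\<^bsub>H\<^esub> \<Psi>) \<alpha> = rep (\<Psi> \<oplus>\<^bsub>H\<^esub> \<Phi>) \<alpha>"
        using c \<alpha> by (simp add: H_add A.M.a_comm)
    qed (use c in \<open>simp_all add: H_add\<close>)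
  next
    fix \<Phi> assume c: "\<Phi> \<in> carrier H"
    show "\<zero>\<^bsub>H\<^esub> \<oplus>\<^bsub>H\<^esub> \<Phi> = \<Phi>"
    proof (rule H_eqI)
      fix \<alpha> assume \<alpha>: "\<alpha> \<in> space M"
      then interpret A: complex_inner_space "F \<alpha>" by (rule fiber)
      show "rep (\<zero>\<^bsub>H\<^esub> \<oplus>\<^bsub>H\<^esub> \<Phi>) \<alpha> = rep \<Phi> \<alpha>"
        using c \<alpha> by (simp add: H_add H_zero)
    qed (use c in \<open>simp_all add: H_add H_zero\<close>)
    show "\<exists>\<Psi>\<in>carrier H. \<Psi> \<oplus>\<^bsub>H\<^esub> \<Phi> = \<zero>\<^bsub>H\<^esub>"
    proof (rule bexI[of _ "(- 1) \<odot>\<^bsub>H\<^esub> \<Phi>"])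
      show "((- 1) \<odot>\<^bsub>H\<^esub> \<Phi>) \<oplus>\<^bsub>H\<^esub> \<Phi> = \<zero>\<^bsub>H\<^esub>"
      proof (rule H_eqI)
        fix \<alpha> assume \<alpha>: "\<alpha> \<in> space M"
        then interpret A: complex_inner_space "F \<alpha>" by (rule fiber)
        have "((- 1) \<odot>\<^bsub>F \<alpha>\<^esub> rep \<Phi> \<alpha>) \<oplus>\<^bsub>F \<alpha>\<^esub> rep \<Phi> \<alpha> = \<zero>\<^bsub>F \<alpha>\<^esub>"
          using c \<alpha> by (intro A.cinner_ext)
            (auto simp: A.smult_in_carrier A.cinner_add_right A.cinner_smult_right A.cinner_zero_right)
        then show "rep (((- 1) \<odot>\<^bsub>H\<^esub> \<Phi>) \<oplus>\<^bsub>H\<^esub> \<Phi>) \<alpha> = rep \<zero>\<^bsub>H\<^esub> \<alpha>"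
          using c \<alpha> by (simp add: H_add H_zero H_smult)
      qed (use c in \<open>simp_all add: H_add H_zero H_smult\<close>)
    qed (use c in \<open>simp add: H_smult\<close>)
  qed (simp_all add: H_add H_zero)
next
  fix a b \<Phi> \<Psi> assume c: "\<Phi> \<in> carrier H"
  show "(a \<oplus>\<^bsub>complex_ring\<^esub> b) \<odot>\<^bsub>H\<^esub> \<Phi> = a \<odot>\<^bsub>H\<^esub> \<Phi> \<oplus>\<^bsub>H\<^esub> b \<odot>\<^bsub>H\<^esub> \<Phi>"
  proof (rule H_eqI)
    fix \<alpha> assume \<alpha>: "\<alpha> \<in> space M"
    then interpret A: complex_inner_space "F \<alpha>" by (rule fiber)
    show "rep ((a \<oplus>\<^bsub>complex_ring\<^esub> b) \<odot>\<^bsub>H\<^esub> \<Phi>) \<alpha> = rep (a \<odot>\<^bsub>H\<^esub> \<Phi> \<oplus>\<^bsub>H\<^esub> b \<odot>\<^bsub>H\<^esub> \<Phi>) \<alpha>"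
      using c \<alpha> A.smult_l_distr[of a b "rep \<Phi> \<alpha>"]
      by (simp add: H_add H_smult) (simp add: complex_ring_def)
  qed (use c in \<open>simp_all add: H_add H_smult\<close>)
  show "(a \<otimes>\<^bsub>complex_ring\<^esub> b) \<odot>\<^bsub>H\<^esub> \<Phi> = a \<odot>\<^bsub>H\<^esub> (b \<odot>\<^bsub>H\<^esub> \<Phi>)"
  proof (rule H_eqI)
    fix \<alpha> assume \<alpha>: "\<alpha> \<in> space M"
    then interpret A: complex_inner_space "F \<alpha>" by (rule fiber)
    show "rep ((a \<otimes>\<^bsub>complex_ring\<^esub> b) \<odot>\<^bsub>H\<^esub> \<Phi>) \<alpha> = rep (a \<odot>\<^bsub>H\<^esub> (b \<odot>\<^bsub>H\<^esub> \<Phi>)) \<alpha>"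
      using c \<alpha> A.smult_assoc1[of a b "rep \<Phi> \<alpha>"]
      by (simp add: H_smult) (simp add: complex_ring_def)
  qed (use c in \<open>simp_all add: H_smult\<close>)
  show "\<one>\<^bsub>complex_ring\<^esub> \<odot>\<^bsub>H\<^esub> \<Phi> = \<Phi>"
  proof (rule H_eqI)
    fix \<alpha> assume \<alpha>: "\<alpha> \<in> space M"
    then interpret A: complex_inner_space "F \<alpha>" by (rule fiber)
    show "rep (\<one>\<^bsub>complex_ring\<^esub> \<odot>\<^bsub>H\<^esub> \<Phi>) \<alpha> = rep \<Phi> \<alpha>"
      using c \<alpha> by (simp add: H_smult)
  qed (use c in \<open>simp_all add: H_smult\<close>)
  assume d: "\<Psi> \<in> carrier H"
  show "a \<odot>\<^bsub>H\<^esub> (\<Phi> \<oplus>\<^bsub>H\<^esub> \<Psi>) = a \<odot>\<^bsub>H\<^esub> \<Phi> \<oplus>\<^bsub>H\<^esub> a \<odot>\<^bsub>H\<^esub> \<Psi>"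
  proof (rule H_eqI)
    fix \<alpha> assume \<alpha>: "\<alpha> \<in> space M"
    then interpret A: complex_inner_space "F \<alpha>" by (rule fiber)
    show "rep (a \<odot>\<^bsub>H\<^esub> (\<Phi> \<oplus>\<^bsub>H\<^esub> \<Psi>)) \<alpha> = rep (a \<odot>\<^bsub>H\<^esub> \<Phi> \<oplus>\<^bsub>H\<^esub> a \<odot>\<^bsub>H\<^esub> \<Psi>) \<alpha>"
      using c d \<alpha> A.smult_r_distr[of a "rep \<Phi> \<alpha>" "rep \<Psi> \<alpha>"]
      by (simp add: H_add H_smult) (simp add: complex_ring_def)
  qed (use c d in \<open>simp_all add: H_add H_smult\<close>)
qed (simp add: H_smult)

sublocale H: complex_inner_space H
proof (intro complex_inner_space.intro module_H complex_inner_space_axioms.intro)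
  fix \<Phi> \<Psi> X c assume \<Phi>: "\<Phi> \<in> carrier H"
  show "0 \<le> Re (cinner H \<Phi> \<Phi>)" by (rule Re_cinner_H(2)[OF \<Phi>])
  {
    assume "cinner H \<Phi> \<Phi> = 0"
    with Re_cinner_H(1)[OF \<Phi>] have "(\<integral>\<^sup>+ \<alpha>. ennreal ((hnorm (F \<alpha>) (rep \<Phi> \<alpha>))\<^sup>2) \<partial>M) = 0" by simp
    then have "AE \<alpha> in M. ennreal ((hnorm (F \<alpha>) (rep \<Phi> \<alpha>))\<^sup>2) = 0"
      by (subst (asm) nn_integral_0_iff_AE) auto
    then have 0: "hnorm (F \<alpha>) (rep \<Phi> \<alpha>) = 0" if "\<alpha> \<in> space M" for \<alpha>
      using that unfolding AE_iff by simp
    show "\<Phi> = \<zero>\<^bsub>H\<^esub>"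
    proof (rule H_eqI)
      fix \<alpha> assume \<alpha>: "\<alpha> \<in> space M"
      then interpret A: complex_inner_space "F \<alpha>" by (rule fiber)
      show "rep \<Phi> \<alpha> = rep \<zero>\<^bsub>H\<^esub> \<alpha>"
        using 0[OF \<alpha>] A.hnorm_eq_zero_iff \<Phi> \<alpha> by (simp add: H_zero)
    qed (use \<Phi> H_zero in auto)
  }
  assume \<Psi>: "\<Psi> \<in> carrier H"
  show "cinner H \<Phi> \<Psi> = cnj (cinner H \<Psi> \<Phi>)"
    unfolding cinner_H Bochner_Integration.integral_cnj[symmetric]
    using \<Phi> \<Psi>
    by (intro Bochner_Integration.integral_cong refl complex_inner_space.cinner_commute[OF fiber]) simp_all
  have "cinner H \<Phi> (c \<odot>\<^bsub>H\<^esub> \<Psi>) = (\<integral>\<alpha>. c * cinner (F \<alpha>) (rep \<Phi> \<alpha>) (rep \<Psi> \<alpha>) \<partial>M)"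
    unfolding cinner_H
    using \<Phi> \<Psi> complex_inner_space.cinner_smult_right[OF fiber]
    by (intro Bochner_Integration.integral_cong) (auto simp: H_smult)
  then show "cinner H \<Phi> (c \<odot>\<^bsub>H\<^esub> \<Psi>) = c * cinner H \<Phi> \<Psi>"
    unfolding cinner_H by simp
  assume X: "X \<in> carrier H"
  have "cinner H \<Phi> (\<Psi> \<oplus>\<^bsub>H\<^esub> X) =
      (\<integral>\<alpha>. cinner (F \<alpha>) (rep \<Phi> \<alpha>) (rep \<Psi> \<alpha>) + cinner (F \<alpha>) (rep \<Phi> \<alpha>) (rep X \<alpha>) \<partial>M)"
    unfolding cinner_H
    using \<Phi> \<Psi> X complex_inner_space.cinner_add_right[OF fiber]
    by (intro Bochner_Integration.integral_cong) (auto simp: H_add)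
  then show "cinner H \<Phi> (\<Psi> \<oplus>\<^bsub>H\<^esub> X) = cinner H \<Phi> \<Psi> + cinner H \<Phi> X"
    unfolding cinner_H using \<Phi> \<Psi> X by (simp add: integrable_cinner)
qed

text \<open>Subtraction goes through the abstract additive inverse, so unfolding the record does not
  reveal its fiber values. They are recovered from (\<Phi> - \<Psi>) + \<Psi> = \<Phi>, evaluated at
  \<alpha>.\<close>

lemma rep_minus:
  assumes "\<Phi> \<in> carrier H" "\<Psi> \<in> carrier H" and \<alpha>: "\<alpha> \<in> space M"
  shows "rep (\<Phi> \<ominus>\<^bsub>H\<^esub> \<Psi>) \<alpha> = rep \<Phi> \<alpha> \<ominus>\<^bsub>F \<alpha>\<^esub> rep \<Psi> \<alpha>"
proof -
  interpret A: complex_inner_space "F \<alpha>" by (rule fiber[OF \<alpha>])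
  have c: "\<Phi> \<ominus>\<^bsub>H\<^esub> \<Psi> \<in> carrier H" using assms by simp
  have "(\<Phi> \<ominus>\<^bsub>H\<^esub> \<Psi>) \<oplus>\<^bsub>H\<^esub> \<Psi> = \<Phi>"
    using assms by (intro H.cinner_ext) (auto simp: H.cinner_minus_right H.cinner_add_right)
  then have eq: "rep (\<Phi> \<ominus>\<^bsub>H\<^esub> \<Psi>) \<alpha> \<oplus>\<^bsub>F \<alpha>\<^esub> rep \<Psi> \<alpha> = rep \<Phi> \<alpha>"
    using H_add(2)[OF c assms(2) \<alpha>] by simp
  show ?thesis
    using assms c unfolding eq[symmetric]
    by (intro A.cinner_ext) (auto simp: A.cinner_minus_right A.cinner_add_right)
qed

text \<open>The Riesz-Fischer argument without subsequences: positive atoms make a Cauchy sequence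
  Cauchy in every fiber, and Fatou's lemma upgrades the fiberwise limit to a limit in the norm of
  the direct integral.\<close>

lemma mcomplete_H: "Metric_space.mcomplete (carrier H) (hdist H)"
  unfolding H.mcomplete_iff
proof (intro allI impI)
  fix u :: "nat \<Rightarrow> ('a \<Rightarrow> 'v) set"
  assume "range u \<subseteq> carrier H"
    and Cauchy: "\<forall>\<epsilon>>0. \<exists>N. \<forall>n\<ge>N. \<forall>m\<ge>N. hnorm H (u n \<ominus>\<^bsub>H\<^esub> u m) < \<epsilon>"
  then have u: "u n \<in> carrier H" for n by auto
  have "\<exists>l\<in>carrier (F \<alpha>). (\<lambda>n. hnorm (F \<alpha>) (rep (u n) \<alpha> \<ominus>\<^bsub>F \<alpha>\<^esub> l)) \<longlonglongrightarrow> 0" if \<alpha>: "\<alpha> \<in> space M" for \<alpha>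
  proof -
    interpret A: hilbert_space "F \<alpha>" by (rule fiber_hilbert[OF \<alpha>])
    have "\<exists>N. \<forall>n\<ge>N. \<forall>m\<ge>N. hnorm (F \<alpha>) (rep (u n) \<alpha> \<ominus>\<^bsub>F \<alpha>\<^esub> rep (u m) \<alpha>) < \<epsilon>" if "\<epsilon> > 0" for \<epsilon>
    proof -
      \<comment> \<open>One atom contributes the squared fiber norm times its mass to the squared
        norm in H, hence the factor sqrt(\<mu> \<alpha>).\<close>
      have "\<epsilon> * sqrt (\<mu> \<alpha>) > 0" using that atom_measure_pos[OF \<alpha>] by simp
      then obtain N where N: "\<And>n m. n \<ge> N \<Longrightarrow> m \<ge> N \<Longrightarrow> hnorm H (u n \<ominus>\<^bsub>H\<^esub> u m) < \<epsilon> * sqrt (\<mu> \<alpha>)"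
        using Cauchy by blast
      have "hnorm (F \<alpha>) (rep (u n) \<alpha> \<ominus>\<^bsub>F \<alpha>\<^esub> rep (u m) \<alpha>) < \<epsilon>" if nm: "n \<ge> N" "m \<ge> N" for n m
      proof -
        define d where "d = hnorm (F \<alpha>) (rep (u n) \<alpha> \<ominus>\<^bsub>F \<alpha>\<^esub> rep (u m) \<alpha>)"
        have "ennreal (d\<^sup>2 * \<mu> \<alpha>) \<le> ennreal ((hnorm H (u n \<ominus>\<^bsub>H\<^esub> u m))\<^sup>2)"
          using atom_le_nn_integral[OF \<alpha>, of "\<lambda>\<alpha>. ennreal ((hnorm (F \<alpha>) (rep (u n \<ominus>\<^bsub>H\<^esub> u m) \<alpha>))\<^sup>2)"]
            u rep_minus[OF u u \<alpha>] by (simp add: hnorm_H d_def ennreal_mult)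
        then have "d\<^sup>2 * \<mu> \<alpha> \<le> (hnorm H (u n \<ominus>\<^bsub>H\<^esub> u m))\<^sup>2"
          by (simp add: ennreal_le_iff)
        also have "\<dots> < (\<epsilon> * sqrt (\<mu> \<alpha>))\<^sup>2"
          using N[OF nm] u by (intro power_strict_mono) auto
        also have "\<dots> = \<epsilon>\<^sup>2 * \<mu> \<alpha>"
          using atom_measure_pos[OF \<alpha>] by (simp add: power_mult_distrib)
        finally have "d\<^sup>2 < \<epsilon>\<^sup>2" using atom_measure_pos[OF \<alpha>] by simp
        then show ?thesis
          using \<open>\<epsilon> > 0\<close> unfolding d_def by (simp add: power2_less_imp_less)
      qed
      then show ?thesis by blast
    qed
    moreover have "range (\<lambda>n. rep (u n) \<alpha>) \<subseteq> carrier (F \<alpha>)" using u \<alpha> by auto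
    ultimately show ?thesis
      using A.complete[unfolded A.mcomplete_iff, rule_format, of "\<lambda>n. rep (u n) \<alpha>"] by blast
  qed
  then obtain l where l: "\<And>\<alpha>. \<alpha> \<in> space M \<Longrightarrow> l \<alpha> \<in> carrier (F \<alpha>)"
    and lim: "\<And>\<alpha>. \<alpha> \<in> space M \<Longrightarrow> (\<lambda>n. hnorm (F \<alpha>) (rep (u n) \<alpha> \<ominus>\<^bsub>F \<alpha>\<^esub> l \<alpha>)) \<longlonglongrightarrow> 0"
    by metis
  let ?I = "\<lambda>n. \<integral>\<^sup>+ \<alpha>. ennreal ((hnorm (F \<alpha>) (rep (u n) \<alpha> \<ominus>\<^bsub>F \<alpha>\<^esub> l \<alpha>))\<^sup>2) \<partial>M"
  \<comment> \<open>Fatou as m tends to infinity: the fiber norms of u n - u m converge to those of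
    u n - l.\<close>
  have I: "?I n \<le> ennreal (\<epsilon>\<^sup>2)"
    if N: "\<And>m. m \<ge> N \<Longrightarrow> hnorm H (u n \<ominus>\<^bsub>H\<^esub> u m) < \<epsilon>" for n N \<epsilon>
  proof -
    have "?I n = (\<integral>\<^sup>+ \<alpha>. liminf (\<lambda>m. ennreal ((hnorm (F \<alpha>) (rep (u n \<ominus>\<^bsub>H\<^esub> u m) \<alpha>))\<^sup>2)) \<partial>M)"
    proof (rule nn_integral_cong)
      fix \<alpha> assume \<alpha>: "\<alpha> \<in> space M"
      interpret A: complex_inner_space "F \<alpha>" by (rule fiber[OF \<alpha>])
      let ?u = "\<lambda>n. rep (u n) \<alpha>"
      have eq: "(?u n \<ominus>\<^bsub>F \<alpha>\<^esub> ?u m) \<ominus>\<^bsub>F \<alpha>\<^esub> (?u n \<ominus>\<^bsub>F \<alpha>\<^esub> l \<alpha>) = l \<alpha> \<ominus>\<^bsub>F \<alpha>\<^esub> ?u m" for m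
        using u l \<alpha> by (intro A.cinner_ext) (auto simp: A.cinner_minus_right)
      have "(\<lambda>m. hnorm (F \<alpha>) (l \<alpha> \<ominus>\<^bsub>F \<alpha>\<^esub> ?u m)) \<longlonglongrightarrow> 0"
        using lim[OF \<alpha>] A.hnorm_minus_commute[OF l[OF \<alpha>]] u \<alpha> by simp
      then have "(\<lambda>m. hnorm (F \<alpha>) (?u n \<ominus>\<^bsub>F \<alpha>\<^esub> ?u m)) \<longlonglongrightarrow> hnorm (F \<alpha>) (?u n \<ominus>\<^bsub>F \<alpha>\<^esub> l \<alpha>)"
        using u l \<alpha> by (intro A.tendsto_hnorm) (auto simp: eq)
      then have "(\<lambda>m. ennreal ((hnorm (F \<alpha>) (rep (u n \<ominus>\<^bsub>H\<^esub> u m) \<alpha>))\<^sup>2)) \<longlonglongrightarrow>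
          ennreal ((hnorm (F \<alpha>) (?u n \<ominus>\<^bsub>F \<alpha>\<^esub> l \<alpha>))\<^sup>2)"
        using u \<alpha> by (intro tendsto_ennrealI tendsto_power) (simp add: rep_minus)
      then show "ennreal ((hnorm (F \<alpha>) (?u n \<ominus>\<^bsub>F \<alpha>\<^esub> l \<alpha>))\<^sup>2) =
          liminf (\<lambda>m. ennreal ((hnorm (F \<alpha>) (rep (u n \<ominus>\<^bsub>H\<^esub> u m) \<alpha>))\<^sup>2))"
        by (rule lim_imp_Liminf[OF trivial_limit_sequentially, symmetric])
    qed
    also have "\<dots> \<le> liminf (\<lambda>m. \<integral>\<^sup>+ \<alpha>. ennreal ((hnorm (F \<alpha>) (rep (u n \<ominus>\<^bsub>H\<^esub> u m) \<alpha>))\<^sup>2) \<partial>M)"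
      by (intro nn_integral_liminf) simp
    also have "\<dots> \<le> liminf (\<lambda>m. ennreal (\<epsilon>\<^sup>2))"
    proof (intro Liminf_mono eventually_sequentiallyI[of N])
      fix m assume "m \<ge> N"
      from N[OF this] have "(hnorm H (u n \<ominus>\<^bsub>H\<^esub> u m))\<^sup>2 \<le> \<epsilon>\<^sup>2"
        using u by (intro power_mono) auto
      then show "(\<integral>\<^sup>+ \<alpha>. ennreal ((hnorm (F \<alpha>) (rep (u n \<ominus>\<^bsub>H\<^esub> u m) \<alpha>))\<^sup>2) \<partial>M) \<le> ennreal (\<epsilon>\<^sup>2)"
        using u by (simp add: hnorm_H[symmetric] ennreal_leI)
    qed
    finally show ?thesis by (simp add: Liminf_const)
  qed
  have ucl: "rep (u n) \<alpha> \<ominus>\<^bsub>F \<alpha>\<^esub> l \<alpha> \<in> carrier (F \<alpha>)" if "\<alpha> \<in> space M" for n \<alpha>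
    using complex_inner_space.minus_closed[OF fiber[OF that]] u l that by simp
  \<comment> \<open>The section l is not yet known to be square integrable, but u N - l is, by the
    bound with \<epsilon> = 1. The limit X is therefore formed as u N - (u N - l).\<close>
  obtain N where "\<And>n m. n \<ge> N \<Longrightarrow> m \<ge> N \<Longrightarrow> hnorm H (u n \<ominus>\<^bsub>H\<^esub> u m) < 1"
    using Cauchy zero_less_one by metis
  then have "?I N \<le> ennreal (1\<^sup>2)" by (intro I) auto
  then have "?I N < \<infinity>" by (rule le_less_trans) simp
  from section_class[OF ucl this] have d: "mk (\<lambda>\<alpha>. rep (u N) \<alpha> \<ominus>\<^bsub>F \<alpha>\<^esub> l \<alpha>) \<in> carrier H"
    "\<And>\<alpha>. \<alpha> \<in> space M \<Longrightarrow> rep (mk (\<lambda>\<alpha>. rep (u N) \<alpha> \<ominus>\<^bsub>F \<alpha>\<^esub> l \<alpha>)) \<alpha> = rep (u N) \<alpha> \<ominus>\<^bsub>F \<alpha>\<^esub> l \<alpha>" by auto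
  define X where "X = u N \<ominus>\<^bsub>H\<^esub> mk (\<lambda>\<alpha>. rep (u N) \<alpha> \<ominus>\<^bsub>F \<alpha>\<^esub> l \<alpha>)"
  have X: "X \<in> carrier H" unfolding X_def using u d by simp
  have repX: "rep X \<alpha> = l \<alpha>" if \<alpha>: "\<alpha> \<in> space M" for \<alpha>
  proof -
    interpret A: complex_inner_space "F \<alpha>" by (rule fiber[OF \<alpha>])
    show ?thesis
      unfolding X_def rep_minus[OF u d(1) \<alpha>] d(2)[OF \<alpha>] using u l \<alpha>
      by (intro A.cinner_ext) (auto simp: A.cinner_minus_right)
  qed
  have "(\<lambda>n. hnorm H (u n \<ominus>\<^bsub>H\<^esub> X)) \<longlonglongrightarrow> 0"
    unfolding LIMSEQ_def
  proof (intro allI impI)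
    fix \<epsilon> :: real assume "\<epsilon> > 0"
    then obtain N where N: "\<And>n m. n \<ge> N \<Longrightarrow> m \<ge> N \<Longrightarrow> hnorm H (u n \<ominus>\<^bsub>H\<^esub> u m) < \<epsilon> / 2"
      using Cauchy half_gt_zero by metis
    have "hnorm H (u n \<ominus>\<^bsub>H\<^esub> X) < \<epsilon>" if "n \<ge> N" for n
    proof -
      have "ennreal ((hnorm H (u n \<ominus>\<^bsub>H\<^esub> X))\<^sup>2) = ?I n"
        using u X by (subst hnorm_H) (auto intro!: nn_integral_cong simp: rep_minus repX)
      also have "\<dots> \<le> ennreal ((\<epsilon> / 2)\<^sup>2)" using N[OF that] by (rule I)
      finally have "(hnorm H (u n \<ominus>\<^bsub>H\<^esub> X))\<^sup>2 \<le> (\<epsilon> / 2)\<^sup>2" by (simp add: ennreal_le_iff)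
      then have "hnorm H (u n \<ominus>\<^bsub>H\<^esub> X) \<le> \<epsilon> / 2"
        by (rule power2_le_imp_le) (use \<open>\<epsilon> > 0\<close> in simp)
      then show ?thesis using \<open>\<epsilon> > 0\<close> by simp
    qed
    then show "\<exists>N. \<forall>n\<ge>N. dist (hnorm H (u n \<ominus>\<^bsub>H\<^esub> X)) 0 < \<epsilon>"
      using u X by (intro exI[of _ N]) auto
  qed
  then show "\<exists>l\<in>carrier H. (\<lambda>n. hnorm H (u n \<ominus>\<^bsub>H\<^esub> l)) \<longlonglongrightarrow> 0" using X by blast
qed

text \<open>The section truncated to \<Delta> lies in the subspace and leaves a remainder orthogonal
  to it. For a second candidate Y, the difference of the candidates lies in the subspace and is
  orthogonal to itself, hence zero.\<close>

lemma restriction_proj: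
  assumes \<Phi>: "\<Phi> \<in> carrier H"
  shows "restriction_proj M F e \<Delta> \<Phi> \<in> carrier H"
    and "\<alpha> \<in> space M \<Longrightarrow>
      rep (restriction_proj M F e \<Delta> \<Phi>) \<alpha> = (if \<alpha> \<in> \<Delta> then rep \<Phi> \<alpha> else \<zero>\<^bsub>F \<alpha>\<^esub>)"
proof -
  let ?W = "restricted_integral M F e \<Delta>"
  have W: "X \<in> ?W \<longleftrightarrow> X \<in> carrier H \<and> (\<forall>\<alpha>\<in>space M. \<alpha> \<notin> \<Delta> \<longrightarrow> rep X \<alpha> = \<zero>\<^bsub>F \<alpha>\<^esub>)" for X
    by (simp add: restricted_integral_def AE_iff)
  let ?x = "\<lambda>\<alpha>. if \<alpha> \<in> \<Delta> then rep \<Phi> \<alpha> else \<zero>\<^bsub>F \<alpha>\<^esub>"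
  have "?x \<alpha> \<in> carrier (F \<alpha>)" "hnorm (F \<alpha>) (?x \<alpha>) \<le> 1 * hnorm (F \<alpha>) (rep \<Phi> \<alpha>)" if "\<alpha> \<in> space M" for \<alpha>
  proof -
    interpret A: complex_inner_space "F \<alpha>" by (rule fiber[OF that])
    show "?x \<alpha> \<in> carrier (F \<alpha>)" "hnorm (F \<alpha>) (?x \<alpha>) \<le> 1 * hnorm (F \<alpha>) (rep \<Phi> \<alpha>)"
      using \<Phi> that by simp_all
  qed
  note mkx = section_class_bounded[of ?x, OF this(1) \<Phi> this(2)]
  have orth: "cinner H Z (\<Phi> \<ominus>\<^bsub>H\<^esub> mk ?x) = 0" if "Z \<in> ?W" for Z
  proof -
    have "cinner (F \<alpha>) (rep Z \<alpha>) (rep (\<Phi> \<ominus>\<^bsub>H\<^esub> mk ?x) \<alpha>) = 0" if \<alpha>: "\<alpha> \<in> space M" for \<alpha>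
    proof -
      interpret A: complex_inner_space "F \<alpha>" by (rule fiber[OF \<alpha>])
      show ?thesis
        using \<open>Z \<in> ?W\<close> mkx \<Phi> \<alpha>
        by (cases "\<alpha> \<in> \<Delta>") (auto simp: W rep_minus A.cinner_zero_left A.cinner_minus_right)
    qed
    then have "cinner H Z (\<Phi> \<ominus>\<^bsub>H\<^esub> mk ?x) = (\<integral>\<alpha>. 0 \<partial>M)"
      unfolding cinner_H by (intro Bochner_Integration.integral_cong) auto
    then show ?thesis by simp
  qed
  have mkW: "mk ?x \<in> ?W" using mkx by (simp add: W)
  have "restriction_proj M F e \<Delta> \<Phi> = mk ?x"
    unfolding restriction_proj_def orth_proj_def
  proof (rule the_equality)
    show "mk ?x \<in> ?W \<and> (\<forall>Z\<in>?W. cinner H Z (\<Phi> \<ominus>\<^bsub>H\<^esub> mk ?x) = 0)"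
      using orth mkW by blast
    fix Y assume Y: "Y \<in> ?W \<and> (\<forall>Z\<in>?W. cinner H Z (\<Phi> \<ominus>\<^bsub>H\<^esub> Y) = 0)"
    define D where "D = Y \<ominus>\<^bsub>H\<^esub> mk ?x"
    have YH: "Y \<in> carrier H" and D: "D \<in> carrier H" using Y mkx(1) by (auto simp: W D_def)
    have "D \<in> ?W"
      unfolding W
    proof (intro conjI ballI impI D)
      fix \<alpha> assume \<alpha>: "\<alpha> \<in> space M" "\<alpha> \<notin> \<Delta>"
      interpret A: complex_inner_space "F \<alpha>" by (rule fiber[OF \<alpha>(1)])
      show "rep D \<alpha> = \<zero>\<^bsub>F \<alpha>\<^esub>"
        using Y YH mkx \<alpha> by (simp add: D_def rep_minus W A.minus_eq_zero_iff)
    qed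
    then have "cinner H D (\<Phi> \<ominus>\<^bsub>H\<^esub> mk ?x) = 0" "cinner H D (\<Phi> \<ominus>\<^bsub>H\<^esub> Y) = 0"
      using orth Y by blast+
    then have "cinner H D D = 0"
      using D YH mkx(1) \<Phi> by (simp add: H.cinner_minus_right D_def[symmetric])
        (simp add: D_def H.cinner_minus_right)
    then show "Y = mk ?x"
      using H.cinner_eq_zero[OF D] H.minus_eq_zero_iff[OF YH mkx(1)] by (simp add: D_def)
  qed
  then show "restriction_proj M F e \<Delta> \<Phi> \<in> carrier H"
    "\<alpha> \<in> space M \<Longrightarrow> rep (restriction_proj M F e \<Delta> \<Phi>) \<alpha> = (if \<alpha> \<in> \<Delta> then rep \<Phi> \<alpha> else \<zero>\<^bsub>F \<alpha>\<^esub>)"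
    using mkx by auto
qed

end

section \<open>Orthogonally additive forms\<close>

context atomic_field
begin

text \<open>Since \<^term>\<open>space M\<close> may be finite, \<open>atom n\<close> may be empty.\<close>

definition atom :: "nat \<Rightarrow> 'a set"
  where "atom n = {\<alpha> \<in> space M. to_nat_on (space M) \<alpha> = n}"

lemma disjoint_atom: "i \<noteq> j \<Longrightarrow> atom i \<inter> atom j = {}"
  by (auto simp: atom_def)

lemma UN_atom: "(\<Union>i. atom i) = space M"
  by (auto simp: atom_def)

lemma atom_cases: obtains "atom n = {}" | \<alpha> where "\<alpha> \<in> space M" "atom n = {\<alpha>}"
proof (cases "atom n = {}")
  case False
  then obtain \<alpha> where \<alpha>: "\<alpha> \<in> space M" "to_nat_on (space M) \<alpha> = n"
    by (auto simp: atom_def)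
  then have "atom n = {\<alpha>}"
    using inj_on_to_nat_on[OF countable_space] by (auto simp: atom_def inj_on_def)
  with \<alpha> that show thesis by blast
qed

abbreviation restr :: "'a set \<Rightarrow> ('a \<Rightarrow> 'v) set \<Rightarrow> ('a \<Rightarrow> 'v) set"
  where "restr \<equiv> restriction_proj M F e"

lemma restr_space: "\<Phi> \<in> carrier H \<Longrightarrow> restr (space M) \<Phi> = \<Phi>"
  by (rule H_eqI) (auto simp: restriction_proj)

lemma restr_diff:
  assumes \<Phi>: "\<Phi> \<in> carrier H" and sub: "B \<subseteq> A"
  shows "restr A \<Phi> \<ominus>\<^bsub>H\<^esub> restr B \<Phi> = restr (A - B) \<Phi>"
proof (rule H_eqI)
  fix \<alpha> assume \<alpha>: "\<alpha> \<in> space M"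
  interpret A: complex_inner_space "F \<alpha>" by (rule fiber[OF \<alpha>])
  have "rep \<Phi> \<alpha> \<ominus>\<^bsub>F \<alpha>\<^esub> rep \<Phi> \<alpha> = \<zero>\<^bsub>F \<alpha>\<^esub>" "\<zero>\<^bsub>F \<alpha>\<^esub> \<ominus>\<^bsub>F \<alpha>\<^esub> \<zero>\<^bsub>F \<alpha>\<^esub> = \<zero>\<^bsub>F \<alpha>\<^esub>"
    using \<Phi> \<alpha> by (simp_all add: A.minus_eq_zero_iff)
  then show "rep (restr A \<Phi> \<ominus>\<^bsub>H\<^esub> restr B \<Phi>) \<alpha> = rep (restr (A - B) \<Phi>) \<alpha>"
    using \<Phi> sub \<alpha> by (auto simp: rep_minus restriction_proj A.minus_zero_right)
qed (use \<Phi> in \<open>simp_all add: restriction_proj\<close>)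

lemma hnorm_restr:
  assumes "\<Phi> \<in> carrier H"
  shows "ennreal ((hnorm H (restr A \<Phi>))\<^sup>2) =
    (\<integral>\<^sup>+ \<alpha>. ennreal ((hnorm (F \<alpha>) (rep \<Phi> \<alpha>))\<^sup>2) * indicator A \<alpha> \<partial>M)"
  unfolding hnorm_H[OF restriction_proj(1)[OF assms]]
proof (rule nn_integral_cong)
  fix \<alpha> assume \<alpha>: "\<alpha> \<in> space M"
  interpret A: complex_inner_space "F \<alpha>" by (rule fiber[OF \<alpha>])
  show "ennreal ((hnorm (F \<alpha>) (rep (restr A \<Phi>) \<alpha>))\<^sup>2) =
      ennreal ((hnorm (F \<alpha>) (rep \<Phi> \<alpha>))\<^sup>2) * indicator A \<alpha>"
    using assms \<alpha> by (auto simp: restriction_proj indicator_def)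
qed

abbreviation tail :: "nat \<Rightarrow> 'a set"
  where "tail n \<equiv> {\<alpha> \<in> space M. n \<le> to_nat_on (space M) \<alpha>}"

text \<open>Every atom leaves the tails eventually, so dominated convergence applies with f as its
  own majorant. Used for norms in the closability argument and for energies in the density
  argument.\<close>

lemma tendsto_nn_integral_tail:
  assumes fin: "(\<integral>\<^sup>+ \<alpha>. f \<alpha> \<partial>M) < \<infinity>"
  shows "(\<lambda>n. \<integral>\<^sup>+ \<alpha>. f \<alpha> * indicator (tail n) \<alpha> \<partial>M) \<longlonglongrightarrow> 0"
proof -
  have "(\<lambda>n. \<integral>\<^sup>+ \<alpha>. f \<alpha> * indicator (tail n) \<alpha> \<partial>M) \<longlonglongrightarrow> (\<integral>\<^sup>+ \<alpha>. 0 \<partial>M)"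
  proof (rule nn_integral_dominated_convergence[OF _ _ _ _ fin])
    have "(\<lambda>n. f \<alpha> * indicator (tail n) \<alpha>) \<longlonglongrightarrow> 0" for \<alpha>
      \<comment> \<open>An atom of index k still belongs to tail k and is absent from k + 1
        onwards.\<close>
      by (intro tendsto_eventually eventually_sequentiallyI[of "Suc (to_nat_on (space M) \<alpha>)"])
        (auto simp: indicator_def)
    then show "AE \<alpha> in M. (\<lambda>n. f \<alpha> * indicator (tail n) \<alpha>) \<longlonglongrightarrow> 0" by simp
  qed (auto intro!: AE_I2 simp: indicator_def)
  then show ?thesis by simp
qed

end

text \<open>The Cauchy condition in \<open>closable_form\<close> ranges over pairs (n, m) in both
  orders, while additivity computes the form of a difference of tails in one order only; evenness
  supplies the other.\<close>

lemma (in complex_inner_space) hermitian_quadratic_form_uminus: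
  assumes "hermitian_quadratic_form H D Q" "x \<in> D"
  shows "Q ((- 1) \<odot> x) = Q x"
proof -
  obtain B where B: "hermitian_sesquilinear H D B" "\<And>x. x \<in> D \<Longrightarrow> complex_of_real (Q x) = B x x"
    and sub: "submodule D complex_ring H"
    using assms(1) unfolding hermitian_quadratic_form_def by blast
  have mx: "(- 1) \<odot> x \<in> D"
    by (rule submodule_complexD(4)[OF sub assms(2)])
  have smult: "B y ((- 1) \<odot> x) = - B y x" if "y \<in> D" for y
  proof -
    have "B y (c \<odot> x) = c * B y x" for c
      using B(1) assms(2) that unfolding hermitian_sesquilinear_def by blast
    then show ?thesis by simp
  qed
  have comm: "B y z = cnj (B z y)" if "y \<in> D" "z \<in> D" for y z
    using B(1) that unfolding hermitian_sesquilinear_def by blast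
  have "B ((- 1) \<odot> x) ((- 1) \<odot> x) = - B ((- 1) \<odot> x) x"
    using smult[OF mx] .
  also have "\<dots> = - cnj (B x ((- 1) \<odot> x))"
    using comm[OF mx assms(2)] by simp
  also have "\<dots> = cnj (B x x)"
    by (simp add: smult[OF assms(2)])
  also have "\<dots> = B x x"
    by (rule comm[OF assms(2) assms(2), symmetric])
  finally have "complex_of_real (Q ((- 1) \<odot> x)) = complex_of_real (Q x)"
    using B(2) mx assms(2) by simp
  then show ?thesis by (simp only: of_real_eq_iff)
qed

locale additive_form = atomic_field M F e
  for M :: "'a measure" and F :: "'a \<Rightarrow> 'v hilbert" and e :: "nat \<Rightarrow> 'a \<Rightarrow> 'v" +
  fixes D :: "('a \<Rightarrow> 'v) set set" and Q :: "('a \<Rightarrow> 'v) set \<Rightarrow> real"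
  assumes form: "hermitian_quadratic_form H D Q"
    and closable: "closable_form H D Q"
    and additive: "orthogonally_additive M F e D Q"
begin

lemma D_submodule: "submodule D complex_ring H"
  and D_carrier: "\<Phi> \<in> D \<Longrightarrow> \<Phi> \<in> carrier H"
  using form H.submodule_complexD(1)[of D] unfolding hermitian_quadratic_form_def by blast+

lemma restr_D: "\<lbrakk>\<Phi> \<in> D; \<Delta> \<subseteq> space M\<rbrakk> \<Longrightarrow> restr \<Delta> \<Phi> \<in> D"
  using conjunct1[OF additive[unfolded orthogonally_additive_def]] by (auto simp: sets_M)

lemma Q_Un:
  assumes "\<Phi> \<in> D" "A \<subseteq> space M" "B \<subseteq> space M" "A \<inter> B = {}"
  shows "Q (restr (A \<union> B) \<Phi>) = Q (restr A \<Phi>) + Q (restr B \<Phi>)"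
proof -
  have I: "{1..2::nat} = {1, 2}" by auto
  let ?\<Delta>s = "\<lambda>i::nat. if i = 1 then A else B"
  have "(\<Union>i\<in>{1..2}. ?\<Delta>s i) = A \<union> B"
    unfolding I by (simp only: UN_insert) simp
  moreover have "?\<Delta>s ` {1..2} \<subseteq> sets M" "A \<union> B \<in> sets M"
    using assms by (auto simp: sets_M)
  moreover have "disjoint_family_on ?\<Delta>s {1..2}"
    using assms(4) unfolding disjoint_family_on_def I by auto
  ultimately have "Q (restr (A \<union> B) \<Phi>) = (\<Sum>i = 1..2. Q (restr (?\<Delta>s i) \<Phi>))"
    using additive assms(1) unfolding orthogonally_additive_def by blast
  then show ?thesis unfolding I by simp
qed

text \<open>The empty set is disjoint from itself, so additivity reads q = q + q.\<close>

lemma Q_empty: "\<Phi> \<in> D \<Longrightarrow> Q (restr {} \<Phi>) = 0"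
  using Q_Un[of \<Phi> "{}" "{}"] by simp

lemma Q_UN_atom:
  assumes "\<Phi> \<in> D" "finite I"
  shows "Q (restr (\<Union>i\<in>I. atom i) \<Phi>) = (\<Sum>i\<in>I. Q (restr (atom i) \<Phi>))"
  using assms(2)
proof induction
  case empty
  then show ?case using Q_empty[OF assms(1)] by simp
next
  case (insert i I)
  have "atom i \<inter> (\<Union>i\<in>I. atom i) = {}"
    using insert(2) by (auto simp: atom_def)
  then have "Q (restr (atom i \<union> (\<Union>i\<in>I. atom i)) \<Phi>) =
      Q (restr (atom i) \<Phi>) + Q (restr (\<Union>i\<in>I. atom i) \<Phi>)"
    by (intro Q_Un assms(1)) (auto simp: atom_def)
  then show ?case using insert by simp
qed

text \<open>Boundedness of the charge \<open>\<Delta> \<mapsto> Q(P\<^sub>\<Delta> \<Phi>)\<close> makes the series over the atoms absolutely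
  convergent; closability, applied to the restrictions of \<open>\<Phi>\<close> to the tails of the
  enumeration, identifies its sum.\<close>

lemma Q_sums:
  assumes \<Phi>: "\<Phi> \<in> D"
  shows "(\<lambda>i. Q (restr (atom i) \<Phi>)) sums Q \<Phi>"
proof -
  have \<Phi>H: "\<Phi> \<in> carrier H" by (rule D_carrier[OF \<Phi>])
  let ?g = "\<lambda>i. Q (restr (atom i) \<Phi>)"
  obtain C where "\<forall>\<Delta>\<in>sets M. \<bar>Q (restr \<Delta> \<Phi>)\<bar> < C"
    using conjunct1[OF conjunct2[OF additive[unfolded orthogonally_additive_def]]] \<Phi> by blast
  then have C: "\<bar>Q (restr \<Delta> \<Phi>)\<bar> < C" if "\<Delta> \<subseteq> space M" for \<Delta>
    using that by (simp add: sets_M)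
  have bound: "(\<Sum>i\<in>I. ?g i) < C" "- (\<Sum>i\<in>I. ?g i) < C" if "finite I" for I
  proof -
    have "(\<Union>i\<in>I. atom i) \<subseteq> space M" by (auto simp: atom_def)
    from C[OF this] show "(\<Sum>i\<in>I. ?g i) < C" "- (\<Sum>i\<in>I. ?g i) < C"
      unfolding Q_UN_atom[OF \<Phi> that] by linarith+
  qed
  \<comment> \<open>The terms are split by sign; each of the two partial sums is, up to sign, the
    form on a finite union of atoms, hence below C.\<close>
  have "(\<Sum>i<n. \<bar>?g i\<bar>) \<le> 2 * C" for n
  proof -
    let ?I = "{..<n} \<inter> {i. ?g i \<ge> 0}" and ?J = "{..<n} \<inter> - {i. ?g i \<ge> 0}"
    have "(\<Sum>i<n. \<bar>?g i\<bar>) = (\<Sum>i<n. if ?g i \<ge> 0 then ?g i else - ?g i)"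
      by (intro sum.cong) auto
    also have "\<dots> = (\<Sum>i\<in>?I. ?g i) - (\<Sum>i\<in>?J. ?g i)"
      by (subst sum.If_cases) (simp_all add: sum_negf)
    finally show ?thesis
      using bound(1)[of ?I] bound(2)[of ?J] by simp
  qed
  then have "summable (\<lambda>i. \<bar>?g i\<bar>)"
    by (rule_tac summableI_nonneg_bounded[of _ "2 * C"]) simp_all
  then have "summable ?g" by (rule summable_rabs_cancel)
  then have sum: "(\<lambda>n. \<Sum>i<n. ?g i) \<longlonglongrightarrow> suminf ?g" by (rule summable_LIMSEQ)
  define u where "u n = restr (tail n) \<Phi>" for n
  have u1: "u n \<in> D" for n
    unfolding u_def by (rule restr_D[OF \<Phi>]) auto
  note u = u1 D_carrier[OF u1]
  have Qu: "Q (u n) = Q \<Phi> - (\<Sum>i<n. ?g i)" for n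
  proof -
    have "(\<Union>i\<in>{..<n}. atom i) \<union> tail n = space M" "(\<Union>i\<in>{..<n}. atom i) \<inter> tail n = {}"
      "(\<Union>i\<in>{..<n}. atom i) \<subseteq> space M"
      by (auto simp: atom_def)
    then show ?thesis
      using Q_Un[OF \<Phi>, of "\<Union>i\<in>{..<n}. atom i" "tail n"] Q_UN_atom[OF \<Phi>, of "{..<n}"]
      by (simp add: u_def restr_space[OF \<Phi>H])
  qed
  have "(\<lambda>n. ennreal ((hnorm H (u n))\<^sup>2)) \<longlonglongrightarrow> 0"
    unfolding u_def hnorm_restr[OF \<Phi>H] by (rule tendsto_nn_integral_tail[OF rep_finite[OF \<Phi>H]])
  then have "(\<lambda>n. hnorm H (u n)) \<longlonglongrightarrow> 0" by (simp add: ennreal_tendsto_0_iff)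
  then have u0: "limitin (htopology H) u \<zero>\<^bsub>H\<^esub> sequentially"
    using u H_zero(1) by (subst H.limitin_iff) (simp_all add: H.minus_zero_right)
  \<comment> \<open>For nested tails the difference is the restriction to tail n - tail m, which is
    disjoint from tail m; so additivity applies although Q is quadratic.\<close>
  have diff: "Q (u n \<ominus>\<^bsub>H\<^esub> u m) = Q (u n) - Q (u m)" if "n \<le> m" for n m
  proof -
    have sub: "tail m \<subseteq> tail n" using that by auto
    have "Q (restr (tail m \<union> (tail n - tail m)) \<Phi>) = Q (u m) + Q (restr (tail n - tail m) \<Phi>)"
      unfolding u_def by (intro Q_Un \<Phi>) auto
    moreover have "tail m \<union> (tail n - tail m) = tail n" using sub by auto
    ultimately show ?thesis
      using restr_diff[OF \<Phi>H sub] by (simp add: u_def)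
  qed
  have abs_diff: "\<bar>Q (u n \<ominus>\<^bsub>H\<^esub> u m)\<bar> = \<bar>Q (u n) - Q (u m)\<bar>" for n m
  proof (cases "n \<le> m")
    case False
    have "u n \<ominus>\<^bsub>H\<^esub> u m = (- 1) \<odot>\<^bsub>H\<^esub> (u m \<ominus>\<^bsub>H\<^esub> u n)"
      using u by (intro H.cinner_ext)
        (auto simp: H.cinner_minus_right H.cinner_smult_right H.smult_in_carrier)
    moreover have "u m \<ominus>\<^bsub>H\<^esub> u n \<in> D"
      by (rule H.submodule_complexD(5)[OF D_submodule u1 u1])
    ultimately have "Q (u n \<ominus>\<^bsub>H\<^esub> u m) = Q (u m \<ominus>\<^bsub>H\<^esub> u n)"
      using H.hermitian_quadratic_form_uminus[OF form] by simp
    then show ?thesis using diff[of m n] False by simp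
  qed (simp add: diff)
  have lim: "(\<lambda>n. Q (u n)) \<longlonglongrightarrow> Q \<Phi> - suminf ?g"
    unfolding Qu by (intro tendsto_intros sum)
  \<comment> \<open>The Q-values of the tails converge to a common limit, so their differences
    vanish along the product filter demanded by closability.\<close>
  have "((\<lambda>p. Q (u (fst p)) - Q (u (snd p))) \<longlongrightarrow>
      (Q \<Phi> - suminf ?g) - (Q \<Phi> - suminf ?g)) (sequentially \<times>\<^sub>F sequentially)"
    by (intro tendsto_diff filterlim_compose[OF lim filterlim_fst] filterlim_compose[OF lim filterlim_snd])
  then have "((\<lambda>p. \<bar>Q (u (fst p)) - Q (u (snd p))\<bar>) \<longlongrightarrow> 0) (sequentially \<times>\<^sub>F sequentially)"
    by (intro tendsto_rabs_zero) simp
  then have "((\<lambda>p. \<bar>Q (u (fst p) \<ominus>\<^bsub>H\<^esub> u (snd p))\<bar>) \<longlongrightarrow> 0) (sequentially \<times>\<^sub>F sequentially)"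
    by (simp only: abs_diff)
  then have "((\<lambda>(n, m). Q (u n \<ominus>\<^bsub>H\<^esub> u m)) \<longlongrightarrow> 0) (sequentially \<times>\<^sub>F sequentially)"
    by (simp add: tendsto_rabs_zero_iff case_prod_unfold)
  moreover have "range u \<subseteq> D" using u1 by auto
  ultimately have "(\<lambda>n. Q (u n)) \<longlonglongrightarrow> 0"
    using closable[unfolded closable_form_def, rule_format, of u] u0 by simp
  then have "(\<lambda>n. Q \<Phi> - Q (u n)) \<longlonglongrightarrow> Q \<Phi> - 0"
    by (intro tendsto_diff tendsto_const)
  then show ?thesis by (simp add: sums_def Qu)
qed

lemma fiber_form_rep:
  assumes \<Phi>: "\<Phi> \<in> D" and \<alpha>: "\<alpha> \<in> space M"
  shows "fiber_form M F e D Q \<alpha> (rep \<Phi> \<alpha>) = Q (restr {\<alpha>} \<Phi>) / \<mu> \<alpha>"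
  unfolding fiber_form_def
proof (rule the_equality)
  show "\<exists>\<Psi>\<in>D. rep \<Psi> \<alpha> = rep \<Phi> \<alpha> \<and> Q (restr {\<alpha>} \<Phi>) / \<mu> \<alpha> = Q (restr {\<alpha>} \<Psi>) / \<mu> \<alpha>"
    using \<Phi> by blast
  fix c assume "\<exists>\<Psi>\<in>D. rep \<Psi> \<alpha> = rep \<Phi> \<alpha> \<and> c = Q (restr {\<alpha>} \<Psi>) / \<mu> \<alpha>"
  then obtain \<Psi> where \<Psi>: "\<Psi> \<in> D" "rep \<Psi> \<alpha> = rep \<Phi> \<alpha>" "c = Q (restr {\<alpha>} \<Psi>) / \<mu> \<alpha>" by blast
  have "restr {\<alpha>} \<Psi> = restr {\<alpha>} \<Phi>"
    using \<Psi>(2) D_carrier[OF \<Phi>] D_carrier[OF \<Psi>(1)]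
    by (intro H_eqI) (auto simp: restriction_proj)
  with \<Psi>(3) show "c = Q (restr {\<alpha>} \<Phi>) / \<mu> \<alpha>" by simp
qed

text \<open>Termwise, Q of the restriction to an atom is h(\<alpha>) times its mass, the integral of
  h over that atom. Integrability of h makes its integral countably additive, so the series of
  \<open>Q_sums\<close> has the integral as its sum.\<close>

lemma Q_eq_integral:
  assumes \<Phi>: "\<Phi> \<in> D" and int: "integrable M h"
    and h: "\<And>\<alpha>. \<alpha> \<in> space M \<Longrightarrow> fiber_form M F e D Q \<alpha> (rep \<Phi> \<alpha>) = h \<alpha>"
  shows "Q \<Phi> = (\<integral>\<alpha>. h \<alpha> \<partial>M)"
proof -
  have "Q (restr (atom i) \<Phi>) = (LINT \<alpha>:atom i|M. h \<alpha>)" for i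
  proof (cases rule: atom_cases[of i])
    case 1
    then show ?thesis using Q_empty[OF \<Phi>] by (simp add: set_lebesgue_integral_def)
  next
    case (2 \<alpha>)
    have "Q (restr {\<alpha>} \<Phi>) = h \<alpha> * \<mu> \<alpha>"
      using h[OF 2(1)] fiber_form_rep[OF \<Phi> 2(1)] atom_measure_pos[OF 2(1)] by (simp add: field_simps)
    also have "\<dots> = (\<integral>\<beta>. h \<alpha> * indicator {\<alpha>} \<beta> \<partial>M)"
      using 2(1) by simp
    also have "\<dots> = (LINT \<beta>:{\<alpha>}|M. h \<beta>)"
      unfolding set_lebesgue_integral_def
      by (intro Bochner_Integration.integral_cong) (auto simp: indicator_def)
    finally show ?thesis using 2 by simp
  qed
  then have "(\<lambda>i. LINT \<alpha>:atom i|M. h \<alpha>) sums Q \<Phi>"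
    using Q_sums[OF \<Phi>] by simp
  moreover have "(LINT \<alpha>:(\<Union>i. atom i)|M. h \<alpha>) = (\<Sum>i. LINT \<alpha>:atom i|M. h \<alpha>)"
  proof (rule lebesgue_integral_countable_add[OF _ disjoint_atom])
    show "set_integrable M (\<Union>i. atom i) h"
      unfolding set_integrable_def UN_atom using int by (intro integrable_mult_indicator) auto
  qed (auto simp: sets_M atom_def)
  moreover have "(LINT \<alpha>:(\<Union>i. atom i)|M. h \<alpha>) = (\<integral>\<alpha>. h \<alpha> \<partial>M)"
    unfolding UN_atom set_lebesgue_integral_def
    by (intro Bochner_Integration.integral_cong) auto
  ultimately show ?thesis by (simp add: sums_iff)
qed

end

section \<open>Spectral resolutions in direct integrals\<close>

locale atomic_resolution = atomic_field M F e
  for M :: "'a measure" and F :: "'a \<Rightarrow> 'v hilbert" and e :: "nat \<Rightarrow> 'a \<Rightarrow> 'v" +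
  fixes Ef :: "'a \<Rightarrow> real set \<Rightarrow> 'v \<Rightarrow> 'v"
  assumes fiber_pvm: "\<alpha> \<in> space M \<Longrightarrow> projection_valued_measure (F \<alpha>) (Ef \<alpha>)"
begin

abbreviation E :: "real set \<Rightarrow> ('a \<Rightarrow> 'v) set \<Rightarrow> ('a \<Rightarrow> 'v) set"
  where "E \<equiv> \<lambda>\<sigma>. decomposable_operator M F e (\<lambda>\<alpha>. Ef \<alpha> \<sigma>)"

lemma fiber_resolution:
  assumes "\<alpha> \<in> space M"
  shows "spectral_resolution (F \<alpha>) (Ef \<alpha>)"
proof -
  interpret A: hilbert_space "F \<alpha>" by (rule fiber_hilbert[OF assms])
  show ?thesis
    by unfold_locales (rule A.complete, rule fiber_pvm[OF assms])
qed

lemma E_H: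
  assumes \<Phi>: "\<Phi> \<in> carrier H" and \<sigma>: "\<sigma> \<in> sets borel"
  shows "E \<sigma> \<Phi> \<in> carrier H" and "\<alpha> \<in> space M \<Longrightarrow> rep (E \<sigma> \<Phi>) \<alpha> = Ef \<alpha> \<sigma> (rep \<Phi> \<alpha>)"
proof -
  have "Ef \<alpha> \<sigma> (rep \<Phi> \<alpha>) \<in> carrier (F \<alpha>)"
    "hnorm (F \<alpha>) (Ef \<alpha> \<sigma> (rep \<Phi> \<alpha>)) \<le> 1 * hnorm (F \<alpha>) (rep \<Phi> \<alpha>)" if \<alpha>: "\<alpha> \<in> space M" for \<alpha>
  proof -
    interpret A: spectral_resolution "F \<alpha>" "Ef \<alpha>" by (rule fiber_resolution[OF \<alpha>])
    show "Ef \<alpha> \<sigma> (rep \<Phi> \<alpha>) \<in> carrier (F \<alpha>)"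
      "hnorm (F \<alpha>) (Ef \<alpha> \<sigma> (rep \<Phi> \<alpha>)) \<le> 1 * hnorm (F \<alpha>) (rep \<Phi> \<alpha>)"
      using \<Phi> \<alpha> \<sigma> A.proj_hnorm_le[OF A.E_proj] by simp_all
  qed
  note section_class_bounded[of "\<lambda>\<alpha>. Ef \<alpha> \<sigma> (rep \<Phi> \<alpha>)", OF this(1) \<Phi> this(2)]
  then show "E \<sigma> \<Phi> \<in> carrier H" "\<alpha> \<in> space M \<Longrightarrow> rep (E \<sigma> \<Phi>) \<alpha> = Ef \<alpha> \<sigma> (rep \<Phi> \<alpha>)"
    by (simp_all add: decomposable_operator_def)
qed

lemma hnorm_E:
  assumes "\<Phi> \<in> carrier H" "\<sigma> \<in> sets borel"
  shows "ennreal ((hnorm H (E \<sigma> \<Phi>))\<^sup>2) = (\<integral>\<^sup>+ \<alpha>. emeasure (spectral_measure (F \<alpha>) (Ef \<alpha>) (rep \<Phi> \<alpha>)) \<sigma> \<partial>M)"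
  unfolding hnorm_H[OF E_H(1)[OF assms]]
proof (rule nn_integral_cong)
  fix \<alpha> assume \<alpha>: "\<alpha> \<in> space M"
  interpret A: spectral_resolution "F \<alpha>" "Ef \<alpha>" by (rule fiber_resolution[OF \<alpha>])
  show "ennreal ((hnorm (F \<alpha>) (rep (E \<sigma> \<Phi>) \<alpha>))\<^sup>2) =
      emeasure (spectral_measure (F \<alpha>) (Ef \<alpha>) (rep \<Phi> \<alpha>)) \<sigma>"
    using assms \<alpha> by (simp add: E_H A.emeasure_spectral_measure)
qed

text \<open>The algebraic laws hold fiber by fiber. Countable additivity is reduced to squared
  norms, for which the sum of the fiber measures is interchanged with the nonnegative integral over
  M.\<close>

lemma pvm_H: "projection_valued_measure H E"
proof (rule H.projection_valued_measureI)
  fix \<sigma> :: "real set" assume \<sigma>: "\<sigma> \<in> sets borel"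
  show "projection_operator H (E \<sigma>)"
    unfolding projection_operator_def
  proof (intro conjI ballI)
    fix \<Phi> assume \<Phi>: "\<Phi> \<in> carrier H"
    show c: "E \<sigma> \<Phi> \<in> carrier H" by (rule E_H(1)[OF \<Phi> \<sigma>])
    show "E \<sigma> (E \<sigma> \<Phi>) = E \<sigma> \<Phi>"
    proof (rule H_eqI)
      fix \<alpha> assume \<alpha>: "\<alpha> \<in> space M"
      interpret A: spectral_resolution "F \<alpha>" "Ef \<alpha>" by (rule fiber_resolution[OF \<alpha>])
      show "rep (E \<sigma> (E \<sigma> \<Phi>)) \<alpha> = rep (E \<sigma> \<Phi>) \<alpha>"
        using \<Phi> c \<alpha> \<sigma> by (simp add: E_H A.E_Int)
    qed (use c \<sigma> in \<open>simp_all add: E_H\<close>)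
    fix \<Psi> assume \<Psi>: "\<Psi> \<in> carrier H"
    show "cinner H \<Phi> (E \<sigma> \<Psi>) = cinner H (E \<sigma> \<Phi>) \<Psi>"
      unfolding cinner_H
    proof (rule Bochner_Integration.integral_cong[OF refl])
      fix \<alpha> assume \<alpha>: "\<alpha> \<in> space M"
      interpret A: spectral_resolution "F \<alpha>" "Ef \<alpha>" by (rule fiber_resolution[OF \<alpha>])
      show "cinner (F \<alpha>) (rep \<Phi> \<alpha>) (rep (E \<sigma> \<Psi>) \<alpha>) = cinner (F \<alpha>) (rep (E \<sigma> \<Phi>) \<alpha>) (rep \<Psi> \<alpha>)"
        using \<Phi> \<Psi> \<alpha> \<sigma> by (simp add: E_H A.proj_symmetric[OF A.E_proj])
    qed
  qed
next
  fix \<Phi> assume \<Phi>: "\<Phi> \<in> carrier H"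
  show "E UNIV \<Phi> = \<Phi>"
  proof (rule H_eqI)
    fix \<alpha> assume \<alpha>: "\<alpha> \<in> space M"
    interpret A: spectral_resolution "F \<alpha>" "Ef \<alpha>" by (rule fiber_resolution[OF \<alpha>])
    show "rep (E UNIV \<Phi>) \<alpha> = rep \<Phi> \<alpha>"
      using \<Phi> \<alpha> by (simp add: E_H A.E_UNIV)
  qed (use \<Phi> in \<open>simp_all add: E_H\<close>)
next
  fix \<sigma> \<tau> :: "real set" and \<Phi>
  assume \<sigma>: "\<sigma> \<in> sets borel" and \<tau>: "\<tau> \<in> sets borel" and \<Phi>: "\<Phi> \<in> carrier H"
  show "E (\<sigma> \<inter> \<tau>) \<Phi> = E \<sigma> (E \<tau> \<Phi>)"
  proof (rule H_eqI)
    fix \<alpha> assume \<alpha>: "\<alpha> \<in> space M"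
    interpret A: spectral_resolution "F \<alpha>" "Ef \<alpha>" by (rule fiber_resolution[OF \<alpha>])
    show "rep (E (\<sigma> \<inter> \<tau>) \<Phi>) \<alpha> = rep (E \<sigma> (E \<tau> \<Phi>)) \<alpha>"
      using \<Phi> \<alpha> \<sigma> \<tau> by (simp add: E_H A.E_Int)
  qed (use \<Phi> \<sigma> \<tau> in \<open>simp_all add: E_H\<close>)
next
  fix \<sigma> :: "nat \<Rightarrow> real set" and \<Phi>
  assume \<sigma>: "range \<sigma> \<subseteq> sets borel" and disj: "disjoint_family \<sigma>" and \<Phi>: "\<Phi> \<in> carrier H"
  have \<sigma>': "\<sigma> i \<in> sets borel" for i using \<sigma> by auto
  let ?n = "\<lambda>\<alpha>. emeasure (spectral_measure (F \<alpha>) (Ef \<alpha>) (rep \<Phi> \<alpha>))"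
  have U: "(\<Union>i. \<sigma> i) \<in> sets borel" using \<sigma>' by auto
  have "ennreal ((hnorm H (E (\<Union>i. \<sigma> i) \<Phi>))\<^sup>2) = (\<integral>\<^sup>+ \<alpha>. (\<Sum>i. ?n \<alpha> (\<sigma> i)) \<partial>M)"
    unfolding hnorm_E[OF \<Phi> U]
  proof (rule nn_integral_cong)
    fix \<alpha> assume \<alpha>: "\<alpha> \<in> space M"
    interpret A: spectral_resolution "F \<alpha>" "Ef \<alpha>" by (rule fiber_resolution[OF \<alpha>])
    show "?n \<alpha> (\<Union>i. \<sigma> i) = (\<Sum>i. ?n \<alpha> (\<sigma> i))"
      using \<sigma> disj by (intro suminf_emeasure[symmetric]) (auto simp: A.sets_spectral_measure)
  qed
  also have "\<dots> = (\<Sum>i. ennreal ((hnorm H (E (\<sigma> i) \<Phi>))\<^sup>2))"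
    using hnorm_E[OF \<Phi> \<sigma>'] by (simp add: nn_integral_suminf)
  finally have "(\<lambda>i. ennreal ((hnorm H (E (\<sigma> i) \<Phi>))\<^sup>2)) sums ennreal ((hnorm H (E (\<Union>i. \<sigma> i) \<Phi>))\<^sup>2)"
    by (simp add: summable_sums)
  then show "(\<lambda>i. (hnorm H (E (\<sigma> i) \<Phi>))\<^sup>2) sums (hnorm H (E (\<Union>i. \<sigma> i) \<Phi>))\<^sup>2"
    by simp
qed

sublocale S: spectral_resolution H E
  by unfold_locales (rule mcomplete_H, rule pvm_H)

text \<open>Disintegration of the spectral measure: known for indicators by \<open>hnorm_E\<close>,
  extended by linearity and monotone convergence. It transfers domains, forms and energies between H
  and the fibers.\<close>

lemma nn_integral_spectral_measure_H:
  assumes \<Phi>: "\<Phi> \<in> carrier H" and f: "f \<in> borel_measurable borel"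
  shows "(\<integral>\<^sup>+ t. f t \<partial>spectral_measure H E \<Phi>) =
    (\<integral>\<^sup>+ \<alpha>. (\<integral>\<^sup>+ t. f t \<partial>spectral_measure (F \<alpha>) (Ef \<alpha>) (rep \<Phi> \<alpha>)) \<partial>M)"
    (is "_ = (\<integral>\<^sup>+ \<alpha>. ?N \<alpha> f \<partial>M)")
  using f
proof induction
  case (cong f g)
  then have "f = g" by (intro ext) simp
  then show ?case using cong by simp
next
  case (set A)
  have "(\<integral>\<^sup>+ \<alpha>. ?N \<alpha> (indicator A) \<partial>M) =
      (\<integral>\<^sup>+ \<alpha>. emeasure (spectral_measure (F \<alpha>) (Ef \<alpha>) (rep \<Phi> \<alpha>)) A \<partial>M)"
  proof (rule nn_integral_cong)
    fix \<alpha> assume \<alpha>: "\<alpha> \<in> space M"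
    interpret A: spectral_resolution "F \<alpha>" "Ef \<alpha>" by (rule fiber_resolution[OF \<alpha>])
    show "?N \<alpha> (indicator A) = emeasure (spectral_measure (F \<alpha>) (Ef \<alpha>) (rep \<Phi> \<alpha>)) A"
      using set by (simp add: A.sets_spectral_measure)
  qed
  then show ?case
    using set \<Phi> by (simp add: S.sets_spectral_measure S.emeasure_spectral_measure hnorm_E)
next
  case (mult u c)
  have "(\<integral>\<^sup>+ \<alpha>. ?N \<alpha> (\<lambda>t. c * u t) \<partial>M) = (\<integral>\<^sup>+ \<alpha>. c * ?N \<alpha> u \<partial>M)"
  proof (rule nn_integral_cong)
    fix \<alpha> assume \<alpha>: "\<alpha> \<in> space M"
    interpret A: spectral_resolution "F \<alpha>" "Ef \<alpha>" by (rule fiber_resolution[OF \<alpha>])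
    show "?N \<alpha> (\<lambda>t. c * u t) = c * ?N \<alpha> u"
      using mult by (simp add: nn_integral_cmult)
  qed
  then show ?case using mult by (simp add: nn_integral_cmult)
next
  case (add u v)
  have "(\<integral>\<^sup>+ \<alpha>. ?N \<alpha> (\<lambda>t. v t + u t) \<partial>M) = (\<integral>\<^sup>+ \<alpha>. ?N \<alpha> v + ?N \<alpha> u \<partial>M)"
  proof (rule nn_integral_cong)
    fix \<alpha> assume \<alpha>: "\<alpha> \<in> space M"
    interpret A: spectral_resolution "F \<alpha>" "Ef \<alpha>" by (rule fiber_resolution[OF \<alpha>])
    show "?N \<alpha> (\<lambda>t. v t + u t) = ?N \<alpha> v + ?N \<alpha> u"
      using add by (simp add: nn_integral_add)
  qed
  then show ?case using add by (simp add: nn_integral_add)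
next
  case (seq U)
  have "(\<integral>\<^sup>+ \<alpha>. ?N \<alpha> (SUP i. U i) \<partial>M) = (\<integral>\<^sup>+ \<alpha>. (SUP i. ?N \<alpha> (U i)) \<partial>M)"
  proof (rule nn_integral_cong)
    fix \<alpha> assume \<alpha>: "\<alpha> \<in> space M"
    interpret A: spectral_resolution "F \<alpha>" "Ef \<alpha>" by (rule fiber_resolution[OF \<alpha>])
    show "?N \<alpha> (SUP i. U i) = (SUP i. ?N \<alpha> (U i))"
      unfolding SUP_apply using seq by (intro nn_integral_monotone_convergence_SUP) auto
  qed
  also have "\<dots> = (SUP i. \<integral>\<^sup>+ \<alpha>. ?N \<alpha> (U i) \<partial>M)"
  proof (rule nn_integral_monotone_convergence_SUP)
    show "incseq (\<lambda>i \<alpha>. ?N \<alpha> (U i))"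
      using seq(3) by (auto simp: incseq_def le_fun_def intro!: nn_integral_mono)
  qed simp
  also have "\<dots> = (SUP i. \<integral>\<^sup>+ t. U i t \<partial>spectral_measure H E \<Phi>)"
    using seq.IH by simp
  also have "\<dots> = (\<integral>\<^sup>+ t. (SUP i. U i) t \<partial>spectral_measure H E \<Phi>)"
    unfolding SUP_apply using seq by (intro nn_integral_monotone_convergence_SUP[symmetric]) auto
  finally show ?case by simp
qed

section \<open>Form domain, form and energy of T in terms of the fibers\<close>

abbreviation fiber_form_dom :: "'a \<Rightarrow> 'v set"
  where "fiber_form_dom \<alpha> \<equiv> dom (sqrt_abs_operator (F \<alpha>) (Ef \<alpha>))"

text \<open>A single fiber contributes \<mu> \<alpha> times its integral of |t|; since \<mu>
  \<alpha> > 0, finiteness of the total passes to each fiber.\<close>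

lemma rep_form_dom:
  assumes \<Phi>: "\<Phi> \<in> S.form_dom" and \<alpha>: "\<alpha> \<in> space M"
  shows "rep \<Phi> \<alpha> \<in> fiber_form_dom \<alpha>"
proof -
  interpret A: spectral_resolution "F \<alpha>" "Ef \<alpha>" by (rule fiber_resolution[OF \<alpha>])
  have \<Phi>H: "\<Phi> \<in> carrier H" by (rule S.spec_dom_carrier[OF \<Phi>])
  have "(\<integral>\<^sup>+ t. ennreal \<bar>t\<bar> \<partial>A.\<nu> (rep \<Phi> \<alpha>)) * ennreal (\<mu> \<alpha>) \<le>
      (\<integral>\<^sup>+ t. ennreal \<bar>t\<bar> \<partial>spectral_measure H E \<Phi>)"
    using atom_le_nn_integral[OF \<alpha>, of "\<lambda>\<alpha>. \<integral>\<^sup>+ t. ennreal \<bar>t\<bar> \<partial>spectral_measure (F \<alpha>) (Ef \<alpha>) (rep \<Phi> \<alpha>)"]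
      \<Phi>H by (simp add: nn_integral_spectral_measure_H)
  also have "\<dots> < \<infinity>" using \<Phi> unfolding S.form_dom_iff by blast
  finally have "(\<integral>\<^sup>+ t. ennreal \<bar>t\<bar> \<partial>A.\<nu> (rep \<Phi> \<alpha>)) < \<infinity>"
    using atom_measure_pos[OF \<alpha>] by (auto simp: ennreal_mult_less_top)
  then show ?thesis
    using \<Phi>H \<alpha> unfolding sqrt_abs_operator_def A.form_dom_iff by simp
qed

text \<open>Disintegration is available for nonnegative functions only, so t is split into its
  positive and negative parts. Membership of \<Phi> in the form domain bounds both by the finite
  integral of |t|, which excludes \<infinity> - \<infinity>.\<close>

lemma integral_spectral_measure_H:
  assumes \<Phi>: "\<Phi> \<in> S.form_dom"
  defines "h \<equiv> \<lambda>\<alpha>. \<integral>t. t \<partial>spectral_measure (F \<alpha>) (Ef \<alpha>) (rep \<Phi> \<alpha>)"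
  shows "integrable M h" and "(\<integral>t. t \<partial>spectral_measure H E \<Phi>) = (\<integral>\<alpha>. h \<alpha> \<partial>M)"
proof -
  let ?N = "\<lambda>f \<alpha>. \<integral>\<^sup>+ t. f t \<partial>spectral_measure (F \<alpha>) (Ef \<alpha>) (rep \<Phi> \<alpha>)"
  have \<Phi>H: "\<Phi> \<in> carrier H" by (rule S.spec_dom_carrier[OF \<Phi>])
  have fin: "(\<integral>\<^sup>+ t. ennreal \<bar>t\<bar> \<partial>spectral_measure H E \<Phi>) < \<infinity>"
    using \<Phi> unfolding S.form_dom_iff by blast
  \<comment> \<open>Stated once for any f below |t| and used for both parts. \<open>enn2real\<close>
    sends \<infinity> to 0, so finiteness in each fiber is checked before converting back.\<close>
  have part: "integrable M (\<lambda>\<alpha>. enn2real (?N f \<alpha>))"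
    "(\<integral>\<alpha>. enn2real (?N f \<alpha>) \<partial>M) = enn2real (\<integral>\<^sup>+ t. f t \<partial>spectral_measure H E \<Phi>)"
    if f: "f \<in> borel_measurable borel" "\<And>t. f t \<le> ennreal \<bar>t\<bar>" for f
  proof -
    have le: "?N f \<alpha> \<le> ?N (\<lambda>t. ennreal \<bar>t\<bar>) \<alpha>" for \<alpha>
      by (intro nn_integral_mono f)
    have eq: "ennreal (enn2real (?N f \<alpha>)) = ?N f \<alpha>" if \<alpha>: "\<alpha> \<in> space M" for \<alpha>
    proof -
      interpret A: spectral_resolution "F \<alpha>" "Ef \<alpha>" by (rule fiber_resolution[OF \<alpha>])
      have "?N (\<lambda>t. ennreal \<bar>t\<bar>) \<alpha> < \<infinity>"
        using rep_form_dom[OF \<Phi> \<alpha>] unfolding sqrt_abs_operator_def A.form_dom_iff by blast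
      with le have "?N f \<alpha> < \<infinity>" by (rule le_less_trans)
      then show ?thesis by simp
    qed
    have I: "(\<integral>\<^sup>+ \<alpha>. ennreal (enn2real (?N f \<alpha>)) \<partial>M) = (\<integral>\<^sup>+ t. f t \<partial>spectral_measure H E \<Phi>)"
      unfolding nn_integral_spectral_measure_H[OF \<Phi>H f(1)] by (intro nn_integral_cong eq)
    have "(\<integral>\<^sup>+ t. f t \<partial>spectral_measure H E \<Phi>) \<le> (\<integral>\<^sup>+ t. ennreal \<bar>t\<bar> \<partial>spectral_measure H E \<Phi>)"
      by (intro nn_integral_mono f)
    with fin have "(\<integral>\<^sup>+ \<alpha>. ennreal (enn2real (?N f \<alpha>)) \<partial>M) < \<infinity>"
      unfolding I by (rule_tac le_less_trans)
    then show "integrable M (\<lambda>\<alpha>. enn2real (?N f \<alpha>))"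
      by (intro integrableI_nonneg) auto
    show "(\<integral>\<alpha>. enn2real (?N f \<alpha>) \<partial>M) = enn2real (\<integral>\<^sup>+ t. f t \<partial>spectral_measure H E \<Phi>)"
      by (subst integral_eq_nn_integral) (simp_all add: I)
  qed
  let ?p = "\<lambda>t::real. ennreal t" and ?m = "\<lambda>t::real. ennreal (- t)"
  have p: "?p \<in> borel_measurable borel" "\<And>t. ?p t \<le> ennreal \<bar>t\<bar>"
    and m: "?m \<in> borel_measurable borel" "\<And>t. ?m t \<le> ennreal \<bar>t\<bar>"
    by (auto intro!: ennreal_leI)
  have h: "h \<alpha> = enn2real (?N ?p \<alpha>) - enn2real (?N ?m \<alpha>)" if \<alpha>: "\<alpha> \<in> space M" for \<alpha>
  proof -
    interpret A: spectral_resolution "F \<alpha>" "Ef \<alpha>" by (rule fiber_resolution[OF \<alpha>])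
    have "?N (\<lambda>t. ennreal \<bar>t\<bar>) \<alpha> < \<infinity>"
      using rep_form_dom[OF \<Phi> \<alpha>] unfolding sqrt_abs_operator_def A.form_dom_iff by blast
    then have "integrable (A.\<nu> (rep \<Phi> \<alpha>)) (\<lambda>t. t)"
      by (intro integrableI_bounded) auto
    then show ?thesis unfolding h_def by (rule real_lebesgue_integral_def)
  qed
  have "integrable M (\<lambda>\<alpha>. enn2real (?N ?p \<alpha>) - enn2real (?N ?m \<alpha>))"
    by (intro Bochner_Integration.integrable_diff part p m)
  then show "integrable M h"
    by (subst Bochner_Integration.integrable_cong[OF refl h])
  have "integrable (spectral_measure H E \<Phi>) (\<lambda>t. t)"
    using fin by (intro integrableI_bounded) auto
  then have "(\<integral>t. t \<partial>spectral_measure H E \<Phi>) =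
      (\<integral>\<alpha>. enn2real (?N ?p \<alpha>) \<partial>M) - (\<integral>\<alpha>. enn2real (?N ?m \<alpha>) \<partial>M)"
    unfolding part(2)[OF p] part(2)[OF m] by (rule real_lebesgue_integral_def)
  also have "\<dots> = (\<integral>\<alpha>. enn2real (?N ?p \<alpha>) - enn2real (?N ?m \<alpha>) \<partial>M)"
    by (intro Bochner_Integration.integral_diff[symmetric] part p m)
  also have "\<dots> = (\<integral>\<alpha>. h \<alpha> \<partial>M)"
    by (intro Bochner_Integration.integral_cong) (simp_all add: h)
  finally show "(\<integral>t. t \<partial>spectral_measure H E \<Phi>) = (\<integral>\<alpha>. h \<alpha> \<partial>M)" .
qed

abbreviation fiber_energy :: "'a \<Rightarrow> 'v \<Rightarrow> ennreal"
  where "fiber_energy \<alpha> \<equiv> spectral_resolution.energy (F \<alpha>) (Ef \<alpha>)"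

lemma energy_H:
  assumes "\<Phi> \<in> carrier H"
  shows "S.energy \<Phi> = (\<integral>\<^sup>+ \<alpha>. fiber_energy \<alpha> (rep \<Phi> \<alpha>) \<partial>M)"
  unfolding S.energy_def
  by (subst nn_integral_spectral_measure_H)
    (auto simp: assms spectral_resolution.energy_def[OF fiber_resolution] intro!: nn_integral_cong)

lemma energy_restr:
  assumes \<Phi>: "\<Phi> \<in> carrier H"
  shows "S.energy (restr A \<Phi>) = (\<integral>\<^sup>+ \<alpha>. fiber_energy \<alpha> (rep \<Phi> \<alpha>) * indicator A \<alpha> \<partial>M)"
  unfolding energy_H[OF restriction_proj(1)[OF \<Phi>]]
proof (rule nn_integral_cong)
  fix \<alpha> assume \<alpha>: "\<alpha> \<in> space M"
  interpret A: spectral_resolution "F \<alpha>" "Ef \<alpha>" by (rule fiber_resolution[OF \<alpha>])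
  have "fiber_energy \<alpha> \<zero>\<^bsub>F \<alpha>\<^esub> = 0" by (rule A.energy_zero)
  then show "fiber_energy \<alpha> (rep (restr A \<Phi>) \<alpha>) = fiber_energy \<alpha> (rep \<Phi> \<alpha>) * indicator A \<alpha>"
    using \<Phi> \<alpha> by (simp add: restriction_proj)
qed

lemma energy_restr_atom:
  assumes "\<Phi> \<in> carrier H" "\<alpha> \<in> space M"
  shows "S.energy (restr {\<alpha>} \<Phi>) = fiber_energy \<alpha> (rep \<Phi> \<alpha>) * ennreal (\<mu> \<alpha>)"
proof -
  have "S.energy (restr {\<alpha>} \<Phi>) = (\<integral>\<^sup>+ \<beta>. fiber_energy \<alpha> (rep \<Phi> \<alpha>) * indicator {\<alpha>} \<beta> \<partial>M)"
    unfolding energy_restr[OF assms(1)] by (intro nn_integral_cong) (auto simp: indicator_def)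
  then show ?thesis
    using assms(2) by (simp add: nn_integral_cmult_indicator sets_M emeasure_atom)
qed

lemma restr_form_dom:
  assumes "\<Phi> \<in> S.form_dom"
  shows "restr A \<Phi> \<in> S.form_dom"
proof -
  have \<Phi>: "\<Phi> \<in> carrier H" by (rule S.spec_dom_carrier[OF assms])
  have "S.energy (restr A \<Phi>) \<le> S.energy \<Phi>"
    unfolding energy_restr[OF \<Phi>] energy_H[OF \<Phi>]
    by (intro nn_integral_mono) (auto simp: indicator_def)
  also have "\<dots> < \<infinity>" using assms S.energy_finite_iff[OF \<Phi>] by blast
  finally show ?thesis using S.energy_finite_iff[OF restriction_proj(1)[OF \<Phi>]] by blast
qed

text \<open>Elements with finitely many nonzero components lie in the closure by approximation in each
  fiber, and they are dense in the form domain.\<close>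

lemma form_closure_H:
  assumes sub: "submodule D complex_ring H" and D: "D \<subseteq> S.form_dom"
    and restr_D: "\<And>\<alpha> \<Phi>. \<lbrakk>\<alpha> \<in> space M; \<Phi> \<in> D\<rbrakk> \<Longrightarrow> restr {\<alpha>} \<Phi> \<in> D"
    and fiber_cl: "\<And>\<alpha>. \<alpha> \<in> space M \<Longrightarrow>
      spectral_resolution.form_closure (F \<alpha>) (Ef \<alpha>) (fiber_domain D \<alpha>) = fiber_form_dom \<alpha>"
    and fiber_D: "\<And>\<alpha>. \<alpha> \<in> space M \<Longrightarrow> fiber_domain D \<alpha> \<subseteq> fiber_form_dom \<alpha>"
  shows "S.form_closure D = S.form_dom"
proof (intro subset_antisym subsetI)
  show "\<Phi> \<in> S.form_dom" if "\<Phi> \<in> S.form_closure D" for \<Phi>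
    using that unfolding S.form_closure_def by blast
  fix \<Phi> assume \<Phi>: "\<Phi> \<in> S.form_dom"
  then have \<Phi>H: "\<Phi> \<in> carrier H" by (rule S.spec_dom_carrier)
  have DH: "\<Psi> \<in> carrier H" if "\<Psi> \<in> D" for \<Psi>
    using that D S.spec_dom_carrier by blast
  have atom_cl: "restr {\<alpha>} \<Phi> \<in> S.form_closure D" if \<alpha>: "\<alpha> \<in> space M" for \<alpha>
    unfolding S.form_closure_iff[OF D]
  proof (intro conjI allI impI)
    show "restr {\<alpha>} \<Phi> \<in> S.form_dom" by (rule restr_form_dom[OF \<Phi>])
    fix \<epsilon> :: real assume "\<epsilon> > 0"
    interpret A: spectral_resolution "F \<alpha>" "Ef \<alpha>" by (rule fiber_resolution[OF \<alpha>])
    have "rep \<Phi> \<alpha> \<in> A.form_closure (fiber_domain D \<alpha>)"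
      unfolding fiber_cl[OF \<alpha>] by (rule rep_form_dom[OF \<Phi> \<alpha>])
    \<comment> \<open>Passing from the fiber to H multiplies the energy by \<mu> \<alpha>, which
      turns this tolerance into \<epsilon>.\<close>
    moreover have "\<epsilon> / \<mu> \<alpha> > 0" using \<open>\<epsilon> > 0\<close> atom_measure_pos[OF \<alpha>] by simp
    ultimately obtain y where y: "y \<in> fiber_domain D \<alpha>"
      "A.energy (rep \<Phi> \<alpha> \<ominus>\<^bsub>F \<alpha>\<^esub> y) < ennreal (\<epsilon> / \<mu> \<alpha>)"
      using A.form_closure_iff[OF fiber_D[OF \<alpha>, unfolded sqrt_abs_operator_def]] by blast
    then obtain \<Psi> where \<Psi>: "\<Psi> \<in> D" "y = rep \<Psi> \<alpha>"
      by (auto simp: fiber_domain_def)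
    have \<Psi>H: "\<Psi> \<in> carrier H" by (rule DH[OF \<Psi>(1)])
    \<comment> \<open>\<Psi> is controlled at \<alpha> only; its restriction to the atom stays in D
      and discards the other fibers.\<close>
    have "restr {\<alpha>} \<Phi> \<ominus>\<^bsub>H\<^esub> restr {\<alpha>} \<Psi> = restr {\<alpha>} (\<Phi> \<ominus>\<^bsub>H\<^esub> \<Psi>)"
    proof (rule H_eqI)
      fix \<beta> assume \<beta>: "\<beta> \<in> space M"
      interpret B: complex_inner_space "F \<beta>" by (rule fiber[OF \<beta>])
      show "rep (restr {\<alpha>} \<Phi> \<ominus>\<^bsub>H\<^esub> restr {\<alpha>} \<Psi>) \<beta> = rep (restr {\<alpha>} (\<Phi> \<ominus>\<^bsub>H\<^esub> \<Psi>)) \<beta>"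
        using \<Phi>H \<Psi>H \<beta> by (auto simp: restriction_proj rep_minus B.minus_zero_right)
    qed (use \<Phi>H \<Psi>H in \<open>simp_all add: restriction_proj\<close>)
    then have "S.energy (restr {\<alpha>} \<Phi> \<ominus>\<^bsub>H\<^esub> restr {\<alpha>} \<Psi>) =
        A.energy (rep \<Phi> \<alpha> \<ominus>\<^bsub>F \<alpha>\<^esub> y) * ennreal (\<mu> \<alpha>)"
      using \<Phi>H \<Psi>H \<alpha> by (simp add: energy_restr_atom rep_minus \<Psi>(2))
    also have "\<dots> < ennreal (\<epsilon> / \<mu> \<alpha>) * ennreal (\<mu> \<alpha>)"
      using y(2) atom_measure_pos[OF \<alpha>] by (intro ennreal_mult_strict_right_mono) auto
    also have "\<dots> = ennreal \<epsilon>"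
      using atom_measure_pos[OF \<alpha>] \<open>\<epsilon> > 0\<close> by (simp flip: ennreal_mult)
    finally show "\<exists>\<Psi>\<in>D. S.energy (restr {\<alpha>} \<Phi> \<ominus>\<^bsub>H\<^esub> \<Psi>) < ennreal \<epsilon>"
      using restr_D[OF \<alpha> \<Psi>(1)] by blast
  qed
  have fin_cl: "restr A \<Phi> \<in> S.form_closure D" if "finite A" "A \<subseteq> space M" for A
    using that
  proof induction
    case empty
    have "restr {} \<Phi> = \<zero>\<^bsub>H\<^esub>"
      using \<Phi>H by (intro H_eqI) (auto simp: restriction_proj H_zero)
    then show ?case
      using subsetD[OF S.subset_form_closure[OF D] H.submodule_complexD(2)[OF sub]] by simp
  next
    case (insert \<alpha> A)
    have "restr (insert \<alpha> A) \<Phi> = restr {\<alpha>} \<Phi> \<oplus>\<^bsub>H\<^esub> restr A \<Phi>"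
    proof (rule H_eqI)
      fix \<beta> assume \<beta>: "\<beta> \<in> space M"
      interpret B: complex_inner_space "F \<beta>" by (rule fiber[OF \<beta>])
      show "rep (restr (insert \<alpha> A) \<Phi>) \<beta> = rep (restr {\<alpha>} \<Phi> \<oplus>\<^bsub>H\<^esub> restr A \<Phi>) \<beta>"
        using \<Phi>H \<beta> insert(2) by (cases "\<alpha> = \<beta>") (simp_all add: restriction_proj H_add)
    qed (use \<Phi>H in \<open>simp_all add: restriction_proj H_add\<close>)
    then show ?case
      using S.form_closure_add[OF sub D atom_cl insert.IH] insert.prems by simp
  qed
  have "(\<lambda>n. S.energy (restr (tail n) \<Phi>)) \<longlonglongrightarrow> 0"
    unfolding energy_restr[OF \<Phi>H] using \<Phi> S.energy_finite_iff[OF \<Phi>H]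
    by (intro tendsto_nn_integral_tail) (simp add: energy_H[OF \<Phi>H])
  then have lim: "(\<lambda>n. S.energy (\<Phi> \<ominus>\<^bsub>H\<^esub> restr (space M - tail n) \<Phi>)) \<longlonglongrightarrow> 0"
    using restr_diff[OF \<Phi>H, of "space M - tail _" "space M"]
    by (simp add: restr_space[OF \<Phi>H] double_diff)
  \<comment> \<open>Outside tail n only indices below n remain, and the enumeration is injective, so
    finitely many atoms are involved.\<close>
  have head: "restr (space M - tail n) \<Phi> \<in> S.form_closure D" for n
  proof (rule fin_cl)
    have "to_nat_on (space M) ` (space M - tail n) \<subseteq> {..<n}" by auto
    then have "finite (to_nat_on (space M) ` (space M - tail n))"
      by (rule finite_subset) simp
    then show "finite (space M - tail n)"
      by (rule finite_imageD) (rule inj_on_subset[OF inj_on_to_nat_on[OF countable_space]], blast)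
  qed blast
  show "\<Phi> \<in> S.form_closure D"
  proof (rule S.form_closure_closed[OF D \<Phi>])
    fix \<epsilon> :: real assume "\<epsilon> > 0"
    then have "\<forall>\<^sub>F n in sequentially. S.energy (\<Phi> \<ominus>\<^bsub>H\<^esub> restr (space M - tail n) \<Phi>) < ennreal \<epsilon>"
      using lim by (intro order_tendstoD) auto
    then obtain n where "S.energy (\<Phi> \<ominus>\<^bsub>H\<^esub> restr (space M - tail n) \<Phi>) < ennreal \<epsilon>"
      by (auto simp: eventually_sequentially)
    with head show "\<exists>\<Psi>\<in>S.form_closure D. S.energy (\<Phi> \<ominus>\<^bsub>H\<^esub> \<Psi>) < ennreal \<epsilon>" by blast
  qed
qed

end

theorem theorem4p4:
  fixes M :: "'a measure"
    and F :: "'a \<Rightarrow> 'v hilbert"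
    and e :: "nat \<Rightarrow> 'a \<Rightarrow> 'v"
    and H :: "('a \<Rightarrow> 'v) set hilbert"
    and D :: "('a \<Rightarrow> 'v) set set"
    and Q :: "('a \<Rightarrow> 'v) set \<Rightarrow> real"
    and Tf :: "'a \<Rightarrow> ('v \<rightharpoonup> 'v)"
    and Ef :: "'a \<Rightarrow> real set \<Rightarrow> 'v \<Rightarrow> 'v"
    and E :: "real set \<Rightarrow> ('a \<Rightarrow> 'v) set \<Rightarrow> ('a \<Rightarrow> 'v) set"
    and T :: "('a \<Rightarrow> 'v) set \<rightharpoonup> ('a \<Rightarrow> 'v) set"
  assumes sigma_finite: "sigma_finite_measure M"
    and field: "measurable_field M F e"
    and H: "H = direct_integral M F e"
    and Q: "hermitian_quadratic_form H D Q"
    and H1: "closable_form H D Q" "orthogonally_additive M F e D Q"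
    and H2: "point_supported M" "\<forall>\<alpha>\<in>space M. emeasure M {\<alpha>} > 0"
    and H3: "\<forall>\<alpha>\<in>space M. strongly_representable (F \<alpha>)
               (fiber_domain D \<alpha>) (fiber_form M F e D Q \<alpha>) (Tf \<alpha>) (Ef \<alpha>)"
    and E: "E = (\<lambda>\<sigma>. decomposable_operator M F e (\<lambda>\<alpha>. Ef \<alpha> \<sigma>))"
    and T: "T = spectral_integral H E (\<lambda>t. t)"
    and D: "D \<subseteq> dom (sqrt_abs_operator H E)"
  shows "strongly_representable H D Q T E \<and>
    (\<forall>D' Q'. strong_representation H D Q T E D' Q' \<longrightarrow>
      D' = dom (sqrt_abs_operator H E) \<and>
      (\<forall>\<Phi>\<in>D'.
        complex_of_real (Q' \<Phi>) =
          cinner H (the (sqrt_abs_operator H E \<Phi>))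
            (sgn_operator H E (the (sqrt_abs_operator H E \<Phi>))) \<and>
        Q' \<Phi> = (\<integral>t. t \<partial>spectral_measure H E \<Phi>)))"
proof -
  interpret field: measurable_field M F e by (rule field)
  interpret atomic_field M F e
  proof
    show "sets M = Pow (space M)" "countable (space M)"
      using H2(1) by (auto simp: point_supported_def)
    fix \<alpha> assume \<alpha>: "\<alpha> \<in> space M"
    then show "emeasure M {\<alpha>} > 0" using H2(2) by blast
    \<comment> \<open>Finiteness of the atoms: each lies in some member of a cover by sets of finite
      measure.\<close>
    obtain A where A: "A \<subseteq> sets M" "\<Union>A = space M" "\<And>a. a \<in> A \<Longrightarrow> emeasure M a \<noteq> \<infinity>"
      using sigma_finite unfolding sigma_finite_measure_def by blast
    then obtain a where "a \<in> A" "\<alpha> \<in> a" using \<alpha> by blast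
    moreover from this A(1) have "emeasure M {\<alpha>} \<le> emeasure M a"
      by (intro emeasure_mono) auto
    ultimately show "emeasure M {\<alpha>} < \<infinity>"
      using A(3) by (auto simp: less_top intro: le_less_trans)
  qed
  interpret additive_form M F e D Q
    by unfold_locales (use Q H1 in \<open>simp_all add: H\<close>)
  have rep: "\<exists>D' Q'. strong_representation (F \<alpha>) (fiber_domain D \<alpha>) (fiber_form M F e D Q \<alpha>)
      (Tf \<alpha>) (Ef \<alpha>) D' Q'" if "\<alpha> \<in> space M" for \<alpha>
    using H3 that by (simp add: strongly_representable_def)
  interpret R: atomic_resolution M F e Ef
  proof
    fix \<alpha> assume "\<alpha> \<in> space M"
    from rep[OF this] show "projection_valued_measure (F \<alpha>) (Ef \<alpha>)"
      unfolding strong_representation_def resolution_of_identity_def by blast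
  qed
  have D_dom: "D \<subseteq> R.S.form_dom"
    using D by (simp only: sqrt_abs_operator_def E H)
  have fiber_D: "fiber_domain D \<alpha> \<subseteq> R.fiber_form_dom \<alpha>" if "\<alpha> \<in> space M" for \<alpha>
    using rep[OF that] unfolding strong_representation_def by blast
  have fiber_cl: "spectral_resolution.form_closure (F \<alpha>) (Ef \<alpha>) (fiber_domain D \<alpha>) = R.fiber_form_dom \<alpha>"
    if \<alpha>: "\<alpha> \<in> space M" for \<alpha>
  proof -
    interpret A: spectral_resolution "F \<alpha>" "Ef \<alpha>" by (rule R.fiber_resolution[OF \<alpha>])
    obtain D' Q' where r: "strong_representation (F \<alpha>) (fiber_domain D \<alpha>) (fiber_form M F e D Q \<alpha>)
        (Tf \<alpha>) (Ef \<alpha>) D' Q'" using rep[OF \<alpha>] by blast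
    have D': "D' = A.form_closure (fiber_domain D \<alpha>)"
      using r unfolding strong_representation_def A.form_closure_def sqrt_abs_operator_def by blast
    have "Tf \<alpha> = spectral_integral (F \<alpha>) (Ef \<alpha>) (\<lambda>t. t)" "dom (Tf \<alpha>) \<subseteq> D'"
      using r unfolding strong_representation_def resolution_of_identity_def by blast+
    \<comment> \<open>Condition (1) of representability puts the operator domain inside the
      extension domain, which condition (2) identifies with the closure; density of the operator
      domain then fills the fiber form domain.\<close>
    then have "A.spec_dom (\<lambda>t. t) \<subseteq> A.form_closure (fiber_domain D \<alpha>)"
      by (simp only: D')
    from A.form_closure_eq_form_dom[OF fiber_D[OF \<alpha>, unfolded sqrt_abs_operator_def] this]
    show ?thesis by (simp only: sqrt_abs_operator_def)
  qed
  have closure: "R.S.form_closure D = R.S.form_dom"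
  proof (rule R.form_closure_H[OF D_submodule D_dom _ fiber_cl fiber_D])
    show "restr {\<alpha>} \<Phi> \<in> D" if "\<alpha> \<in> space M" "\<Phi> \<in> D" for \<alpha> \<Phi>
      using that by (intro restr_D) auto
  qed
  have Q_eq: "(\<integral>t. t \<partial>spectral_measure H E \<Phi>) = Q \<Phi>" if \<Phi>: "\<Phi> \<in> D" for \<Phi>
  proof -
    have \<Phi>d: "\<Phi> \<in> R.S.form_dom" using D_dom \<Phi> by (rule subsetD)
    have "Q \<Phi> = (\<integral>\<alpha>. (\<integral>t. t \<partial>spectral_measure (F \<alpha>) (Ef \<alpha>) (rep \<Phi> \<alpha>)) \<partial>M)"
    \<comment> \<open>The integrability demanded here is where the inclusion of \<open>D\<close> in
      the form domain of T is used.\<close>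
    proof (rule Q_eq_integral[OF \<Phi> R.integral_spectral_measure_H(1)[OF \<Phi>d]])
      fix \<alpha> assume \<alpha>: "\<alpha> \<in> space M"
      obtain D' Q' where r: "strong_representation (F \<alpha>) (fiber_domain D \<alpha>)
          (fiber_form M F e D Q \<alpha>) (Tf \<alpha>) (Ef \<alpha>) D' Q'" using rep[OF \<alpha>] by blast
      have "rep \<Phi> \<alpha> \<in> fiber_domain D \<alpha>" using \<Phi> by (auto simp: fiber_domain_def)
      with r show "fiber_form M F e D Q \<alpha> (rep \<Phi> \<alpha>) =
          (\<integral>t. t \<partial>spectral_measure (F \<alpha>) (Ef \<alpha>) (rep \<Phi> \<alpha>))"
        unfolding strong_representation_def form_extends_def by (metis subsetD)
    qed
    with R.integral_spectral_measure_H(2)[OF \<Phi>d] show ?thesis by (simp only: E H)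
  qed
  have "strong_representation H D Q T E R.S.form_dom (\<lambda>\<Phi>. \<integral>t. t \<partial>spectral_measure H E \<Phi>)"
    unfolding strong_representation_def
  proof (intro conjI)
    show "self_adjoint H T"
      unfolding T E H by (rule R.S.self_adjoint_spectral_integral) simp
    show "resolution_of_identity H E T"
      unfolding resolution_of_identity_def T using R.pvm_H by (simp add: E H)
    show "form_extends H R.S.form_dom (\<lambda>\<Phi>. \<integral>t. t \<partial>spectral_measure H E \<Phi>) D Q"
      unfolding form_extends_def
      using R.S.hermitian_quadratic_form_spectral D_dom Q_eq by (simp only: E H) blast
    show "dom T \<subseteq> R.S.form_dom"
      unfolding T E H by (rule R.S.spec_dom_subset_form_dom)
    show "D \<subseteq> dom (sqrt_abs_operator H E)" by (rule D)
    show "R.S.form_dom = {x \<in> dom (sqrt_abs_operator H E).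
        \<forall>\<epsilon>>0. \<exists>y\<in>D. spectral_norm H E (x \<ominus>\<^bsub>H\<^esub> y) < \<epsilon>}"
      using closure unfolding R.S.form_closure_def sqrt_abs_operator_def E H by (rule sym)
  qed simp
  then have "strongly_representable H D Q T E"
    unfolding strongly_representable_def by blast
  moreover have "D' = dom (sqrt_abs_operator H E) \<and>
      (\<forall>\<Phi>\<in>D'.
        complex_of_real (Q' \<Phi>) =
          cinner H (the (sqrt_abs_operator H E \<Phi>))
            (sgn_operator H E (the (sqrt_abs_operator H E \<Phi>))) \<and>
        Q' \<Phi> = (\<integral>t. t \<partial>spectral_measure H E \<Phi>))"
    if r: "strong_representation H D Q T E D' Q'" for D' Q'
  proof -
    \<comment> \<open>Any representing pair has its domain fixed as a closure and its values fixed
      by the spectral integral, so the formulas hold for every pair and not only for the one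
      constructed above.\<close>
    have "D' = R.S.form_closure D"
      using r unfolding strong_representation_def R.S.form_closure_def sqrt_abs_operator_def E H
      by blast
    then have D': "D' = R.S.form_dom" by (simp only: closure)
    have Q': "Q' \<Phi> = (\<integral>t. t \<partial>spectral_measure H E \<Phi>)" if "\<Phi> \<in> D'" for \<Phi>
      using r that unfolding strong_representation_def by blast
    show ?thesis
      using D' Q' R.S.cinner_sgn_operator unfolding sqrt_abs_operator_def E H by simp
  qed
  ultimately show ?thesis by blast
qed

end
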